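(* (In ZFC.) The \(E\)-order is transitive: if \(U_0,U_1,U_2\) are uniform ultrafilters with \(U_0\leq_E U_1\) and \(U_1\leq_E U_2\), then \(U_0\leq_E U_2\).
   Context: For a countably complete ultrafilter \(U\), \(\mathrm{Ult}(V,U)\) is the transitive collapse of the ultrapower, \(j_U\) its embedding, \([\mathrm{id}]_U\) the class of the identity. A uniform ultrafilter is a countably complete ultrafilter \(U\) on \([\kappa]^n\) (the \(n\)-element subsets of an ordinal \(\kappa\)) with \(\kappa\) least such that \([\kappa]^n\in U\). Finite sets of ordinals are ordered by \(a<b\) iff the largest element of their symmetric difference lies in \(b\). An external comparison of \(\langle U_0,U_1\rangle\) is a pair \(\langle W_0,W_1\rangle\) where each \(W_i\) is an ultrafilter on the subsets of some set lying in \(\mathrm{Ult}(V,U_i)\) (not necessarily an element of \(\mathrm{Ult}(V,U_i)\)) which \((\mathrm{Ult}(V,U_i),W_i)\) thinks is countably complete, the ultrapowers \(\mathrm{Ult}(\mathrm{Ult}(V,U_i),W_i)\) formed with functions in \(\mathrm{Ult}(V,U_i)\) are equal (and wellfounded), and \(j_{W_0}\circ j_{U_0}=j_{W_1}\circ j_{U_1}\). It is \(1\)-internal if \(W_1\in\mathrm{Ult}(V,U_1)\). For uniform \(U_0,U_1\), \(U_0\leq_E U_1\) iff there is a \(1\)-internal external comparison \(\langle W_0,W_1\rangle\) of \(\langle U_0,U_1\rangle\) with \(j_{W_0}([\mathrm{id}]_{U_0})\leq j_{W_1}([\mathrm{id}]_{U_1})\). *)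

theory Defs
  imports Main
begin

text \<open>
  The ambient theory is first-order ZFC: the universe \<open>V\<close> is an arbitrary type \<open>'v\<close> with a
  binary relation satisfying the axioms, where the two schemes range over the formulas of the
  language of set theory, with parameters. The relation need not be wellfounded or
  \<open>\<omega>\<close>-standard from the outside, so every notion below is internal to the model: it quantifies over
  elements of \<open>'v\<close> only. Proper classes, such as ultrapowers of \<open>V\<close>, are values of type
  \<open>'v set\<close> given by such internal descriptions.
\<close>

datatype fm = Mem nat nat | Eql nat nat | Neg fm | Conj fm fm | All nat fm

primrec sat :: "('v \<Rightarrow> 'v \<Rightarrow> bool) \<Rightarrow> (nat \<Rightarrow> 'v) \<Rightarrow> fm \<Rightarrow> bool" where
  "sat E s (Mem i j) \<longleftrightarrow> E (s i) (s j)"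
| "sat E s (Eql i j) \<longleftrightarrow> s i = s j"
| "sat E s (Neg p) \<longleftrightarrow> \<not> sat E s p"
| "sat E s (Conj p q) \<longleftrightarrow> sat E s p \<and> sat E s q"
| "sat E s (All i p) \<longleftrightarrow> (\<forall>x. sat E (s(i := x)) p)"

locale membership =
  fixes mem :: "'v \<Rightarrow> 'v \<Rightarrow> bool"  (infix "\<^bold>\<in>" 50)
begin

definition elts :: "'v \<Rightarrow> 'v set" where
  "elts x = {u. u \<^bold>\<in> x}"

text \<open>Only meaningful when the class \<open>A\<close> is a set of the model.\<close>

definition setof :: "'v set \<Rightarrow> 'v" where
  "setof A = (THE x. elts x = A)"

definition pair :: "'v \<Rightarrow> 'v \<Rightarrow> 'v" where
  "pair a b = setof {setof {a}, setof {a, b}}"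

definition is_fun :: "'v \<Rightarrow> 'v \<Rightarrow> bool" where
  "is_fun f X \<longleftrightarrow> (\<forall>p \<in> elts f. \<exists>x \<in> elts X. \<exists>y. p = pair x y)
                \<and> (\<forall>x \<in> elts X. \<exists>!y. pair x y \<in> elts f)"

definition app :: "'v \<Rightarrow> 'v \<Rightarrow> 'v" where
  "app f x = (THE y. pair x y \<in> elts f)"

definition transitive :: "'v \<Rightarrow> bool" where
  "transitive x \<longleftrightarrow> (\<forall>y \<in> elts x. elts y \<subseteq> elts x)"

text \<open>By Foundation, these are exactly the von Neumann ordinals.\<close>

definition ordinal :: "'v \<Rightarrow> bool" where
  "ordinal x \<longleftrightarrow> transitive x \<and> (\<forall>y \<in> elts x. transitive y)"

definition natural :: "'v \<Rightarrow> bool" where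
  "natural n \<longleftrightarrow> ordinal n \<and>
     (\<forall>m \<in> insert n (elts n). elts m = {} \<or> (\<exists>k. elts m = insert k (elts k)))"

definition omega :: 'v where
  "omega = setof {n. natural n}"

definition subsets_of_size :: "'v \<Rightarrow> 'v \<Rightarrow> 'v" where
  "subsets_of_size \<kappa> n =
     setof {a. elts a \<subseteq> elts \<kappa> \<and> (\<exists>f. is_fun f n \<and> bij_betw (app f) (elts n) (elts a))}"

text \<open>
  For a transitive class \<open>M\<close> (the whole universe, or an ultrapower of it) and \<open>X \<in> M\<close>: \<open>W\<close>, a set of
  the universe that need not belong to \<open>M\<close>, is an ultrafilter on the subsets of \<open>X\<close> lying in \<open>M\<close>
  which \<open>(M, W)\<close> thinks is countably complete. For \<open>M = UNIV\<close> this is an ordinary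
  countably complete (possibly principal) ultrafilter on \<open>X\<close>.
\<close>

definition cc_ultrafilter :: "'v set \<Rightarrow> 'v \<Rightarrow> 'v \<Rightarrow> bool" where
  "cc_ultrafilter M X W \<longleftrightarrow>
     X \<in> M \<and>
     (\<forall>A \<in> elts W. A \<in> M \<and> elts A \<subseteq> elts X) \<and>
     X \<in> elts W \<and>
     setof {} \<notin> elts W \<and>
     (\<forall>A \<in> elts W. \<forall>B \<in> M. elts A \<subseteq> elts B \<and> elts B \<subseteq> elts X \<longrightarrow> B \<in> elts W) \<and>
     (\<forall>A \<in> elts W. \<forall>B \<in> elts W. setof (elts A \<inter> elts B) \<in> elts W) \<and>
     (\<forall>A \<in> M. elts A \<subseteq> elts X \<longrightarrow> A \<in> elts W \<or> setof (elts X - elts A) \<in> elts W) \<and>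
     (\<forall>f \<in> M. is_fun f omega \<and> (\<forall>n \<in> elts omega. app f n \<in> elts W) \<longrightarrow>
        setof {x \<in> elts X. \<forall>n \<in> elts omega. x \<in> elts (app f n)} \<in> elts W)"

definition uniform_ultrafilter :: "'v \<Rightarrow> bool" where
  "uniform_ultrafilter U \<longleftrightarrow>
     (\<exists>\<kappa> n. ordinal \<kappa> \<and> n \<in> elts omega \<and>
        cc_ultrafilter UNIV (subsets_of_size \<kappa> n) U \<and>
        (\<forall>\<alpha> \<in> elts \<kappa>. subsets_of_size \<alpha> n \<notin> elts U))"

text \<open>The underlying set of an ultrafilter is its union.\<close>

definition base :: "'v \<Rightarrow> 'v" where
  "base W = setof (\<Union>A \<in> elts W. elts A)"

definition ult_funs :: "'v set \<Rightarrow> 'v \<Rightarrow> 'v set" where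
  "ult_funs M W = {f \<in> M. is_fun f (base W)}"

definition ult_eq :: "'v \<Rightarrow> 'v \<Rightarrow> 'v \<Rightarrow> bool" where
  "ult_eq W f g \<longleftrightarrow> setof {x \<in> elts (base W). app f x = app g x} \<in> elts W"

definition ult_mem :: "'v \<Rightarrow> 'v \<Rightarrow> 'v \<Rightarrow> bool" where
  "ult_mem W f g \<longleftrightarrow> setof {x \<in> elts (base W). app f x \<^bold>\<in> app g x} \<in> elts W"

definition ult_wellfounded :: "'v set \<Rightarrow> 'v \<Rightarrow> bool" where
  "ult_wellfounded M W \<longleftrightarrow>
     (\<forall>D. elts D \<noteq> {} \<and> elts D \<subseteq> ult_funs M W \<longrightarrow>
        (\<exists>f \<in> elts D. \<forall>g \<in> elts D. \<not> ult_mem W g f))"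

text \<open>
  The transitive collapse of the ultrapower is the class function \<open>\<pi>\<close> on \<open>ult_funs M W\<close> with
  \<open>\<pi> f = {\<pi> g | g. ult_mem W g f}\<close>. As usual in ZFC it is obtained by gluing set-sized partial
  solutions \<open>h\<close>. The equivalence classes of functions may be proper classes, so the domain \<open>D\<close> of
  \<open>h\<close> is only required to be closed under predecessors up to \<open>ult_eq\<close>; by Foundation any two partial
  solutions agree on equivalent arguments.
\<close>

definition partial_collapse :: "'v set \<Rightarrow> 'v \<Rightarrow> 'v \<Rightarrow> 'v \<Rightarrow> bool" where
  "partial_collapse M W D h \<longleftrightarrow>
     elts D \<subseteq> ult_funs M W \<and> is_fun h D \<and>
     (\<forall>f \<in> elts D. \<forall>g \<in> ult_funs M W. ult_mem W g f \<longrightarrow> (\<exists>g' \<in> elts D. ult_eq W g g')) \<and>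
     (\<forall>f \<in> elts D. elts (app h f) = {app h g | g. g \<in> elts D \<and> ult_mem W g f})"

text \<open>The element \<open>[f]\<^sub>W\<close> of the collapsed ultrapower of \<open>M\<close>, formed with functions in \<open>M\<close>.\<close>

definition ult_class :: "'v set \<Rightarrow> 'v \<Rightarrow> 'v \<Rightarrow> 'v" where
  "ult_class M W f = (THE y. \<exists>D h. partial_collapse M W D h \<and> f \<in> elts D \<and> y = app h f)"

definition Ult :: "'v set \<Rightarrow> 'v \<Rightarrow> 'v set" where
  "Ult M W = ult_class M W ` ult_funs M W"

definition ult_emb :: "'v set \<Rightarrow> 'v \<Rightarrow> 'v \<Rightarrow> 'v" where
  "ult_emb M W x = ult_class M W (setof {pair z x | z. z \<in> elts (base W)})"

definition ult_id :: "'v set \<Rightarrow> 'v \<Rightarrow> 'v" where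
  "ult_id M W = ult_class M W (setof {pair z z | z. z \<in> elts (base W)})"

definition external_comparison :: "'v \<Rightarrow> 'v \<Rightarrow> 'v \<Rightarrow> 'v \<Rightarrow> bool" where
  "external_comparison U0 U1 W0 W1 \<longleftrightarrow>
     (let M0 = Ult UNIV U0; M1 = Ult UNIV U1 in
        (\<exists>X. cc_ultrafilter M0 X W0) \<and> (\<exists>X. cc_ultrafilter M1 X W1) \<and>
        ult_wellfounded M0 W0 \<and> ult_wellfounded M1 W1 \<and>
        Ult M0 W0 = Ult M1 W1 \<and>
        ult_emb M0 W0 \<circ> ult_emb UNIV U0 = ult_emb M1 W1 \<circ> ult_emb UNIV U1)"

definition one_internal :: "'v \<Rightarrow> 'v \<Rightarrow> bool" where
  "one_internal U1 W1 \<longleftrightarrow> W1 \<in> Ult UNIV U1"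

text \<open>Meant for finite sets of ordinals; there \<open>z \<^bold>\<in> m\<close> says that \<open>z\<close> is below \<open>m\<close>.\<close>

definition fin_less :: "'v \<Rightarrow> 'v \<Rightarrow> bool" where
  "fin_less a b \<longleftrightarrow>
     (\<exists>m \<in> elts b - elts a. \<forall>z \<in> (elts a - elts b) \<union> (elts b - elts a). z = m \<or> z \<^bold>\<in> m)"

definition fin_le :: "'v \<Rightarrow> 'v \<Rightarrow> bool" where
  "fin_le a b \<longleftrightarrow> fin_less a b \<or> a = b"

definition E_le :: "'v \<Rightarrow> 'v \<Rightarrow> bool" where
  "E_le U0 U1 \<longleftrightarrow>
     (\<exists>W0 W1. external_comparison U0 U1 W0 W1 \<and> one_internal U1 W1 \<and>
        fin_le (ult_emb (Ult UNIV U0) W0 (ult_id UNIV U0))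
               (ult_emb (Ult UNIV U1) W1 (ult_id UNIV U1)))"

end

text \<open>
  In the schemes, variable \<open>0\<close> (and \<open>1\<close> in Replacement) is the distinguished one; the remaining
  values of the assignment \<open>s\<close> are the parameters.
\<close>

locale ZFC_model = membership +
  assumes extensionality: "\<And>x y. elts x = elts y \<Longrightarrow> x = y"
    and foundation: "\<And>x. elts x \<noteq> {} \<Longrightarrow> \<exists>y \<in> elts x. elts y \<inter> elts x = {}"
    and pairing: "\<And>x y. \<exists>z. elts z = {x, y}"
    and union: "\<And>x. \<exists>z. elts z = (\<Union>y \<in> elts x. elts y)"
    and power_set: "\<And>x. \<exists>z. elts z = {u. elts u \<subseteq> elts x}"
    and infinity: "\<exists>w. (\<exists>e \<in> elts w. elts e = {}) \<and>
                       (\<forall>x \<in> elts w. \<exists>y \<in> elts w. elts y = insert x (elts x))"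
    and separation: "\<And>p s x. \<exists>z. elts z = {u \<in> elts x. sat mem (s(0 := u)) p}"
    and replacement: "\<And>p s x. (\<forall>u \<in> elts x. \<exists>!v. sat mem (s(0 := u, 1 := v)) p) \<Longrightarrow>
                        \<exists>z. elts z = {v. \<exists>u \<in> elts x. sat mem (s(0 := u, 1 := v)) p}"
    and choice: "\<And>x. (\<forall>y \<in> elts x. elts y \<noteq> {}) \<Longrightarrow>
                   (\<forall>y \<in> elts x. \<forall>z \<in> elts x. y \<noteq> z \<longrightarrow> elts y \<inter> elts z = {}) \<Longrightarrow>
                   \<exists>c. \<forall>y \<in> elts x. \<exists>!z. z \<in> elts y \<inter> elts c"

end

theory Submission
  imports Defs
begin

text \<open>
  External comparisons of \<open>U0\<close> and \<open>U1\<close> amount to countably complete ultrafilters \<open>F\<close> of the universe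
  that project to both: if \<open>W\<close> is an external ultrafilter of \<open>Ult V U\<close>, then the ultrapower of \<open>Ult V U\<close>
  by \<open>W\<close> is \<open>Ult V F\<close> for \<open>F = {A. [x \<mapsto> A\<^sub>x]\<^sub>U \<in> W}\<close>, and every \<open>F\<close> that projects to \<open>U\<close> arises in this
  way. The comparison is 1-internal iff \<open>F\<close> is the sum of ultrafilters \<open>w x\<close> along \<open>U1\<close>. Pushing
  the \<open>w x\<close> forward, \<open>U0 \<le>\<^sub>E U1\<close> holds iff \<open>U0\<close> is the \<open>U1\<close>-limit of countably complete ultrafilters \<open>w x\<close>
  with \<open>{z. z \<le> x} \<in> w x\<close> for almost all \<open>x\<close>. In this form transitivity is clear: if \<open>U1\<close> is the
  \<open>U2\<close>-limit of \<open>v x\<close>, then \<open>U0\<close> is the \<open>U2\<close>-limit of the \<open>v x\<close>-limits of \<open>w\<close>.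

  Elements of ultrapowers are handled through the functions that represent them, so neither the
  theorem of Los for arbitrary formulas nor relativization to an ultrapower is needed.
\<close>

section \<open>Definable predicates\<close>

text \<open>The two sides of a comparison are never matched function by function; they meet in one
  point. Both iterated ultrapowers are ultrapowers of the universe, by \<open>F0\<close> and by
  \<open>F\<close> say. As they coincide, the image of the identity class of \<open>U0\<close> is
  the class of some \<open>g0\<close> modulo \<open>F\<close>, and as the embeddings agree,
  \<open>U0\<close> is the ultrafilter derived from that point: \<open>A\<close> is in
  \<open>U0\<close> iff \<open>g0 \<sigma>\<close> is in \<open>A\<close> for
  \<open>F\<close>-almost all \<sigma>. So the fibres of \<open>F\<close> need only be pushed
  forward along \<open>g0\<close>. Conversely, one sum \<open>F\<close> on pairs serves both sides,
  read over its first or over its second coordinate. Two obstacles shape the rest. An ultrapower is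
  a proper class of collapsed values, so collapses are computed on sets of functions into a
  transitive bound, and subsets of the base of an external ultrafilter are reached through their
  fibres (\<open>Sec\<close>). And the model may be nonstandard, so choice, recursion and induction
  must be internal: each predicate they are applied to has to be shown definable.\<close>

text \<open>
  \<open>Dfn\<close> holds of the predicates of environments, and \<open>DT\<close> of the terms, that are defined by a formula with
  parameters. Parameters are constant functions of the environment, and quantifiers extend it at
  the front, so that definability is proved by resolution with introduction rules.
\<close>

definition basic :: "((nat \<Rightarrow> 'v) \<Rightarrow> 'v) \<Rightarrow> bool" where
  "basic t \<longleftrightarrow> (\<exists>i. t = (\<lambda>s. s i)) \<or> (\<exists>c. t = (\<lambda>s. c))"

inductive Dfn :: "('v \<Rightarrow> 'v \<Rightarrow> bool) \<Rightarrow> ((nat \<Rightarrow> 'v) \<Rightarrow> bool) \<Rightarrow> bool" for E where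
  Dfn_atom_mem: "basic t \<Longrightarrow> basic u \<Longrightarrow> Dfn E (\<lambda>s. E (t s) (u s))"
| Dfn_atom_eq: "basic t \<Longrightarrow> basic u \<Longrightarrow> Dfn E (\<lambda>s. t s = u s)"
| Dfn_not: "Dfn E P \<Longrightarrow> Dfn E (\<lambda>s. \<not> P s)"
| Dfn_conj: "Dfn E P \<Longrightarrow> Dfn E Q \<Longrightarrow> Dfn E (\<lambda>s. P s \<and> Q s)"
| Dfn_all_env: "Dfn E P \<Longrightarrow> Dfn E (\<lambda>s. \<forall>x. P (case_nat x s))"

section \<open>Translation of definable predicates into formulas\<close>

primrec rename :: "(nat \<Rightarrow> nat) \<Rightarrow> fm \<Rightarrow> fm" where
  "rename f (Mem i j) = Mem (f i) (f j)"
| "rename f (Eql i j) = Eql (f i) (f j)"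
| "rename f (Neg p) = Neg (rename f p)"
| "rename f (Conj p q) = Conj (rename f p) (rename f q)"
| "rename f (All i p) = All (f i) (rename f p)"

text \<open>Bound variables are renamed too. Injectivity prevents capture: an update at
  \<open>f i\<close> must be visible at \<open>i\<close> alone.\<close>

lemma sat_rename: "inj f \<Longrightarrow> sat E e (rename f p) \<longleftrightarrow> sat E (e \<circ> f) p"
proof (induction p arbitrary: e)
  case (All i p)
  have "(e(f i := x)) \<circ> f = (e \<circ> f)(i := x)" for x
    using All.prems by (auto simp: fun_eq_iff inj_eq)
  then show ?case by (simp only: rename.simps sat.simps All.IH[OF All.prems])
qed auto

text \<open>
  Formula variables are split by their residue modulo 3: residue 0 carries the environment,
  residue 1 the parameters, and residue 2 is left unused, which makes room for bound variables.
\<close>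

definition env_agrees :: "(nat \<Rightarrow> 'v) \<Rightarrow> (nat \<Rightarrow> 'v) \<Rightarrow> (nat \<Rightarrow> 'v) \<Rightarrow> bool" where
  "env_agrees s r e \<longleftrightarrow> (\<forall>i. e (3 * i) = s i) \<and> (\<forall>i. e (3 * i + 1) = r i)"

text \<open>A variable \<open>s k\<close> is read at \<open>3 * k\<close>; a constant is stored as
  parameter number \<open>n\<close>. The free choice of \<open>n\<close> lets the two terms of an
  atom use different slots.\<close>

lemma basic_index:
  assumes "basic t"
  shows "\<exists>i c. \<forall>s r e. env_agrees s r e \<longrightarrow> r n = c \<longrightarrow> e i = t s"
  using assms unfolding basic_def env_agrees_def by metis

lemma Dfn_formula:
  assumes "Dfn E P"
  shows "\<exists>p r. \<forall>s e. env_agrees s r e \<longrightarrow> (sat E e p \<longleftrightarrow> P s)"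
  using assms
proof induction
  case (Dfn_atom_mem t u)
  obtain i c where 1: "\<forall>s r e. env_agrees s r e \<longrightarrow> r 0 = c \<longrightarrow> e i = t s"
    using basic_index[OF Dfn_atom_mem(1), of 0] by (elim exE)
  obtain j d where 2: "\<forall>s r e. env_agrees s r e \<longrightarrow> r 1 = d \<longrightarrow> e j = u s"
    using basic_index[OF Dfn_atom_mem(2), of 1] by (elim exE)
  show ?case
  proof (intro exI allI impI)
    fix s e assume "env_agrees s (\<lambda>n. if n = 0 then c else d) e"
    with 1 2 show "sat E e (Mem i j) \<longleftrightarrow> E (t s) (u s)" by simp
  qed
next
  case (Dfn_atom_eq t u)
  obtain i c where 1: "\<forall>s r e. env_agrees s r e \<longrightarrow> r 0 = c \<longrightarrow> e i = t s"
    using basic_index[OF Dfn_atom_eq(1), of 0] by (elim exE)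
  obtain j d where 2: "\<forall>s r e. env_agrees s r e \<longrightarrow> r 1 = d \<longrightarrow> e j = u s"
    using basic_index[OF Dfn_atom_eq(2), of 1] by (elim exE)
  show ?case
  proof (intro exI allI impI)
    fix s e assume "env_agrees s (\<lambda>n. if n = 0 then c else d) e"
    with 1 2 show "sat E e (Eql i j) \<longleftrightarrow> t s = u s" by simp
  qed
next
  case (Dfn_not P)
  then obtain p r where "\<forall>s e. env_agrees s r e \<longrightarrow> (sat E e p \<longleftrightarrow> P s)" by blast
  then show ?case by (intro exI[of _ "Neg p"] exI[of _ r]) auto
next
  case (Dfn_conj P Q)
  then obtain p q r1 r2
    where p: "\<And>s e. env_agrees s r1 e \<Longrightarrow> sat E e p \<longleftrightarrow> P s"
      and q: "\<And>s e. env_agrees s r2 e \<Longrightarrow> sat E e q \<longleftrightarrow> Q s" by blast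
  \<comment> \<open>\<open>f k\<close> fixes environment and spare variables and moves parameter
    \<open>n\<close> to slot \<open>2 * n + k\<close>. Thus the conjuncts draw on the even and on
    the odd parameters, and their parameter lists cannot collide.\<close>
  define f where "f k n = (if n mod 3 = 1 then 3 * (2 * (n div 3) + k) + 1 else n)" for k n :: nat
  have inj: "inj (f k)" for k
  proof (rule injI)
    fix x y assume eq: "f k x = f k y"
    have "(3 * m + 1) mod 3 = 1" for m :: nat by presburger
    then have "f k n mod 3 = n mod 3" for n unfolding f_def by presburger
    with eq have mod: "x mod 3 = y mod 3" by metis
    with eq have "x div 3 = y div 3" by (auto simp: f_def split: if_splits)
    with mod show "x = y" by (metis div_mult_mod_eq)
  qed
  define r where "r n = (if even n then r1 (n div 2) else r2 (n div 2))" for n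
  have a: "env_agrees s r1 (e \<circ> f 0)" "env_agrees s r2 (e \<circ> f 1)" if "env_agrees s r e" for s e
  proof -
    have e: "e (3 * i) = s i" "e (3 * i + 1) = r i" for i
      using that by (auto simp: env_agrees_def)
    have "f 0 (3 * i) = 3 * i" "f 0 (3 * i + 1) = 3 * (2 * i) + 1"
         "f 1 (3 * i) = 3 * i" "f 1 (3 * i + 1) = 3 * (2 * i + 1) + 1" for i
      by (simp_all add: f_def)
    then show "env_agrees s r1 (e \<circ> f 0)" "env_agrees s r2 (e \<circ> f 1)"
      by (simp_all only: env_agrees_def comp_apply e) (simp_all add: r_def)
  qed
  show ?case
  proof (intro exI allI impI)
    fix s e assume "env_agrees s r e"
    from p[OF a(1)[OF this]] q[OF a(2)[OF this]]
    show "sat E e (Conj (rename (f 0) p) (rename (f 1) q)) \<longleftrightarrow> P s \<and> Q s"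
      by (simp only: sat.simps sat_rename[OF inj])
  qed
next
  case (Dfn_all_env P)
  then obtain p r where p: "\<And>s e. env_agrees s r e \<Longrightarrow> sat E e p \<longleftrightarrow> P s" by blast
  \<comment> \<open>Variable 0, which holds the new front element, goes to the spare variable 2 and
    is quantified there. The remaining environment moves back by one place, and the spare variables
    move up by one place to free 2.\<close>
  define f :: "nat \<Rightarrow> nat" where
    "f n = (if n = 0 then 2 else if n mod 3 = 0 then n - 3 else if n mod 3 = 2 then n + 3 else n)" for n
  have inj: "inj f"
  proof (rule inj_on_inverseI)
    fix n :: nat
    show "(\<lambda>n. if n = 2 then 0 else if n mod 3 = 0 then n + 3 else if n mod 3 = 2 then n - 3 else n) (f n) = n"
    proof (cases "n = 0 \<or> n mod 3 \<noteq> 0")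
      case False
      then have "\<exists>k. n = 3 * Suc k" by (metis mod_0_imp_dvd dvd_def mult_0_right not0_implies_Suc)
      then obtain k where "n = 3 * Suc k" ..
      moreover have "3 * k \<noteq> 2" by presburger
      ultimately show ?thesis by (simp add: f_def)
    qed (auto simp: f_def)
  qed
  have "env_agrees (case_nat x s) r (e(2 := x) \<circ> f)" if "env_agrees s r e" for s e x
  proof -
    have e: "e (3 * i) = s i" "e (3 * i + 1) = r i" for i
      using that by (auto simp: env_agrees_def)
    have f: "f (3 * Suc i) = 3 * i" "f (3 * i + 1) = 3 * i + 1" "f 0 = 2" for i
      by (simp_all add: f_def)
    have ne: "3 * i \<noteq> 2" "3 * i + 1 \<noteq> 2" for i :: nat by presburger+
    have "(e(2 := x) \<circ> f) (3 * i) = case_nat x s i" for i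
    proof (cases i)
      case (Suc j)
      show ?thesis unfolding Suc by (simp only: comp_apply f fun_upd_apply ne if_False e nat.case)
    qed (simp add: f)
    moreover have "(e(2 := x) \<circ> f) (3 * i + 1) = r i" for i
      by (simp only: comp_apply f fun_upd_apply ne if_False e)
    ultimately show ?thesis by (simp add: env_agrees_def)
  qed
  note * = p[OF this]
  show ?case
  proof (intro exI allI impI)
    fix s e assume "env_agrees s r e"
    from *[OF this] show "sat E e (All 2 (rename f p)) \<longleftrightarrow> (\<forall>x. P (case_nat x s))"
      by (simp only: sat.simps sat_rename[OF inj])
  qed
qed

text \<open>Atoms accept basic terms only, so substituting variables and constants never leaves the
  syntax. Compound terms need a quantifier for their value, as in \<open>Dfn_subst\<close>.\<close>

lemma Dfn_subst_basic:
  assumes "Dfn E P" "\<And>i. basic (\<sigma> i)"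
  shows "Dfn E (\<lambda>s. P (\<lambda>i. \<sigma> i s))"
proof -
  have basic: "basic (\<lambda>s. t (\<lambda>i. \<sigma> i s))" if "basic t" "\<And>i. basic (\<sigma> i)" for t and \<sigma> :: "nat \<Rightarrow> (nat \<Rightarrow> 'a) \<Rightarrow> 'a"
    using that unfolding basic_def by auto
  from assms show ?thesis
  proof (induction arbitrary: \<sigma>)
    case (Dfn_all_env P)
    define \<tau> where "\<tau> i = (case i of 0 \<Rightarrow> (\<lambda>s :: nat \<Rightarrow> 'a. s 0) | Suc j \<Rightarrow> (\<lambda>s. \<sigma> j (\<lambda>n. s (Suc n))))" for i
    have "basic (\<tau> i)" for i
      using Dfn_all_env.prems unfolding \<tau>_def basic_def by (cases i) (auto, metis)
    then have "Dfn E (\<lambda>s. P (\<lambda>i. \<tau> i s))" by (rule Dfn_all_env.IH)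
    then have "Dfn E (\<lambda>s. \<forall>x. P (\<lambda>i. \<tau> i (case_nat x s)))" by (rule Dfn.Dfn_all_env)
    moreover have "(\<lambda>i. \<tau> i (case_nat x s)) = case_nat x (\<lambda>i. \<sigma> i s)" for x s
      by (auto simp: \<tau>_def fun_eq_iff split: nat.split)
    ultimately show ?case by simp
  next
    case (Dfn_atom_mem t u)
    show ?case
      using Dfn_atom_mem.hyps[THEN basic, OF Dfn_atom_mem.prems] by (rule Dfn.Dfn_atom_mem)
  next
    case (Dfn_atom_eq t u)
    show ?case
      using Dfn_atom_eq.hyps[THEN basic, OF Dfn_atom_eq.prems] by (rule Dfn.Dfn_atom_eq)
  next
    case (Dfn_not P)
    show ?case using Dfn_not.IH[OF Dfn_not.prems] by (rule Dfn.Dfn_not)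
  next
    case (Dfn_conj P Q)
    show ?case using Dfn_conj.IH[OF Dfn_conj.prems] by (rule Dfn.Dfn_conj)
  qed
qed

text \<open>The language has no function symbols, so a term is treated through its graph, with the
  value put in front of the environment.\<close>

definition DT :: "('v \<Rightarrow> 'v \<Rightarrow> bool) \<Rightarrow> ((nat \<Rightarrow> 'v) \<Rightarrow> 'v) \<Rightarrow> bool" where
  "DT E t \<longleftrightarrow> Dfn E (\<lambda>s. s 0 = t (\<lambda>n. s (Suc n)))"

lemma basic_var [simp]: "basic (\<lambda>s. s i)" and basic_const [simp]: "basic (\<lambda>s. c)"
  by (auto simp: basic_def)

section \<open>Closure of definability under connectives, quantifiers and substitution\<close>

lemma Dfn_all: "Dfn E (\<lambda>s. Q (s 0) (\<lambda>n. s (Suc n))) \<Longrightarrow> Dfn E (\<lambda>s. \<forall>x. Q x s)"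
  by (drule Dfn_all_env) simp

lemma Dfn_ex: "Dfn E (\<lambda>s. Q (s 0) (\<lambda>n. s (Suc n))) \<Longrightarrow> Dfn E (\<lambda>s. \<exists>x. Q x s)"
  by (drule Dfn_not, drule Dfn_all, drule Dfn_not) simp

lemma Dfn_imp: "Dfn E P \<Longrightarrow> Dfn E Q \<Longrightarrow> Dfn E (\<lambda>s. P s \<longrightarrow> Q s)"
  by (drule Dfn_conj[OF _ Dfn_not, of E P Q], assumption, drule Dfn_not) simp

lemma Dfn_disj: "Dfn E P \<Longrightarrow> Dfn E Q \<Longrightarrow> Dfn E (\<lambda>s. P s \<or> Q s)"
  by (drule Dfn_imp[OF Dfn_not, of E P Q], assumption) (simp add: disj_imp)

lemma Dfn_iff: "Dfn E P \<Longrightarrow> Dfn E Q \<Longrightarrow> Dfn E (\<lambda>s. P s \<longleftrightarrow> Q s)"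
  by (subst iff_conv_conj_imp) (intro Dfn_conj Dfn_imp)

lemma Dfn_shift: "Dfn E P \<Longrightarrow> Dfn E (\<lambda>s. P (\<lambda>n. s (f n)))"
  by (erule Dfn_subst_basic) simp

lemma DT_shift: "DT E t \<Longrightarrow> DT E (\<lambda>s. t (\<lambda>n. s (f n)))"
  unfolding DT_def
  using Dfn_shift[of E "\<lambda>s. s 0 = t (\<lambda>n. s (Suc n))" "case_nat 0 (\<lambda>n. Suc (f n))"] by simp

lemma Dfn_subst:
  assumes "Dfn E (\<lambda>s. Q (s 0) (\<lambda>n. s (Suc n)))" "DT E t"
  shows "Dfn E (\<lambda>s. Q (t s) s)"
proof -
  have "Dfn E (\<lambda>s. \<exists>x. x = t s \<and> Q x s)"
    using assms unfolding DT_def by (intro Dfn_ex Dfn_conj)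
  then show ?thesis by simp
qed

lemma Dfn_inst1: "Dfn E (\<lambda>s. P (s 0)) \<Longrightarrow> DT E a \<Longrightarrow> Dfn E (\<lambda>s. P (a s))"
  by (rule Dfn_subst)

lemma Dfn_inst2:
  assumes "Dfn E (\<lambda>s. P (s 0) (s 1))" "DT E a" "DT E b"
  shows "Dfn E (\<lambda>s. P (a s) (b s))"
proof (rule Dfn_subst[OF _ assms(2)])
  have "Dfn E (\<lambda>s. P (s 1) (b (\<lambda>n. s (Suc n))))"
  proof (rule Dfn_subst[OF _ DT_shift[OF assms(3)]])
    show "Dfn E (\<lambda>s. P (s (Suc 1)) (s 0))"
      using Dfn_shift[OF assms(1), of "case_nat 2 (\<lambda>n. 0)"] by (simp add: numeral_2_eq_2)
  qed
  then show "Dfn E (\<lambda>s. P (s 0) (b (\<lambda>n. s (Suc n))))"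
  proof -
    have "Dfn E (\<lambda>s. \<exists>y. y = b (\<lambda>n. s (Suc n)) \<and> P (s 0) y)"
    proof (rule Dfn_ex, rule Dfn_conj)
      show "Dfn E (\<lambda>s. s 0 = b (\<lambda>n. s (Suc (Suc n))))"
        using DT_shift[OF assms(3), of Suc] by (simp add: DT_def)
      show "Dfn E (\<lambda>s. P (s (Suc 0)) (s 0))"
        using Dfn_shift[OF assms(1), of "case_nat 1 (\<lambda>n. 0)"] by simp
    qed
    then show ?thesis by simp
  qed
qed

lemma Dfn_inst3:
  assumes "Dfn E (\<lambda>s. P (s 0) (s 1) (s 2))" "DT E a" "DT E b" "DT E c"
  shows "Dfn E (\<lambda>s. P (a s) (b s) (c s))"
proof -
  have *: "DT E t \<Longrightarrow> Dfn E (\<lambda>s. s 2 = t (\<lambda>n. s (n + 3)))" 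
    "DT E t \<Longrightarrow> Dfn E (\<lambda>s. s 1 = t (\<lambda>n. s (n + 3)))"
    "DT E t \<Longrightarrow> Dfn E (\<lambda>s. s 0 = t (\<lambda>n. s (n + 3)))" for t
    unfolding DT_def
    using Dfn_shift[of E "\<lambda>s. s 0 = t (\<lambda>n. s (Suc n))" "case_nat 2 (\<lambda>n. n + 3)"]
      Dfn_shift[of E "\<lambda>s. s 0 = t (\<lambda>n. s (Suc n))" "case_nat 1 (\<lambda>n. n + 3)"]
      Dfn_shift[of E "\<lambda>s. s 0 = t (\<lambda>n. s (Suc n))" "case_nat 0 (\<lambda>n. n + 3)"] by simp_all
  have "Dfn E (\<lambda>s. \<exists>z y x. x = a s \<and> y = b s \<and> z = c s \<and> P x y z)"
    using *(1)[OF assms(4)] *(2)[OF assms(3)] *(3)[OF assms(2)] assms(1)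
    by (intro Dfn_ex Dfn_conj) (simp_all add: numeral_3_eq_3 numeral_2_eq_2)
  then show ?thesis by simp
qed

lemma DT_var: "DT E (\<lambda>s. s i)" and DT_const: "DT E (\<lambda>s. c)"
  unfolding DT_def by (auto intro: Dfn_atom_eq)

lemma DT_inst1:
  assumes "Dfn E (\<lambda>s. s 0 = F (s 1))" "DT E a" shows "DT E (\<lambda>s. F (a s))"
  unfolding DT_def
  using Dfn_inst2[of E "\<lambda>z a. z = F a", OF assms(1) DT_var[of _ 0] DT_shift[OF assms(2), of Suc]] .

lemma DT_inst2:
  assumes "Dfn E (\<lambda>s. s 0 = F (s 1) (s 2))" "DT E a" "DT E b" shows "DT E (\<lambda>s. F (a s) (b s))"
  unfolding DT_def
  using Dfn_inst3[of E "\<lambda>z a b. z = F a b", OF assms(1) DT_var[of _ 0] DT_shift[OF assms(2), of Suc] DT_shift[OF assms(3), of Suc]] .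

lemma Dfn_mem: "DT E t \<Longrightarrow> DT E u \<Longrightarrow> Dfn E (\<lambda>s. E (t s) (u s))"
  by (rule Dfn_inst2[of E E]) (auto intro: Dfn_atom_mem)

lemma Dfn_eq: "DT E t \<Longrightarrow> DT E u \<Longrightarrow> Dfn E (\<lambda>s. t s = u s)"
  by (rule Dfn_inst2[of E "(=)"]) (auto intro: Dfn_atom_eq)

lemma Dfn_const: "Dfn E (\<lambda>s. b)"
proof -
  have "Dfn E (\<lambda>s. s 0 = s 0)" by (simp only: Dfn_atom_eq basic_var)
  from this Dfn_not[OF this] show ?thesis by (cases b) auto
qed

lemma DT_if:
  assumes "Dfn E P" "DT E t" "DT E u"
  shows "DT E (\<lambda>s. if P s then t s else u s)"
proof -
  have "Dfn E (\<lambda>s. (P (\<lambda>n. s (Suc n)) \<longrightarrow> s 0 = t (\<lambda>n. s (Suc n))) \<and>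
                   (\<not> P (\<lambda>n. s (Suc n)) \<longrightarrow> s 0 = u (\<lambda>n. s (Suc n))))"
    using assms unfolding DT_def by (intro Dfn_conj Dfn_imp Dfn_not Dfn_shift[OF assms(1)])
  then show ?thesis unfolding DT_def by (rule back_subst[of "Dfn E"]) (auto simp: fun_eq_iff)
qed

text \<open>The tail of the environment is frozen into parameters. This is how a predicate that
  occurs under other binders becomes a legitimate instance of a scheme in one variable.\<close>

lemma Dfn_fix_env:
  assumes "Dfn E (\<lambda>s. P (s 0) (\<lambda>n. s (Suc n)))"
  shows "Dfn E (\<lambda>s. P (s 0) e)"
  using Dfn_subst_basic[OF assms, of "case_nat (\<lambda>s. s 0) (\<lambda>n s. e n)"]
  by (simp split: nat.split)

lemma Dfn_fix_env2:
  assumes "Dfn E (\<lambda>s. P (s 0) (s 1) (\<lambda>n. s (Suc (Suc n))))"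
  shows "Dfn E (\<lambda>s. P (s 0) (s 1) e)"
  using Dfn_subst_basic[OF assms, of "case_nat (\<lambda>s. s 0) (case_nat (\<lambda>s. s 1) (\<lambda>n s. e n))"]
  by (simp split: nat.split)

section \<open>Elementary set theory in the model\<close>

named_theorems dfn

lemmas [dfn] = DT_var DT_const DT_if Dfn_const Dfn_not Dfn_conj Dfn_disj Dfn_imp Dfn_iff
  Dfn_all Dfn_ex Dfn_eq

context ZFC_model
begin

abbreviation D1 :: "('a \<Rightarrow> bool) \<Rightarrow> bool" where
  "D1 P \<equiv> Dfn mem (\<lambda>s. P (s 0))"

abbreviation D2 :: "('a \<Rightarrow> 'a \<Rightarrow> bool) \<Rightarrow> bool" where
  "D2 P \<equiv> Dfn mem (\<lambda>s. P (s 0) (s 1))"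

abbreviation DF :: "('a \<Rightarrow> 'a) \<Rightarrow> bool" where
  "DF F \<equiv> DT mem (\<lambda>s. F (s 0))"

abbreviation DF2 :: "('a \<Rightarrow> 'a \<Rightarrow> 'a) \<Rightarrow> bool" where
  "DF2 F \<equiv> DT mem (\<lambda>s. F (s 0) (s 1))"

lemma D1I: "D1 P \<Longrightarrow> DT mem t \<Longrightarrow> Dfn mem (\<lambda>s. P (t s))"
  by (rule Dfn_inst1)

lemma D2I: "D2 P \<Longrightarrow> DT mem t \<Longrightarrow> DT mem u \<Longrightarrow> Dfn mem (\<lambda>s. P (t s) (u s))"
  by (rule Dfn_inst2)

lemma DFI: "DF F \<Longrightarrow> DT mem t \<Longrightarrow> DT mem (\<lambda>s. F (t s))"
  by (rule DT_inst1) (simp_all add: DT_def)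

lemma DF2I: "DF2 F \<Longrightarrow> DT mem t \<Longrightarrow> DT mem u \<Longrightarrow> DT mem (\<lambda>s. F (t s) (u s))"
  by (rule DT_inst2) (simp_all add: DT_def numeral_2_eq_2)

lemma Dfn_elts [dfn]: "DT mem t \<Longrightarrow> DT mem u \<Longrightarrow> Dfn mem (\<lambda>s. t s \<in> elts (u s))"
  unfolding elts_def mem_Collect_eq by (rule Dfn_mem)

lemma Dfn_ball [dfn]:
  assumes "DT mem X" "Dfn mem (\<lambda>s. Q (s 0) (\<lambda>n. s (Suc n)))"
  shows "Dfn mem (\<lambda>s. \<forall>x \<in> elts (X s). Q x s)"
  unfolding Ball_def by (intro dfn assms(2) DT_shift[OF assms(1)])

lemma Dfn_bex [dfn]:
  assumes "DT mem X" "Dfn mem (\<lambda>s. Q (s 0) (\<lambda>n. s (Suc n)))"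
  shows "Dfn mem (\<lambda>s. \<exists>x \<in> elts (X s). Q x s)"
  unfolding Bex_def by (intro dfn assms(2) DT_shift[OF assms(1)])

lemma Dfn_subset [dfn]:
  assumes "DT mem t" "DT mem u" shows "Dfn mem (\<lambda>s. elts (t s) \<subseteq> elts (u s))"
  unfolding subset_eq by (intro dfn DT_shift[OF assms(1)] DT_shift[OF assms(2)] assms)

lemma Dfn_empty [dfn]:
  assumes "DT mem t" shows "Dfn mem (\<lambda>s. elts (t s) = {})"
proof -
  have eq: "elts x = {} \<longleftrightarrow> (\<forall>u. u \<notin> elts x)" for x by blast
  show ?thesis unfolding eq by (intro dfn DT_shift[OF assms])
qed

section \<open>The axiom schemes for definable predicates\<close>

lemma separation_D1:
  assumes "D1 P" shows "\<exists>z. elts z = {u \<in> elts x. P u}"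
proof -
  obtain p r where p: "\<forall>s e. env_agrees s r e \<longrightarrow> (sat mem e p \<longleftrightarrow> P (s 0))"
    using Dfn_formula[OF assms] by blast
  \<comment> \<open>\<open>P\<close> looks only at the first environment entry, which separation
    overwrites; apart from it just the parameter slots matter, and \<open>x\<close> is a
    filler.\<close>
  define e where "e n = (if n mod 3 = 1 then r (n div 3) else x)" for n :: nat
  have "env_agrees (\<lambda>i. (e(0 := u)) (3 * i)) r (e(0 := u))" for u
  proof -
    have "(3 * i + 1) mod 3 = 1" "(3 * i + 1) div 3 = i" "3 * i + 1 \<noteq> 0" for i :: nat by presburger+
    then show ?thesis unfolding env_agrees_def by (simp only: e_def fun_upd_apply if_True if_False simp_thms)
  qed
  then have "sat mem (e(0 := u)) p \<longleftrightarrow> P u" for u using p by fastforce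
  with separation[of x e p] show ?thesis by simp
qed

lemma replacement_D2:
  assumes "D2 P" "\<forall>u \<in> elts x. \<exists>!v. P u v"
  shows "\<exists>z. elts z = {v. \<exists>u \<in> elts x. P u v}"
proof -
  obtain p r where p: "\<forall>s e. env_agrees s r e \<longrightarrow> (sat mem e p \<longleftrightarrow> P (s 0) (s 1))"
    using Dfn_formula[OF assms(1)] by blast
  \<comment> \<open>Replacement distinguishes variables 0 and 1, whereas the first two environment
    entries sit at 0 and 3. Exchanging 1 and 3 reconciles them; parameter number 0 is thereby found
    at 3.\<close>
  define g where "g n = (if n = 1 then 3 else if n = 3 then 1 else n)" for n :: nat
  have "inj g" by (rule inj_on_inverseI[of _ g]) (simp add: g_def)
  define e where "e n = (if n = 3 then r 0 else if n mod 3 = 1 then r (n div 3) else x)" for n :: nat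
  have "sat mem (e(0 := u, 1 := v)) (rename g p) \<longleftrightarrow> P u v" for u v
  proof -
    let ?e = "e(0 := u, 1 := v) \<circ> g"
    have "?e (3 * i + 1) = r i" for i
    proof (cases i)
      case (Suc j)
      have "3 * Suc j + 1 \<noteq> (0 :: nat)" "3 * Suc j + 1 \<noteq> (1 :: nat)" "3 * Suc j + 1 \<noteq> (3 :: nat)"
        "(3 * Suc j + 1) mod 3 = (1 :: nat)" "(3 * Suc j + 1) div 3 = Suc j" by presburger+
      then show ?thesis unfolding Suc comp_apply fun_upd_apply g_def e_def by (simp only: if_False if_True refl)
    qed (simp add: g_def e_def)
    then have "env_agrees (\<lambda>i. ?e (3 * i)) r ?e" by (simp add: env_agrees_def)
    with p have "sat mem ?e p \<longleftrightarrow> P (?e (3 * 0)) (?e (3 * 1))" by blast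
    then show ?thesis unfolding sat_rename[OF \<open>inj g\<close>] by (simp add: g_def)
  qed
  then show ?thesis using replacement[of x e "rename g p"] assms(2) by simp
qed

lemma elts_inject [simp]: "elts x = elts y \<longleftrightarrow> x = y"
  using extensionality by blast

lemma vext: "(\<And>u. u \<in> elts x \<longleftrightarrow> u \<in> elts y) \<Longrightarrow> x = y"
  using extensionality by blast

lemma veq_iff: "x = y \<longleftrightarrow> (\<forall>u. u \<in> elts x \<longleftrightarrow> u \<in> elts y)"
  using vext by auto

lemma setof_eq: "elts z = A \<Longrightarrow> setof A = z"
  unfolding setof_def by (rule the_equality) auto

lemma setof_elts [simp]: "setof (elts x) = x"
  by (rule setof_eq) simp

lemma elts_setofI: "\<exists>z. elts z = A \<Longrightarrow> elts (setof A) = A"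
  by auto

section \<open>Set formation and the definability of its results\<close>

definition sep :: "'a \<Rightarrow> ('a \<Rightarrow> bool) \<Rightarrow> 'a" where
  "sep X P = setof {x \<in> elts X. P x}"

definition rep :: "'a \<Rightarrow> ('a \<Rightarrow> 'a) \<Rightarrow> 'a" where
  "rep X F = setof (F ` elts X)"

definition bigun :: "'a \<Rightarrow> 'a" where
  "bigun X = setof (\<Union>y \<in> elts X. elts y)"

definition pow :: "'a \<Rightarrow> 'a" where
  "pow X = setof {u. elts u \<subseteq> elts X}"

definition upair :: "'a \<Rightarrow> 'a \<Rightarrow> 'a" where
  "upair a b = setof {a, b}"

definition un :: "'a \<Rightarrow> 'a \<Rightarrow> 'a" where
  "un a b = bigun (upair a b)"

definition emp :: 'a where "emp = setof {}"

definition suc :: "'a \<Rightarrow> 'a" where "suc n = un n (upair n n)"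

lemma elts_sep: "D1 P \<Longrightarrow> elts (sep X P) = {x \<in> elts X. P x}"
  unfolding sep_def by (rule elts_setofI, rule separation_D1)

lemma elts_rep: assumes "DF F" shows "elts (rep X F) = F ` elts X"
proof -
  note [dfn] = DFI[OF assms]
  have "D2 (\<lambda>u v. v = F u)" by (intro dfn)
  from replacement_D2[OF this, of X] have "\<exists>z. elts z = {v. \<exists>u\<in>elts X. v = F u}" by simp
  moreover have "{v. \<exists>u\<in>elts X. v = F u} = F ` elts X" by auto
  ultimately show ?thesis unfolding rep_def by (intro elts_setofI) simp
qed

lemma elts_bigun [simp]: "elts (bigun X) = (\<Union>y \<in> elts X. elts y)"
  unfolding bigun_def by (rule elts_setofI, rule union)

lemma elts_pow [simp]: "elts (pow X) = {u. elts u \<subseteq> elts X}"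
  unfolding pow_def by (rule elts_setofI, rule power_set)

lemma elts_upair [simp]: "elts (upair a b) = {a, b}"
  unfolding upair_def by (rule elts_setofI, rule pairing)

lemma elts_un [simp]: "elts (un a b) = elts a \<union> elts b"
  by (simp add: un_def)

lemma elts_suc [simp]: "elts (suc n) = insert n (elts n)"
  by (auto simp: suc_def)

lemma elts_emp [simp]: "elts emp = {}"
proof -
  obtain w where "\<exists>e \<in> elts w. elts e = {}" using infinity by blast
  then show ?thesis unfolding emp_def by (intro elts_setofI) blast
qed

lemma elts_eq_empty [simp]: "elts x = {} \<longleftrightarrow> x = emp"
  using elts_emp extensionality by metis

lemma setof_empty [simp]: "setof {} = emp"
  by (simp add: emp_def)

lemma setof_Int: "elts (setof (elts x \<inter> elts y)) = elts x \<inter> elts y"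
proof -
  have "D1 (\<lambda>u. u \<in> elts y)" by (intro dfn)
  from separation_D1[OF this, of x] show ?thesis by (intro elts_setofI) (simp add: Int_def)
qed

lemma pair_upair: "pair a b = upair (upair a a) (upair a b)"
  by (simp add: pair_def upair_def)

lemma pair_inject [simp]: "pair a b = pair c d \<longleftrightarrow> a = c \<and> b = d"
proof -
  have "upair x y = upair z w \<longleftrightarrow> {x, y} = {z, w}" for x y z w
    using elts_upair elts_inject by metis
  then show ?thesis unfolding pair_upair by (auto simp: doubleton_eq_iff)
qed

lemma DT_upair [dfn]:
  assumes "DT mem a" "DT mem b" shows "DT mem (\<lambda>s. upair (a s) (b s))"
proof (rule DT_inst2[OF _ assms])
  have "Dfn mem (\<lambda>s. \<forall>u. u \<in> elts (s 0) \<longleftrightarrow> u = s 1 \<or> u = s 2)" by (intro dfn)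
  moreover have "z = upair a b \<longleftrightarrow> (\<forall>u. u \<in> elts z \<longleftrightarrow> u = a \<or> u = b)" for z a b
    by (auto intro: vext)
  ultimately show "Dfn mem (\<lambda>s. s 0 = upair (s 1) (s 2))" by simp
qed

lemma DT_pair [dfn]: "DT mem a \<Longrightarrow> DT mem b \<Longrightarrow> DT mem (\<lambda>s. pair (a s) (b s))"
  unfolding pair_upair by (intro dfn)

lemma DT_bigun [dfn]: assumes "DT mem a" shows "DT mem (\<lambda>s. bigun (a s))"
proof (rule DT_inst1[OF _ assms])
  have "Dfn mem (\<lambda>s. \<forall>u. u \<in> elts (s 0) \<longleftrightarrow> (\<exists>y \<in> elts (s 1). u \<in> elts y))" by (intro dfn)
  moreover have "z = bigun a \<longleftrightarrow> (\<forall>u. u \<in> elts z \<longleftrightarrow> (\<exists>y \<in> elts a. u \<in> elts y))" for z a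
    by (auto intro: vext)
  ultimately show "Dfn mem (\<lambda>s. s 0 = bigun (s 1))" by simp
qed

lemma DT_pow [dfn]: assumes "DT mem a" shows "DT mem (\<lambda>s. pow (a s))"
proof (rule DT_inst1[OF _ assms])
  have "Dfn mem (\<lambda>s. \<forall>u. u \<in> elts (s 0) \<longleftrightarrow> elts u \<subseteq> elts (s 1))" by (intro dfn)
  moreover have "z = pow a \<longleftrightarrow> (\<forall>u. u \<in> elts z \<longleftrightarrow> elts u \<subseteq> elts a)" for z a
    by (auto intro: vext)
  ultimately show "Dfn mem (\<lambda>s. s 0 = pow (s 1))" by simp
qed

lemma DT_un [dfn]: "DT mem a \<Longrightarrow> DT mem b \<Longrightarrow> DT mem (\<lambda>s. un (a s) (b s))"
  unfolding un_def by (intro dfn)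

lemma DT_suc [dfn]: "DT mem a \<Longrightarrow> DT mem (\<lambda>s. suc (a s))"
  unfolding suc_def by (intro dfn)

lemma DT_sep [dfn]:
  assumes "DT mem X" "Dfn mem (\<lambda>s. P (s 0) (\<lambda>n. s (Suc n)))"
  shows "DT mem (\<lambda>s. sep (X s) (\<lambda>x. P x s))"
proof -
  have "Dfn mem (\<lambda>s. P (s 0) (\<lambda>n. s (Suc (Suc n))))"
    using Dfn_shift[OF assms(2), of "case_nat 0 (\<lambda>n. Suc (Suc n))"] by simp
  then have "Dfn mem (\<lambda>s. \<forall>u. u \<in> elts (s 0) \<longleftrightarrow> u \<in> elts (X (\<lambda>n. s (Suc n))) \<and> P u (\<lambda>n. s (Suc n)))"
    by (intro dfn DT_shift[OF assms(1)])
  moreover have "elts (sep (X e) (\<lambda>x. P x e)) = {x \<in> elts (X e). P x e}" for e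
    by (rule elts_sep, rule Dfn_fix_env, rule assms)
  then have "z = sep (X e) (\<lambda>x. P x e) \<longleftrightarrow> (\<forall>u. u \<in> elts z \<longleftrightarrow> u \<in> elts (X e) \<and> P u e)" for z e
    by (auto intro: vext)
  ultimately show ?thesis unfolding DT_def by simp
qed

lemma DF_fix_env:
  assumes "DT mem (\<lambda>s. F (s 0) (\<lambda>n. s (Suc n)))"
  shows "DF (\<lambda>x. F x e)"
  using assms Dfn_fix_env2[of mem "\<lambda>y x e. y = F x e" e] by (simp add: DT_def)

lemma DT_rep [dfn]:
  assumes "DT mem X" "DT mem (\<lambda>s. F (s 0) (\<lambda>n. s (Suc n)))"
  shows "DT mem (\<lambda>s. rep (X s) (\<lambda>x. F x s))"
proof -
  have "Dfn mem (\<lambda>s. s 1 = F (s 0) (\<lambda>n. s (Suc (Suc (Suc n)))))"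
    using Dfn_shift[OF assms(2)[unfolded DT_def], of "case_nat 1 (case_nat 0 (\<lambda>n. n + 3))"] by (simp add: numeral_3_eq_3)
  then have "Dfn mem (\<lambda>s. \<forall>u. u \<in> elts (s 0) \<longleftrightarrow> (\<exists>x \<in> elts (X (\<lambda>n. s (Suc n))). u = F x (\<lambda>n. s (Suc n))))"
    by (intro Dfn_all Dfn_iff Dfn_elts Dfn_bex DT_var DT_shift[OF assms(1)]) simp
  moreover have "elts (rep (X e) (\<lambda>x. F x e)) = (\<lambda>x. F x e) ` elts (X e)" for e
    by (rule elts_rep, rule DF_fix_env, rule assms)
  then have "z = rep (X e) (\<lambda>x. F x e) \<longleftrightarrow> (\<forall>u. u \<in> elts z \<longleftrightarrow> (\<exists>x \<in> elts (X e). u = F x e))" for z e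
    by (subst veq_iff) (auto simp: image_iff)
  ultimately show ?thesis unfolding DT_def by simp
qed

section \<open>Functions, dependent sums and projections\<close>

definition lam :: "'a \<Rightarrow> ('a \<Rightarrow> 'a) \<Rightarrow> 'a" where
  "lam X F = rep X (\<lambda>x. pair x (F x))"

definition Sig :: "'a \<Rightarrow> ('a \<Rightarrow> 'a) \<Rightarrow> 'a" where
  "Sig X Y = bigun (rep X (\<lambda>x. rep (Y x) (pair x)))"

text \<open>Unlike \<open>app\<close>, this has a fixed default where \<open>f\<close> is not
  single-valued, which makes it a definable term for all arguments. On the domain of a function the
  two agree (\<open>app_ap\<close>).\<close>

definition ap :: "'a \<Rightarrow> 'a \<Rightarrow> 'a" where
  "ap f x = (if \<exists>!y. pair x y \<in> elts f then THE y. pair x y \<in> elts f else emp)"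

definition pfst :: "'a \<Rightarrow> 'a" where
  "pfst p = (if \<exists>a b. p = pair a b then THE a. \<exists>b. p = pair a b else emp)"

definition psnd :: "'a \<Rightarrow> 'a" where
  "psnd p = (if \<exists>a b. p = pair a b then THE b. \<exists>a. p = pair a b else emp)"

lemma DT_lam [dfn]:
  assumes "DT mem X" "DT mem (\<lambda>s. F (s 0) (\<lambda>n. s (Suc n)))"
  shows "DT mem (\<lambda>s. lam (X s) (\<lambda>x. F x s))"
  unfolding lam_def by (intro DT_rep DT_pair DT_var assms)

lemma DT_Sig [dfn]:
  assumes "DT mem X" "DT mem (\<lambda>s. F (s 0) (\<lambda>n. s (Suc n)))"
  shows "DT mem (\<lambda>s. Sig (X s) (\<lambda>x. F x s))"
  unfolding Sig_def by (intro dfn assms)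

lemma pfst_pair [simp]: "pfst (pair a b) = a" and psnd_pair [simp]: "psnd (pair a b) = b"
  by (auto simp: pfst_def psnd_def)

lemma DT_ap [dfn]: assumes "DT mem f" "DT mem x" shows "DT mem (\<lambda>s. ap (f s) (x s))"
proof (rule DT_inst2[OF _ assms])
  have "Dfn mem (\<lambda>s. ((\<exists>y. pair (s 2) y \<in> elts (s 1) \<and> (\<forall>z. pair (s 2) z \<in> elts (s 1) \<longrightarrow> z = y)) \<longrightarrow>
      pair (s 2) (s 0) \<in> elts (s 1)) \<and> (\<not> (\<exists>y. pair (s 2) y \<in> elts (s 1) \<and> (\<forall>z. pair (s 2) z \<in> elts (s 1) \<longrightarrow> z = y)) \<longrightarrow> s 0 = emp))"
    by (intro dfn)
  moreover have "y = ap f x \<longleftrightarrow> ((\<exists>!y. pair x y \<in> elts f) \<longrightarrow> pair x y \<in> elts f) \<and> (\<not> (\<exists>!y. pair x y \<in> elts f) \<longrightarrow> y = emp)" for y f x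
    unfolding ap_def by (auto intro: the1_equality[symmetric] theI')
  ultimately show "Dfn mem (\<lambda>s. s 0 = ap (s 1) (s 2))" unfolding Ex1_def by simp
qed

lemma DT_pfst [dfn]: assumes "DT mem x" shows "DT mem (\<lambda>s. pfst (x s))"
proof (rule DT_inst1[OF _ assms])
  have "Dfn mem (\<lambda>s. (\<exists>b. s 1 = pair (s 0) b) \<or> (\<not> (\<exists>a b. s 1 = pair a b) \<and> s 0 = emp))"
    by (intro dfn)
  moreover have "a = pfst p \<longleftrightarrow> (\<exists>b. p = pair a b) \<or> (\<not> (\<exists>a b. p = pair a b) \<and> a = emp)" for a p
    by (cases "\<exists>a b. p = pair a b") (auto simp: pfst_def)
  ultimately show "Dfn mem (\<lambda>s. s 0 = pfst (s 1))" by simp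
qed

lemma DT_psnd [dfn]: assumes "DT mem x" shows "DT mem (\<lambda>s. psnd (x s))"
proof (rule DT_inst1[OF _ assms])
  have "Dfn mem (\<lambda>s. (\<exists>b. s 1 = pair b (s 0)) \<or> (\<not> (\<exists>a b. s 1 = pair a b) \<and> s 0 = emp))"
    by (intro dfn)
  moreover have "a = psnd p \<longleftrightarrow> (\<exists>b. p = pair b a) \<or> (\<not> (\<exists>a b. p = pair a b) \<and> a = emp)" for a p
    by (cases "\<exists>a b. p = pair a b") (auto simp: psnd_def)
  ultimately show "Dfn mem (\<lambda>s. s 0 = psnd (s 1))" by simp
qed

lemma Dfn_is_fun [dfn]: assumes "DT mem f" "DT mem x" shows "Dfn mem (\<lambda>s. is_fun (f s) (x s))"
  by (rule Dfn_inst2[OF _ assms]) (unfold is_fun_def Ex1_def, intro dfn)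

lemma Dfn_natural [dfn]: assumes "DT mem n" shows "Dfn mem (\<lambda>s. natural (n s))"
proof (rule Dfn_inst1[OF _ assms])
  have "elts m = insert k (elts k) \<longleftrightarrow> m = suc k" for m k
    by (metis elts_suc extensionality)
  then have eq: "natural n \<longleftrightarrow> (\<forall>y \<in> elts n. elts y \<subseteq> elts n) \<and> (\<forall>y \<in> elts n. \<forall>z \<in> elts y. elts z \<subseteq> elts y) \<and>
     (\<forall>m \<in> elts (suc n). elts m = {} \<or> (\<exists>k. m = suc k))" for n
    by (simp add: natural_def ordinal_def transitive_def conj_assoc)
  show "D1 natural" unfolding eq by (intro dfn)
qed

lemma elts_lam: assumes "DF F" shows "elts (lam X F) = (\<lambda>x. pair x (F x)) ` elts X"
  unfolding lam_def by (rule elts_rep) (intro dfn DFI[OF assms])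

lemma elts_Sig: assumes "DF Y" shows "elts (Sig X Y) = {pair x y | x y. x \<in> elts X \<and> y \<in> elts (Y x)}"
proof -
  note [dfn] = DFI[OF assms]
  have "elts (rep X (\<lambda>x. rep (Y x) (pair x))) = (\<lambda>x. rep (Y x) (pair x)) ` elts X"
    by (rule elts_rep) (intro dfn)
  moreover have "elts (rep (Y x) (pair x)) = pair x ` elts (Y x)" for x
    by (rule elts_rep) (intro dfn)
  ultimately show ?thesis by (auto simp: Sig_def)
qed

lemma is_fun_lam: "DF F \<Longrightarrow> is_fun (lam X F) X"
  unfolding is_fun_def by (auto simp: elts_lam)

lemma ap_lam [simp]: "DF F \<Longrightarrow> x \<in> elts X \<Longrightarrow> ap (lam X F) x = F x"
  unfolding ap_def by (auto simp: elts_lam)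

lemma ap_pair: "is_fun f X \<Longrightarrow> x \<in> elts X \<Longrightarrow> pair x y \<in> elts f \<longleftrightarrow> y = ap f x"
proof -
  assume "is_fun f X" "x \<in> elts X"
  then have "\<exists>!y. pair x y \<in> elts f" by (simp add: is_fun_def)
  then obtain z where z: "\<And>y. pair x y \<in> elts f \<longleftrightarrow> y = z" by blast
  show ?thesis by (simp add: ap_def z)
qed

lemma app_ap: "is_fun f X \<Longrightarrow> x \<in> elts X \<Longrightarrow> app f x = ap f x"
  by (simp add: app_def ap_pair)

lemma is_fun_elts: "is_fun f X \<Longrightarrow> elts f = (\<lambda>x. pair x (ap f x)) ` elts X"
proof (intro set_eqI iffI)
  fix p assume f: "is_fun f X" and "p \<in> elts f"
  then obtain x y where "x \<in> elts X" "p = pair x y" unfolding is_fun_def by blast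
  with f \<open>p \<in> elts f\<close> show "p \<in> (\<lambda>x. pair x (ap f x)) ` elts X" by (simp add: ap_pair)
qed (auto simp: ap_pair)

lemma DF_ap: "DF (ap f)" by (intro dfn)

lemma is_fun_eq_lam: "is_fun f X \<Longrightarrow> f = lam X (ap f)"
  by (metis is_fun_elts elts_lam[OF DF_ap] extensionality)

lemma is_fun_ext: "is_fun f X \<Longrightarrow> is_fun g X \<Longrightarrow> (\<And>x. x \<in> elts X \<Longrightarrow> ap f x = ap g x) \<Longrightarrow> f = g"
  by (rule extensionality) (auto simp: is_fun_elts)

text \<open>Replacement in the form that turns a definable class function on a set into a set. It
  serves where values are unique but no bound for them is at hand.\<close>

lemma fun_ex1:
  assumes P: "D2 P" and ex: "\<And>x. x \<in> elts X \<Longrightarrow> \<exists>!y. P x y"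
  shows "\<exists>f. is_fun f X \<and> (\<forall>x \<in> elts X. P x (ap f x))"
proof -
  note [dfn] = D2I[OF P]
  have D: "D2 (\<lambda>x p. \<exists>y. P x y \<and> p = pair x y)" by (intro dfn)
  have "\<forall>x \<in> elts X. \<exists>!p. \<exists>y. P x y \<and> p = pair x y"
  proof
    fix x assume "x \<in> elts X"
    then obtain z where "\<And>y. P x y \<longleftrightarrow> y = z" using ex by metis
    then show "\<exists>!p. \<exists>y. P x y \<and> p = pair x y" by simp
  qed
  from replacement_D2[OF D this]
  obtain f where f: "elts f = {p. \<exists>x \<in> elts X. \<exists>y. P x y \<and> p = pair x y}" by (elim exE)
  have "is_fun f X" unfolding is_fun_def f
  proof (intro conjI ballI)
    fix x assume "x \<in> elts X"
    then obtain z where "\<And>y. P x y \<longleftrightarrow> y = z" using ex by metis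
    with \<open>x \<in> elts X\<close> show "\<exists>!y. pair x y \<in> {p. \<exists>x \<in> elts X. \<exists>y. P x y \<and> p = pair x y}" by simp
  qed auto
  moreover have "P x (ap f x)" if "x \<in> elts X" for x
  proof -
    from \<open>is_fun f X\<close> that have "pair x (ap f x) \<in> elts f" by (simp add: ap_pair)
    then show ?thesis using f by auto
  qed
  ultimately show ?thesis by blast
qed

text \<open>The axiom of choice selects from pairwise disjoint sets. Tagging the candidates with
  their index \<open>x\<close> makes the families disjoint, and the bound \<open>B x\<close> makes
  them sets.\<close>

lemma bounded_choice:
  assumes P: "D2 P" and B: "DF B" and ex: "\<And>x. x \<in> elts X \<Longrightarrow> \<exists>y \<in> elts (B x). P x y"
  shows "\<exists>f. is_fun f X \<and> (\<forall>x \<in> elts X. ap f x \<in> elts (B x) \<and> P x (ap f x))"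
proof -
  note [dfn] = D2I[OF P] DFI[OF B]
  let ?A = "rep X (\<lambda>x. rep (sep (B x) (P x)) (pair x))"
  have A: "elts ?A = (\<lambda>x. rep (sep (B x) (P x)) (pair x)) ` elts X"
    by (rule elts_rep) (intro dfn)
  have "elts (rep (sep (B x) (P x)) (pair x)) = pair x ` elts (sep (B x) (P x))" for x
    by (rule elts_rep) (intro dfn)
  moreover have "elts (sep (B x) (P x)) = {y \<in> elts (B x). P x y}" for x
    by (rule elts_sep) (intro dfn)
  ultimately have R: "elts (rep (sep (B x) (P x)) (pair x)) = {pair x y | y. y \<in> elts (B x) \<and> P x y}" for x
    by auto
  obtain c where c: "\<forall>y \<in> elts ?A. \<exists>!z. z \<in> elts y \<inter> elts c"
  proof (rule exE[OF choice[of ?A]])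
    show "\<forall>y\<in>elts ?A. elts y \<noteq> {}" using ex unfolding A by (simp add: R del: elts_eq_empty) blast
    show "\<forall>y\<in>elts ?A. \<forall>z\<in>elts ?A. y \<noteq> z \<longrightarrow> elts y \<inter> elts z = {}"
      unfolding A by (auto simp: R del: elts_eq_empty)
  qed
  have "\<exists>!y. y \<in> elts (B x) \<and> P x y \<and> pair x y \<in> elts c" if x: "x \<in> elts X" for x
  proof -
    define K where "K = rep (sep (B x) (P x)) (pair x)"
    have K: "elts K = {pair x y | y. y \<in> elts (B x) \<and> P x y}" unfolding K_def by (rule R)
    have "rep (sep (B x) (P x)) (pair x) \<in> elts ?A" using x unfolding A by (rule imageI)
    from bspec[OF c this] have ex1: "\<exists>!z. z \<in> elts K \<inter> elts c" unfolding K_def .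
    then obtain z where z: "z \<in> elts K" "z \<in> elts c" by blast
    from z(1) obtain y where y: "z = pair x y" "y \<in> elts (B x)" "P x y" unfolding K by blast
    show ?thesis
    proof (rule ex1I[of _ y])
      fix y' assume "y' \<in> elts (B x) \<and> P x y' \<and> pair x y' \<in> elts c"
      then have "pair x y' \<in> elts K \<inter> elts c" unfolding K by blast
      with ex1 z have "pair x y' = z" by blast
      then show "y' = y" using y by simp
    qed (use y z in simp)
  qed
  moreover have "D2 (\<lambda>x y. y \<in> elts (B x) \<and> P x y \<and> pair x y \<in> elts c)" by (intro dfn)
  ultimately show ?thesis using fun_ex1[of "\<lambda>x y. y \<in> elts (B x) \<and> P x y \<and> pair x y \<in> elts c" X] by blast
qed

definition funs :: "'a \<Rightarrow> 'a \<Rightarrow> 'a" where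
  "funs X Y = sep (pow (Sig X (\<lambda>_. Y))) (\<lambda>f. is_fun f X)"

lemma DT_funs [dfn]:
  assumes "DT mem X" "DT mem Y" shows "DT mem (\<lambda>s. funs (X s) (Y s))"
  unfolding funs_def by (intro dfn assms DT_shift[OF assms(1)] DT_shift[OF assms(2)])

lemma elts_funs: "elts (funs X Y) = {f. is_fun f X \<and> (\<forall>x \<in> elts X. ap f x \<in> elts Y)}"
proof -
  have "elts (funs X Y) = {f \<in> elts (pow (Sig X (\<lambda>_. Y))). is_fun f X}"
    unfolding funs_def by (rule elts_sep) (intro dfn)
  moreover have "elts f \<subseteq> elts (Sig X (\<lambda>_. Y)) \<longleftrightarrow> (\<forall>x \<in> elts X. ap f x \<in> elts Y)" if "is_fun f X" for f
    using that by (auto simp: elts_Sig[OF DT_const] is_fun_elts)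
  ultimately show ?thesis by auto
qed

section \<open>Foundation and the natural numbers of the model\<close>

lemma mem_irrefl: "x \<notin> elts x"
  using foundation[of "upair x x"] by auto

lemma mem_asym: "x \<in> elts y \<Longrightarrow> y \<notin> elts x"
  using foundation[of "upair x y"] by auto

lemma suc_inject [simp]: "suc n = suc m \<longleftrightarrow> n = m"
proof
  assume "suc n = suc m"
  then have "elts (suc n) = elts (suc m)" by simp
  then show "n = m" unfolding elts_suc using mem_asym[of n m] by (metis insert_iff)
qed simp

lemma suc_neq_emp [simp]: "suc n \<noteq> emp" "emp \<noteq> suc n"
  using elts_suc[of n] by (metis elts_emp insert_not_empty)+

lemma natural_mem: "natural n \<Longrightarrow> k \<in> elts n \<Longrightarrow> natural k"
  unfolding natural_def ordinal_def transitive_def by blast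

lemma natural_suc: "natural n \<Longrightarrow> natural (suc n)"
  unfolding natural_def ordinal_def transitive_def by auto

lemma natural_emp: "natural emp"
  unfolding natural_def ordinal_def transitive_def by auto

lemma natural_cases: "natural n \<Longrightarrow> n = emp \<or> (\<exists>k. n = suc k)"
  unfolding natural_def by (metis elts_suc extensionality insertI1 elts_emp)

text \<open>\<open>omega\<close> is a comprehension that must first be seen to be a set. Every
  natural number lies in the inductive set \<open>w\<close>: a least one outside would be neither
  zero nor a successor.\<close>

lemma elts_omega [simp]: "elts omega = {n. natural n}"
proof -
  obtain w e where w: "e \<in> elts w" "elts e = {}"
    "\<forall>x \<in> elts w. \<exists>y \<in> elts w. elts y = insert x (elts x)" using infinity by blast
  have emp: "emp \<in> elts w" using w(1,2) by simp
  have suc: "suc x \<in> elts w" if "x \<in> elts w" for x using w(3) that by (metis elts_suc extensionality)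
  have "n \<in> elts w" if "natural n" for n
  proof (rule ccontr)
    assume n: "n \<notin> elts w"
    let ?B = "sep (suc n) (\<lambda>m. m \<notin> elts w)"
    have B: "elts ?B = {m \<in> elts (suc n). m \<notin> elts w}" by (rule elts_sep) (intro dfn)
    then have "elts ?B \<noteq> {}" using n by auto
    from foundation[OF this] obtain m where m: "m \<in> elts ?B" "elts m \<inter> elts ?B = {}" by blast
    then have "natural m" using B that natural_mem by auto
    then consider "m = emp" | k where "m = suc k" using natural_cases by blast
    then show False
    proof cases
      case 2
      then have "k \<in> elts m" by simp
      then have "k \<in> elts (suc n)"
        using m B natural_suc[OF that] unfolding natural_def ordinal_def transitive_def by blast
      then have "k \<in> elts w" using m B \<open>k \<in> elts m\<close> by auto
      then show False using suc 2 m B by auto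
    qed (use m B emp in auto)
  qed
  then have "elts (sep w natural) = {n. natural n}" by (subst elts_sep) (intro dfn, auto)
  then show ?thesis unfolding omega_def by (intro elts_setofI) blast
qed

text \<open>A least counterexample comes from separation and Foundation, hence only for definable
  \<open>P\<close>; the naturals of the model may be nonstandard.\<close>

lemma omega_induct:
  assumes "natural n" and P: "D1 P" and 0: "P emp" and S: "\<And>n. natural n \<Longrightarrow> P n \<Longrightarrow> P (suc n)"
  shows "P n"
proof (rule ccontr)
  assume "\<not> P n"
  note [dfn] = D1I[OF P]
  let ?B = "sep omega (\<lambda>m. \<not> P m)"
  have B: "elts ?B = {m \<in> elts omega. \<not> P m}" by (rule elts_sep) (intro dfn)
  have "elts ?B \<noteq> {}" using \<open>\<not> P n\<close> \<open>natural n\<close> B by auto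
  from foundation[OF this] obtain m where m: "m \<in> elts ?B" "elts m \<inter> elts ?B = {}" by blast
  then have "natural m" using B by auto
  from natural_cases[OF this] show False
  proof
    assume "\<exists>k. m = suc k"
    then obtain k where k: "m = suc k" by blast
    then have "natural k" using \<open>natural m\<close> natural_mem by auto
    moreover have "P k" using m B k \<open>natural k\<close> by auto
    ultimately show False using S k m B by auto
  qed (use 0 m B in auto)
qed

lemma natural_mem_suc:
  assumes "natural n" "k \<in> elts n" shows "suc k \<in> elts (suc n)"
proof -
  have D: "D1 (\<lambda>n. \<forall>k \<in> elts n. suc k \<in> elts (suc n))" by (intro dfn)
  have "\<forall>k \<in> elts n. suc k \<in> elts (suc n)"
    by (rule omega_induct[OF \<open>natural n\<close> D]) auto
  with \<open>k \<in> elts n\<close> show ?thesis by blast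
qed

text \<open>Attempts of a given length exist and agree where both are constrained, so their last
  values glue to one sequence.\<close>

lemma omega_recursion:
  assumes G: "DF G"
  shows "\<exists>s. ap s emp = a \<and> (\<forall>n \<in> elts omega. ap s (suc n) = G (ap s n))"
proof -
  note [dfn] = DFI[OF G]
  \<comment> \<open>An attempt for \<open>n\<close> also determines the value at \<open>n\<close>
    itself, through the predecessor of \<open>n\<close>. Therefore an attempt for
    \<open>suc n\<close> needs the domain \<open>suc (suc n)\<close>.\<close>
  define att where "att s n \<longleftrightarrow> ap s emp = a \<and> (\<forall>k \<in> elts n. ap s (suc k) = G (ap s k))" for s n
  have [dfn]: "DT mem t \<Longrightarrow> DT mem u \<Longrightarrow> Dfn mem (\<lambda>s. att (t s) (u s))" for t u
    by (rule Dfn_inst2) (unfold att_def, intro dfn)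
  have uniq: "ap s n = ap s' n" if "natural n" "att s n" "att s' n" for s s' n
  proof -
    have D: "D1 (\<lambda>n. \<forall>s s'. att s n \<and> att s' n \<longrightarrow> ap s n = ap s' n)" by (intro dfn)
    have "\<forall>s s'. att s n \<and> att s' n \<longrightarrow> ap s n = ap s' n"
    proof (rule omega_induct[OF \<open>natural n\<close> D])
      fix n assume IH: "\<forall>s s'. att s n \<and> att s' n \<longrightarrow> ap s n = ap s' n"
      show "\<forall>s s'. att s (suc n) \<and> att s' (suc n) \<longrightarrow> ap s (suc n) = ap s' (suc n)"
      proof (intro allI impI, elim conjE)
        fix s s' assume s: "att s (suc n)" "att s' (suc n)"
        then have "att s n" "att s' n" by (auto simp: att_def)
        with IH have "ap s n = ap s' n" by blast
        with s show "ap s (suc n) = ap s' (suc n)" by (simp add: att_def)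
      qed
    qed (simp add: att_def)
    with that show ?thesis by blast
  qed
  have ex: "\<exists>s. att s n" if "natural n" for n
  proof -
    have D: "D1 (\<lambda>n. \<exists>s. att s n)" by (intro dfn)
    show ?thesis
    proof (rule omega_induct[OF that D])
      have "DF (\<lambda>_. a)" by (intro dfn)
      then have "ap (lam (upair emp emp) (\<lambda>_. a)) emp = a" by simp
      then show "\<exists>s. att s emp" by (auto simp: att_def)
    next
      fix n assume "natural n" "\<exists>s. att s n"
      then obtain s where s: "att s n" by blast
      let ?F = "\<lambda>k. if k = suc n then G (ap s n) else ap s k"
      have F: "DF ?F" by (intro dfn)
      have D: "D1 (\<lambda>n. emp \<in> elts (suc n))" by (intro dfn)
      have emp: "emp \<in> elts (suc n)" by (rule omega_induct[OF \<open>natural n\<close> D]) auto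
      have "att (lam (suc (suc n)) ?F) (suc n)"
        unfolding att_def
      proof (intro conjI ballI)
        show "ap (lam (suc (suc n)) ?F) emp = a" using emp F s by (simp add: att_def)
        fix k assume "k \<in> elts (suc n)"
        moreover have "suc k \<in> elts (suc (suc n))"
          using natural_mem_suc[OF natural_suc[OF \<open>natural n\<close>] \<open>k \<in> elts (suc n)\<close>] .
        moreover have "k \<in> elts n \<Longrightarrow> k \<noteq> n" "k \<in> elts n \<Longrightarrow> k \<noteq> suc n" "n \<noteq> suc n"
          using mem_irrefl[of n] mem_asym[of n k] by auto (metis insertI1 elts_suc)
        ultimately show "ap (lam (suc (suc n)) ?F) (suc k) = G (ap (lam (suc (suc n)) ?F) k)"
          using F s by (auto simp: att_def)
      qed
      then show "\<exists>s. att s (suc n)" by blast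
    qed
  qed
  have "\<exists>!y. \<exists>s. att s n \<and> y = ap s n" if "n \<in> elts omega" for n
    using that uniq ex by (metis elts_omega mem_Collect_eq)
  moreover have "D2 (\<lambda>n y. \<exists>s. att s n \<and> y = ap s n)" by (intro dfn)
  ultimately obtain f where f: "\<forall>n \<in> elts omega. \<exists>s. att s n \<and> ap f n = ap s n"
    using fun_ex1[of "\<lambda>n y. \<exists>s. att s n \<and> y = ap s n" omega] by auto
  have "ap f emp = a" using f natural_emp by (auto simp: att_def)
  moreover have "ap f (suc n) = G (ap f n)" if n: "natural n" for n
  proof -
    obtain s s' where s: "att s (suc n)" "ap f (suc n) = ap s (suc n)" "att s' n" "ap f n = ap s' n"
      using f n natural_suc by (metis elts_omega mem_Collect_eq)
    then have "att s n" by (auto simp: att_def)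
    from uniq[OF n this s(3)] s show ?thesis by (simp add: att_def)
  qed
  ultimately show ?thesis by auto
qed

text \<open>The union of the iterated unions of \<open>x\<close>. It supplies the bound that cuts an
  ultrapower down to a set of functions closed under predecessors up to equivalence.\<close>

lemma transitive_superset: "\<exists>t. transitive t \<and> elts x \<subseteq> elts t"
proof -
  have "DF bigun" by (intro dfn)
  from omega_recursion[OF this] obtain s where s: "ap s emp = x" "\<forall>n \<in> elts omega. ap s (suc n) = bigun (ap s n)"
    by blast
  let ?t = "bigun (rep omega (ap s))"
  have t: "elts ?t = (\<Union>n \<in> elts omega. elts (ap s n))"
    by (simp add: elts_rep[OF DF_ap])
  have "transitive ?t" unfolding transitive_def
  proof
    fix y assume "y \<in> elts ?t"
    then obtain n where n: "natural n" "y \<in> elts (ap s n)" unfolding t by auto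
    then have "elts y \<subseteq> elts (ap s (suc n))" using s(2) by auto
    then show "elts y \<subseteq> elts ?t" unfolding t using natural_suc[OF n(1)] by auto
  qed
  moreover have "elts x \<subseteq> elts ?t" unfolding t using s(1) natural_emp by auto
  ultimately show ?thesis by blast
qed

end

section \<open>Countably complete ultrafilters\<close>

context ZFC_model
begin

definition dif :: "'a \<Rightarrow> 'a \<Rightarrow> 'a" where
  "dif X A = sep X (\<lambda>x. x \<notin> elts A)"

lemma elts_dif [simp]: "elts (dif X A) = elts X - elts A"
proof -
  have "elts (dif X A) = {x \<in> elts X. x \<notin> elts A}" unfolding dif_def by (rule elts_sep) (intro dfn)
  then show ?thesis by auto
qed

lemma DT_dif [dfn]:
  assumes "DT mem X" "DT mem A" shows "DT mem (\<lambda>s. dif (X s) (A s))"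
  unfolding dif_def by (intro dfn assms DT_shift[OF assms(2)])

lemma setof_Diff_dif: "setof (elts X - elts A) = dif X A"
  by (rule setof_eq) simp

text \<open>
  Closure under countable intersections and under supersets are one condition: every
  \<open>B \<subseteq> X\<close> that contains a countable intersection of members is a member.
\<close>

definition uf :: "'a \<Rightarrow> 'a \<Rightarrow> bool" where
  "uf X W \<longleftrightarrow>
     (\<forall>A \<in> elts W. elts A \<subseteq> elts X) \<and>
     (\<forall>A. elts A \<subseteq> elts X \<longrightarrow> (A \<in> elts W \<longleftrightarrow> dif X A \<notin> elts W)) \<and>
     (\<forall>f B. (\<forall>n \<in> elts omega. ap f n \<in> elts W) \<and> elts B \<subseteq> elts X \<and>
        (\<forall>x \<in> elts X. (\<forall>n \<in> elts omega. x \<in> elts (ap f n)) \<longrightarrow> x \<in> elts B) \<longrightarrow> B \<in> elts W)"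

lemma Dfn_uf [dfn]: assumes "DT mem X" "DT mem W" shows "Dfn mem (\<lambda>s. uf (X s) (W s))"
  by (rule Dfn_inst2[OF _ assms]) (unfold uf_def, intro dfn)

text \<open>As a filter of the ambient logic, \<open>W\<close> turns almost-everywhere arguments
  into instances of \<open>eventually\<close>. Definability matters only where such a statement is
  negated, split or turned into membership in \<open>W\<close>.\<close>

definition filt :: "'a \<Rightarrow> 'a filter" where
  "filt W = (INF A \<in> elts W. principal (elts A))"

text \<open>\<open>um\<close> and \<open>ue\<close> are \<open>ult_mem\<close> and
  \<open>ult_eq\<close> rewritten with \<open>ap\<close>, so that they are definable relations on
  all of the model and not just on functions with the right domain.\<close>

definition um :: "'a \<Rightarrow> 'a \<Rightarrow> 'a \<Rightarrow> bool" where
  "um W f g \<longleftrightarrow> sep (base W) (\<lambda>x. ap f x \<in> elts (ap g x)) \<in> elts W"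

definition ue :: "'a \<Rightarrow> 'a \<Rightarrow> 'a \<Rightarrow> bool" where
  "ue W f g \<longleftrightarrow> sep (base W) (\<lambda>x. ap f x = ap g x) \<in> elts W"

lemma Dfn_um [dfn]:
  assumes "DT mem f" "DT mem g" shows "Dfn mem (\<lambda>s. um W (f s) (g s))"
  by (rule Dfn_inst2[OF _ assms]) (unfold um_def, intro dfn)

lemma Dfn_ue [dfn]:
  assumes "DT mem f" "DT mem g" shows "Dfn mem (\<lambda>s. ue W (f s) (g s))"
  by (rule Dfn_inst2[OF _ assms]) (unfold ue_def, intro dfn)

lemma ult_mem_um: "is_fun f (base W) \<Longrightarrow> is_fun g (base W) \<Longrightarrow> ult_mem W f g \<longleftrightarrow> um W f g"
  unfolding ult_mem_def um_def sep_def elts_def[of "app g _"] elts_def[of "ap g _"]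
  by (simp add: app_ap cong: conj_cong)

lemma ult_eq_ue: "is_fun f (base W) \<Longrightarrow> is_fun g (base W) \<Longrightarrow> ult_eq W f g \<longleftrightarrow> ue W f g"
  unfolding ult_eq_def ue_def sep_def by (simp add: app_ap cong: conj_cong)

context
  fixes X U :: 'a
  assumes U: "uf X U"
begin

lemma uf_sub: "A \<in> elts U \<Longrightarrow> elts A \<subseteq> elts X"
  using U unfolding uf_def by blast

lemma uf_dif: "elts A \<subseteq> elts X \<Longrightarrow> dif X A \<in> elts U \<longleftrightarrow> A \<notin> elts U"
  using U unfolding uf_def by blast

lemma uf_cc:
  assumes "DF F" "\<And>n. natural n \<Longrightarrow> F n \<in> elts U" "elts B \<subseteq> elts X"
    and "\<And>x. x \<in> elts X \<Longrightarrow> (\<And>n. natural n \<Longrightarrow> x \<in> elts (F n)) \<Longrightarrow> x \<in> elts B"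
  shows "B \<in> elts U"
proof -
  have *: "ap (lam omega F) n = F n" if "natural n" for n
    using assms(1) that by simp
  have "(\<forall>n \<in> elts omega. ap (lam omega F) n \<in> elts U) \<and> elts B \<subseteq> elts X \<and>
        (\<forall>x \<in> elts X. (\<forall>n \<in> elts omega. x \<in> elts (ap (lam omega F) n)) \<longrightarrow> x \<in> elts B)"
    using assms(2-4) * by simp
  then show ?thesis using U unfolding uf_def by meson
qed

lemma uf_Int:
  assumes "A \<in> elts U" "B \<in> elts U" "elts C \<subseteq> elts X" "elts A \<inter> elts B \<subseteq> elts C"
  shows "C \<in> elts U"
\<comment> \<open>A binary intersection is a countable one: \<open>A\<close> at zero,
  \<open>B\<close> at every later index.\<close>
proof (rule uf_cc[of "\<lambda>n. if n = emp then A else B"])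
  show "DF (\<lambda>n. if n = emp then A else B)" by (intro dfn)
  fix x assume *: "\<And>n. natural n \<Longrightarrow> x \<in> elts (if n = emp then A else B)"
  from *[OF natural_emp] *[OF natural_suc[OF natural_emp]] have "x \<in> elts A" "x \<in> elts B" by auto
  then show "x \<in> elts C" using assms(4) by blast
qed (use assms in auto)

lemma uf_sup: "A \<in> elts U \<Longrightarrow> elts A \<subseteq> elts B \<Longrightarrow> elts B \<subseteq> elts X \<Longrightarrow> B \<in> elts U"
  using uf_Int[of A A B] by blast

lemma uf_top: "X \<in> elts U"
proof (cases "emp \<in> elts U")
  case False
  have "dif X emp = X" by (rule extensionality) simp
  with False uf_dif[of emp] show ?thesis by simp
qed (simp add: uf_sup[of emp])

lemma uf_emp: "emp \<notin> elts U"
proof -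
  have "dif X emp = X" by (rule extensionality) simp
  with uf_top uf_dif[of emp] show ?thesis by simp
qed

section \<open>The quantifier "almost all"\<close>

lemma eventually_filt: "eventually P (filt U) \<longleftrightarrow> (\<exists>A \<in> elts U. \<forall>x \<in> elts A. P x)"
proof -
  have "eventually P (filt U) \<longleftrightarrow> (\<exists>A \<in> elts U. eventually P (principal (elts A)))"
    unfolding filt_def
  proof (rule eventually_INF_base)
    show "elts U \<noteq> {}" using uf_top by blast
    fix A B assume AB: "A \<in> elts U" "B \<in> elts U"
    let ?C = "setof (elts A \<inter> elts B)"
    have C: "elts ?C = elts A \<inter> elts B" by (rule setof_Int)
    then have "?C \<in> elts U" using AB uf_sub[OF AB(1)] by (intro uf_Int[OF AB]) auto
    moreover have "principal (elts ?C) \<le> inf (principal (elts A)) (principal (elts B))"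
      unfolding C by simp
    ultimately show "\<exists>C\<in>elts U. principal (elts C) \<le> inf (principal (elts A)) (principal (elts B))" ..
  qed
  then show ?thesis by (simp add: eventually_principal)
qed

lemma ev_base: "\<forall>\<^sub>F x in filt U. x \<in> elts X"
  unfolding eventually_filt using uf_top by blast

lemma ev_iff: assumes "D1 P" shows "(\<forall>\<^sub>F x in filt U. P x) \<longleftrightarrow> sep X P \<in> elts U"
proof
  assume "\<forall>\<^sub>F x in filt U. P x"
  then obtain A where A: "A \<in> elts U" "\<forall>x \<in> elts A. P x" unfolding eventually_filt by blast
  then have "elts A \<subseteq> elts (sep X P)" using uf_sub[OF A(1)] by (auto simp: elts_sep[OF assms])
  with A(1) show "sep X P \<in> elts U" by (rule uf_sup) (auto simp: elts_sep[OF assms])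
next
  assume "sep X P \<in> elts U"
  then show "\<forall>\<^sub>F x in filt U. P x" unfolding eventually_filt
    by (rule rev_bexI) (simp add: elts_sep[OF assms])
qed

lemma ev_mem: "A \<in> elts U \<Longrightarrow> \<forall>\<^sub>F x in filt U. x \<in> elts A"
  unfolding eventually_filt by blast

lemma mem_ev: "elts A \<subseteq> elts X \<Longrightarrow> A \<in> elts U \<longleftrightarrow> (\<forall>\<^sub>F x in filt U. x \<in> elts A)"
  unfolding eventually_filt using uf_sup by blast

text \<open>This is maximality of the ultrafilter. It is tied to definable \<open>P\<close>, since
  another predicate need not cut out a set of the model.\<close>

lemma ev_not: assumes "D1 P" shows "(\<forall>\<^sub>F x in filt U. \<not> P x) \<longleftrightarrow> \<not> (\<forall>\<^sub>F x in filt U. P x)"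
proof -
  note [dfn] = D1I[OF assms]
  have D: "D1 (\<lambda>x. \<not> P x)" by (intro dfn)
  have "sep X (\<lambda>x. \<not> P x) = dif X (sep X P)"
    by (rule extensionality) (auto simp: elts_sep[OF assms] elts_sep[OF D])
  moreover have "elts (sep X P) \<subseteq> elts X" by (auto simp: elts_sep[OF assms])
  ultimately show ?thesis by (simp add: ev_iff[OF assms] ev_iff[OF D] uf_dif)
qed

lemma ev_False: "\<not> (\<forall>\<^sub>F x in filt U. False)"
proof -
  have "D1 (\<lambda>x. False)" by (intro dfn)
  from ev_not[OF this] show ?thesis by simp
qed

lemma ev_ex:
  assumes "\<forall>\<^sub>F x in filt U. P x" shows "\<exists>x \<in> elts X. P x"
proof (rule ccontr)
  assume *: "\<not> (\<exists>x \<in> elts X. P x)"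
  from assms ev_base have "\<forall>\<^sub>F x in filt U. False" by eventually_elim (use * in blast)
  then show False using ev_False by contradiction
qed

lemma ev_disj:
  assumes P: "D1 P" and ev: "\<forall>\<^sub>F x in filt U. P x \<or> Q x"
  shows "(\<forall>\<^sub>F x in filt U. P x) \<or> (\<forall>\<^sub>F x in filt U. Q x)"
proof (cases "\<forall>\<^sub>F x in filt U. P x")
  case False
  then have "\<forall>\<^sub>F x in filt U. \<not> P x" using ev_not[OF P] by simp
  with ev have "\<forall>\<^sub>F x in filt U. Q x" by eventually_elim simp
  then show ?thesis ..
qed simp

lemma ev_omega:
  assumes P: "D2 P" and ev: "\<And>n. natural n \<Longrightarrow> \<forall>\<^sub>F x in filt U. P n x"
  shows "\<forall>\<^sub>F x in filt U. \<forall>n. natural n \<longrightarrow> P n x"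
proof -
  note [dfn] = D2I[OF P]
  have D: "D1 (P n)" for n by (intro dfn)
  have D': "D1 (\<lambda>x. \<forall>n. natural n \<longrightarrow> P n x)" by (intro dfn)
  show ?thesis unfolding ev_iff[OF D']
  proof (rule uf_cc)
    show "DF (\<lambda>n. sep X (P n))" by (intro dfn)
    show "natural n \<Longrightarrow> sep X (P n) \<in> elts U" for n using ev ev_iff[OF D] by simp
  qed (auto simp: elts_sep[OF D] elts_sep[OF D'])
qed

lemma ev_omega_iff:
  assumes "D2 P"
  shows "(\<forall>n. natural n \<longrightarrow> (\<forall>\<^sub>F x in filt U. P n x)) \<longleftrightarrow> (\<forall>\<^sub>F x in filt U. \<forall>n. natural n \<longrightarrow> P n x)"
proof
  assume *: "\<forall>\<^sub>F x in filt U. \<forall>n. natural n \<longrightarrow> P n x"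
  show "\<forall>n. natural n \<longrightarrow> (\<forall>\<^sub>F x in filt U. P n x)"
    by (intro allI impI, rule eventually_mono[OF *]) simp
qed (intro ev_omega[OF assms], simp)

text \<open>The existential step of the theorem of Los: witnesses are chosen on a set in
  \<open>U\<close>, and what the function does elsewhere is immaterial to its class.\<close>

lemma ev_choice:
  assumes P: "D2 P" and B: "DF B" and ex: "\<forall>\<^sub>F x in filt U. \<exists>y \<in> elts (B x). P x y"
  shows "\<exists>f. \<forall>\<^sub>F x in filt U. ap f x \<in> elts (B x) \<and> P x (ap f x)"
proof -
  from ex obtain A where A: "A \<in> elts U" "\<And>x. x \<in> elts A \<Longrightarrow> \<exists>y \<in> elts (B x). P x y"
    unfolding eventually_filt by blast
  from bounded_choice[OF P B A(2)]
  obtain f where "\<forall>x \<in> elts A. ap f x \<in> elts (B x) \<and> P x (ap f x)" by blast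
  with A(1) show ?thesis unfolding eventually_filt by blast
qed

lemma base_uf [simp]: "base U = X"
  unfolding base_def by (rule setof_eq) (use uf_sub uf_top in blast)

lemma um_ev: "um U f g \<longleftrightarrow> (\<forall>\<^sub>F x in filt U. ap f x \<in> elts (ap g x))"
proof -
  have "D1 (\<lambda>x. ap f x \<in> elts (ap g x))" by (intro dfn)
  from ev_iff[OF this] show ?thesis by (simp add: um_def)
qed

lemma ue_ev: "ue U f g \<longleftrightarrow> (\<forall>\<^sub>F x in filt U. ap f x = ap g x)"
proof -
  have "D1 (\<lambda>x. ap f x = ap g x)" by (intro dfn)
  from ev_iff[OF this] show ?thesis by (simp add: ue_def)
qed

text \<open>Iterating a choice of smaller functions along \<open>omega\<close> would give a
  descending sequence of functions. By countable completeness it descends at a single point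
  \<open>x\<close> for all \<open>n\<close> at once, which contradicts Foundation.\<close>

lemma um_wf:
  assumes "d \<in> elts D"
  shows "\<exists>f \<in> elts D. \<forall>g \<in> elts D. \<not> um U g f"
proof (rule ccontr)
  assume *: "\<not> (\<exists>f \<in> elts D. \<forall>g \<in> elts D. \<not> um U g f)"
  have P: "D2 (\<lambda>f g. um U g f)" and B: "DF (\<lambda>_. D)" by (intro dfn)+
  have "\<exists>e. is_fun e D \<and> (\<forall>f \<in> elts D. ap e f \<in> elts D \<and> um U (ap e f) f)"
    by (rule bounded_choice[OF P B]) (use * in blast)
  then obtain e where e: "\<And>f. f \<in> elts D \<Longrightarrow> ap e f \<in> elts D \<and> um U (ap e f) f" by blast
  from omega_recursion[OF DF_ap[of e], of d] obtain s
    where s: "ap s emp = d" "\<And>n. natural n \<Longrightarrow> ap s (suc n) = ap e (ap s n)" by auto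
  have D: "D1 (\<lambda>n. ap s n \<in> elts D)" by (intro dfn)
  have sD: "ap s n \<in> elts D" if "natural n" for n
    by (rule omega_induct[OF that D]) (use s e assms in auto)
  have D: "D2 (\<lambda>n x. ap (ap s (suc n)) x \<in> elts (ap (ap s n) x))" by (intro dfn)
  have "\<forall>\<^sub>F x in filt U. \<forall>n. natural n \<longrightarrow> ap (ap s (suc n)) x \<in> elts (ap (ap s n) x)"
    by (rule ev_omega[OF D]) (use e sD s um_ev in auto)
  from ev_ex[OF this] obtain x where x: "\<And>n. natural n \<Longrightarrow> ap (ap s (suc n)) x \<in> elts (ap (ap s n) x)"
    by blast
  let ?S = "rep omega (\<lambda>n. ap (ap s n) x)"
  have "elts ?S = (\<lambda>n. ap (ap s n) x) ` elts omega" by (rule elts_rep) (intro dfn)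
  then have S: "elts ?S = {ap (ap s n) x | n. natural n}" by auto
  then have "elts ?S \<noteq> {}" using natural_emp by blast
  from foundation[OF this] obtain n where "natural n" "elts (ap (ap s n) x) \<inter> elts ?S = {}"
    unfolding S by blast
  then show False using x[of n] natural_suc[of n] unfolding S by blast
qed

end

section \<open>Transitive collapse\<close>

text \<open>Recursion along \<open>R\<close>, done by gluing attempts on subsets of \<open>D\<close>
  closed under predecessors. Extensionality is not part of the picture yet, so \<open>h\<close> may
  identify elements.\<close>

lemma mostowski:
  assumes R: "D2 R"
    and wf: "\<And>E. E \<noteq> emp \<Longrightarrow> elts E \<subseteq> elts D \<Longrightarrow> \<exists>d \<in> elts E. \<forall>g \<in> elts E. \<not> R g d"
  shows "\<exists>h. is_fun h D \<and> (\<forall>d \<in> elts D. elts (ap h d) = {ap h g | g. g \<in> elts D \<and> R g d})"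
proof -
  note [dfn] = D2I[OF R]
  have pred: "elts (rep (sep D (\<lambda>g. R g d)) (ap h)) = {ap h g | g. g \<in> elts D \<and> R g d}" for h d
  proof -
    have "D1 (\<lambda>g. R g d)" by (intro dfn)
    from elts_sep[OF this] show ?thesis by (auto simp: elts_rep[OF DF_ap])
  qed
  define att where "att C h \<longleftrightarrow> elts C \<subseteq> elts D \<and> (\<forall>d \<in> elts C. \<forall>g \<in> elts D. R g d \<longrightarrow> g \<in> elts C) \<and>
      (\<forall>d \<in> elts C. ap h d = rep (sep D (\<lambda>g. R g d)) (ap h))" for C h
  have [dfn]: "DT mem t \<Longrightarrow> DT mem u \<Longrightarrow> Dfn mem (\<lambda>s. att (t s) (u s))" for t u
    by (rule Dfn_inst2) (unfold att_def, intro dfn)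
  have rep_cong: "rep (sep D (\<lambda>g. R g d)) (ap h) = rep (sep D (\<lambda>g. R g d)) (ap h')"
    if "\<And>g. g \<in> elts D \<Longrightarrow> R g d \<Longrightarrow> ap h g = ap h' g" for h h' d
  proof (rule extensionality)
    show "elts (rep (sep D (\<lambda>g. R g d)) (ap h)) = elts (rep (sep D (\<lambda>g. R g d)) (ap h'))"
      unfolding pred using that by metis
  qed
  have uniq: "ap h d = ap h' d" if a: "att C h" "att C' h'" and d: "d \<in> elts C" "d \<in> elts C'" for C h C' h' d
  proof (rule ccontr)
    assume ne: "ap h d \<noteq> ap h' d"
    let ?B = "sep C (\<lambda>d. d \<in> elts C' \<and> ap h d \<noteq> ap h' d)"
    have B: "elts ?B = {d \<in> elts C. d \<in> elts C' \<and> ap h d \<noteq> ap h' d}" by (rule elts_sep) (intro dfn)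
    have "?B \<noteq> emp" using B d ne elts_emp by (metis (mono_tags, lifting) empty_Collect_eq)
    moreover have "elts ?B \<subseteq> elts D" using B a(1) by (auto simp: att_def)
    ultimately obtain m where m: "m \<in> elts ?B" "\<forall>g \<in> elts ?B. \<not> R g m" using wf by blast
    then have "ap h g = ap h' g" if "g \<in> elts D" "R g m" for g
      using a that unfolding att_def B by blast
    then have "rep (sep D (\<lambda>g. R g m)) (ap h) = rep (sep D (\<lambda>g. R g m)) (ap h')" by (rule rep_cong)
    then have "ap h m = ap h' m" using a m(1) unfolding att_def B by simp
    then show False using m(1) unfolding B by blast
  qed
  have "D1 (\<lambda>d. \<exists>C h. att C h \<and> d \<in> elts C)" by (intro dfn)
  from separation_D1[OF this] obtain E where E: "elts E = {d \<in> elts D. \<exists>C h. att C h \<and> d \<in> elts C}" ..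
  have "D2 (\<lambda>d y. \<exists>C h. att C h \<and> d \<in> elts C \<and> y = ap h d)" by (intro dfn)
  moreover have "\<exists>!y. \<exists>C h. att C h \<and> d \<in> elts C \<and> y = ap h d" if "d \<in> elts E" for d
    using that uniq unfolding E by (intro ex_ex1I) blast+
  ultimately have "\<exists>H. is_fun H E \<and> (\<forall>d \<in> elts E. \<exists>C h. att C h \<and> d \<in> elts C \<and> ap H d = ap h d)"
    by (rule fun_ex1)
  then obtain H where H: "is_fun H E" "\<And>d. d \<in> elts E \<Longrightarrow> \<exists>C h. att C h \<and> d \<in> elts C \<and> ap H d = ap h d"
    by blast
  have H_val: "ap H d = ap h d" if "att C h" "d \<in> elts C" for C h d
  proof -
    have "elts C \<subseteq> elts D" using that(1) by (simp add: att_def)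
    then have "d \<in> elts E" unfolding E using that by blast
    then obtain C' h' where "att C' h'" "d \<in> elts C'" "ap H d = ap h' d" using H(2) by blast
    then show ?thesis using uniq that by metis
  qed
  have closed: "g \<in> elts E" if d: "d \<in> elts E" and g: "g \<in> elts D" "R g d" for d g
  proof -
    obtain C h where C: "att C h" "d \<in> elts C" using d unfolding E by blast
    then have "g \<in> elts C" using g by (simp add: att_def)
    then show ?thesis unfolding E using C(1) g by blast
  qed
  have H_rec: "ap H d = rep (sep D (\<lambda>g. R g d)) (ap H)" if d: "d \<in> elts E" for d
  proof -
    obtain C h where C: "att C h" "d \<in> elts C" using d unfolding E by blast
    have "ap H d = rep (sep D (\<lambda>g. R g d)) (ap h)" using H_val[OF C] C unfolding att_def by simp
    also have "\<dots> = rep (sep D (\<lambda>g. R g d)) (ap H)"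
    proof (rule rep_cong)
      fix g assume "g \<in> elts D" "R g d"
      then have "g \<in> elts C" using C unfolding att_def by blast
      then show "ap h g = ap H g" using H_val[OF C(1)] by simp
    qed
    finally show ?thesis .
  qed
  \<comment> \<open>At an \<open>R\<close>-minimal element missed by all attempts, all predecessors
    are already covered by \<open>H\<close>; adding that one point gives an attempt that contains
    it.\<close>
  have "E = D"
  proof (rule ccontr)
    assume "E \<noteq> D"
    have "elts (dif D E) \<noteq> {}" using \<open>E \<noteq> D\<close> E extensionality[of E D] by auto
    then have "dif D E \<noteq> emp" by (simp only: elts_eq_empty simp_thms)
    moreover have "elts (dif D E) \<subseteq> elts D" by auto
    ultimately obtain d where d: "d \<in> elts (dif D E)" "\<forall>g \<in> elts (dif D E). \<not> R g d" using wf by blast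
    let ?C = "un E (upair d d)"
    let ?F = "\<lambda>x. if x = d then rep (sep D (\<lambda>g. R g d)) (ap H) else ap H x"
    have F: "DF ?F" by (intro dfn)
    have dE: "d \<notin> elts E" "d \<in> elts D" using d(1) by auto
    have pre: "g \<in> elts E" if "g \<in> elts D" "R g d" for g using that d(2) by auto
    have val: "ap (lam ?C ?F) x = ap H x" if "x \<in> elts E" for x
      using that dE by (subst ap_lam[OF F]) auto
    have CD: "elts ?C \<subseteq> elts D" using dE(2) E by auto
    have sub: "g \<in> elts E" if "e \<in> elts ?C" "g \<in> elts D" "R g e" for e g
    proof (cases "e = d")
      case False
      then have "e \<in> elts E" using that(1) by simp
      then show ?thesis using closed that by blast
    qed (use pre that in blast)
    have rec: "ap (lam ?C ?F) e = rep (sep D (\<lambda>g. R g e)) (ap (lam ?C ?F))" if e: "e \<in> elts ?C" for e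
    proof -
      have "ap (lam ?C ?F) e = rep (sep D (\<lambda>g. R g e)) (ap H)"
      proof (cases "e = d")
        case True
        then show ?thesis using e by (subst ap_lam[OF F]) simp_all
      next
        case False
        then have "e \<in> elts E" using e by simp
        then show ?thesis using val[of e] H_rec[of e] by simp
      qed
      also have "\<dots> = rep (sep D (\<lambda>g. R g e)) (ap (lam ?C ?F))"
        by (rule rep_cong, rule val[symmetric], rule sub[OF e])
      finally show ?thesis .
    qed
    have "\<forall>e \<in> elts ?C. \<forall>g \<in> elts D. R g e \<longrightarrow> g \<in> elts ?C" using sub by simp
    with CD rec have "elts ?C \<subseteq> elts D \<and> (\<forall>e \<in> elts ?C. \<forall>g \<in> elts D. R g e \<longrightarrow> g \<in> elts ?C) \<and>
        (\<forall>e \<in> elts ?C. ap (lam ?C ?F) e = rep (sep D (\<lambda>g. R g e)) (ap (lam ?C ?F)))" by blast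
    then have "att ?C (lam ?C ?F)" by (rule iffD2[OF att_def])
    moreover have "d \<in> elts ?C" by simp
    ultimately have "d \<in> elts E" unfolding E using dE(2) by blast
    then show False using dE(1) by contradiction
  qed
  then show ?thesis using H(1) H_rec pred by metis
qed

section \<open>Uniqueness of the collapse\<close>

lemma partial_collapseD:
  assumes "partial_collapse M W D h"
  shows "elts D \<subseteq> ult_funs M W" and "is_fun h D"
    and "f \<in> elts D \<Longrightarrow> g \<in> ult_funs M W \<Longrightarrow> ult_mem W g f \<Longrightarrow> \<exists>g' \<in> elts D. ult_eq W g g'"
    and "f \<in> elts D \<Longrightarrow> u \<in> elts (app h f) \<longleftrightarrow> (\<exists>g \<in> elts D. ult_mem W g f \<and> u = app h g)"
  using assms unfolding partial_collapse_def by simp_all blast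

text \<open>What the uniqueness of the collapse asks of \<open>W\<close>. It is verified separately
  for ultrapowers of the universe and for external ones, so that one uniqueness proof covers
  both.\<close>

definition ult_congruent :: "'a set \<Rightarrow> 'a \<Rightarrow> bool" where
  "ult_congruent M W \<longleftrightarrow>
     (\<forall>f \<in> ult_funs M W. ult_eq W f f) \<and>
     (\<forall>f \<in> ult_funs M W. \<forall>g \<in> ult_funs M W. ult_eq W f g \<longrightarrow> ult_eq W g f) \<and>
     (\<forall>f \<in> ult_funs M W. \<forall>f' \<in> ult_funs M W. \<forall>g \<in> ult_funs M W. \<forall>g' \<in> ult_funs M W.
        ult_eq W f f' \<longrightarrow> ult_eq W g g' \<longrightarrow> ult_mem W f g \<longrightarrow> ult_mem W f' g')"

text \<open>Foundation is applied to the set of values of \<open>h\<close> at counterexamples. At a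
  minimal value all predecessors agree, and each predecessor in one domain has an equivalent one in
  the other, so the two values have the same elements.\<close>

lemma partial_collapse_agree:
  assumes M: "ult_congruent M W"
    and pc: "partial_collapse M W D h" "partial_collapse M W D' h'"
    and f: "f \<in> elts D" "f' \<in> elts D'" "ult_eq W f f'"
  shows "app h f = app h' f'"
proof (rule ccontr)
  assume ne: "app h f \<noteq> app h' f'"
  have refl: "ult_eq W f f" if "f \<in> ult_funs M W" for f
    using M that unfolding ult_congruent_def by blast
  have sym: "ult_eq W g f" if "f \<in> ult_funs M W" "g \<in> ult_funs M W" "ult_eq W f g" for f g
    using M that unfolding ult_congruent_def by blast
  have cong: "ult_mem W f' g'"
    if "f \<in> ult_funs M W" "f' \<in> ult_funs M W" "g \<in> ult_funs M W" "g' \<in> ult_funs M W"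
      "ult_eq W f f'" "ult_eq W g g'" "ult_mem W f g" for f f' g g'
    using M that unfolding ult_congruent_def by blast
  have hfun: "is_fun h D" "is_fun h' D'" using pc partial_collapseD(2) by blast+
  have D: "elts D \<subseteq> ult_funs M W" "elts D' \<subseteq> ult_funs M W" using pc partial_collapseD(1) by blast+
  then have ue: "ult_eq W f f' \<longleftrightarrow> ue W f f'" if "f \<in> elts D" "f' \<in> elts D'" for f f'
    using that by (intro ult_eq_ue) (auto simp: ult_funs_def)
  let ?B = "sep D (\<lambda>f. \<exists>f' \<in> elts D'. ue W f f' \<and> ap h f \<noteq> ap h' f')"
  have B: "elts ?B = {f \<in> elts D. \<exists>f' \<in> elts D'. ue W f f' \<and> ap h f \<noteq> ap h' f'}"
    by (rule elts_sep) (intro dfn)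
  have V: "elts (rep ?B (ap h)) = ap h ` elts ?B" by (rule elts_rep) (intro dfn)
  have "f \<in> elts ?B" unfolding B using f ne hfun ue by (auto simp: app_ap)
  then have "elts (rep ?B (ap h)) \<noteq> {}" unfolding V by blast
  from foundation[OF this] obtain g where g: "g \<in> elts ?B" "elts (ap h g) \<inter> elts (rep ?B (ap h)) = {}"
    unfolding V by blast
  then obtain g' where g': "g \<in> elts D" "g' \<in> elts D'" "ult_eq W g g'" "ap h g \<noteq> ap h' g'"
    unfolding B using ue by blast
  have in_funs: "g \<in> ult_funs M W" "g' \<in> ult_funs M W" using g' D by blast+
  have eq: "app h k = app h' k'" if "k \<in> elts D" "ult_mem W k g" "k' \<in> elts D'" "ult_eq W k k'" for k k'
  proof (rule ccontr)
    assume "app h k \<noteq> app h' k'"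
    then have "k \<in> elts ?B" unfolding B using that ue hfun by (auto simp: app_ap)
    moreover have "app h k \<in> elts (app h g)" using partial_collapseD(4)[OF pc(1) g'(1)] that by blast
    ultimately show False using g(2) g'(1) that(1) hfun(1) unfolding V by (auto simp: app_ap)
  qed
  have "app h g = app h' g'"
  proof (rule vext)
    fix u
    show "u \<in> elts (app h g) \<longleftrightarrow> u \<in> elts (app h' g')"
    proof
      assume "u \<in> elts (app h g)"
      then obtain k where k: "u = app h k" "k \<in> elts D" "ult_mem W k g"
        using partial_collapseD(4)[OF pc(1) g'(1)] by blast
      then have kM: "k \<in> ult_funs M W" using D by blast
      have m: "ult_mem W k g'" using cong[OF kM kM in_funs refl[OF kM] g'(3) k(3)] .
      then obtain k' where k': "k' \<in> elts D'" "ult_eq W k k'"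
        using partial_collapseD(3)[OF pc(2) g'(2) kM] by blast
      have k'M: "k' \<in> ult_funs M W" using k' D by blast
      have "ult_mem W k' g'" using cong[OF kM k'M in_funs(2,2) k'(2) refl[OF in_funs(2)] m] .
      then have "app h' k' \<in> elts (app h' g')" using partial_collapseD(4)[OF pc(2) g'(2)] k'(1) by blast
      then show "u \<in> elts (app h' g')" using eq[OF k(2,3) k'] k(1) by simp
    next
      assume "u \<in> elts (app h' g')"
      then obtain k' where k': "u = app h' k'" "k' \<in> elts D'" "ult_mem W k' g'"
        using partial_collapseD(4)[OF pc(2) g'(2)] by blast
      then have k'M: "k' \<in> ult_funs M W" using D by blast
      have m: "ult_mem W k' g" using cong[OF k'M k'M in_funs(2,1) refl[OF k'M] sym[OF in_funs g'(3)] k'(3)] .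
      then obtain k where k: "k \<in> elts D" "ult_eq W k' k"
        using partial_collapseD(3)[OF pc(1) g'(1) k'M] by blast
      have kM: "k \<in> ult_funs M W" using k D by blast
      have m: "ult_mem W k g" using cong[OF k'M kM in_funs(1,1) k(2) refl[OF in_funs(1)] m] .
      then have "app h k \<in> elts (app h g)" using partial_collapseD(4)[OF pc(1) g'(1)] k(1) by blast
      then show "u \<in> elts (app h g)" using eq[OF k(1) m k'(2) sym[OF k'M kM k(2)]] k'(1) by simp
    qed
  qed
  then show False using g' hfun by (simp add: app_ap)
qed

lemma ult_class_eq:
  assumes M: "ult_congruent M W" and pc: "partial_collapse M W D h" and f: "f \<in> elts D"
  shows "ult_class M W f = app h f"
  unfolding ult_class_def
proof (rule the_equality)
  show "\<exists>D' h'. partial_collapse M W D' h' \<and> f \<in> elts D' \<and> app h f = app h' f"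
    by (intro exI[of _ D] exI[of _ h] conjI pc f refl)
  fix y assume "\<exists>D h. partial_collapse M W D h \<and> f \<in> elts D \<and> y = app h f"
  then obtain D' h' where *: "partial_collapse M W D' h'" "f \<in> elts D'" "y = app h' f" by (elim exE conjE)
  have "f \<in> ult_funs M W" using partial_collapseD(1)[OF pc] f by blast
  then have "ult_eq W f f" using M unfolding ult_congruent_def by blast
  from partial_collapse_agree[OF M *(1) pc *(2) f this] show "y = app h f" using * by simp
qed

end

section \<open>Ultrapowers of the universe\<close>

context ZFC_model
begin

text \<open>Elements of an ultrapower are named by definable operations of the ambient logic.
  Nothing is lost, since a set function \<open>f\<close> on \<open>X\<close> is the restriction of
  \<open>ap f\<close>.\<close>

definition cls :: "'a \<Rightarrow> 'a \<Rightarrow> ('a \<Rightarrow> 'a) \<Rightarrow> 'a" where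
  "cls X U F = ult_class UNIV U (lam X F)"

lemma Dfn_fin_less [dfn]: assumes "DT mem a" "DT mem b" shows "Dfn mem (\<lambda>s. fin_less (a s) (b s))"
proof (rule Dfn_inst2[OF _ assms])
  have eq: "fin_less a b \<longleftrightarrow> (\<exists>m \<in> elts b. m \<notin> elts a \<and> (\<forall>z. (z \<in> elts a \<and> z \<notin> elts b) \<or> (z \<in> elts b \<and> z \<notin> elts a) \<longrightarrow> z = m \<or> z \<^bold>\<in> m))" for a b
    unfolding fin_less_def by blast
  show "Dfn mem (\<lambda>s. fin_less (s 0) (s 1))" unfolding eq by (intro dfn Dfn_mem)
qed

lemma Dfn_fin_le [dfn]: "DT mem a \<Longrightarrow> DT mem b \<Longrightarrow> Dfn mem (\<lambda>s. fin_le (a s) (b s))"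
  unfolding fin_le_def by (intro dfn)

context
  fixes X U :: 'a
  assumes U: "uf X U"
begin

lemma ult_funs_uf: "ult_funs UNIV U = {f. is_fun f X}"
  by (simp add: ult_funs_def base_uf[OF U])

lemma ult_mem_ev:
  "is_fun f X \<Longrightarrow> is_fun g X \<Longrightarrow> ult_mem U f g \<longleftrightarrow> (\<forall>\<^sub>F x in filt U. ap f x \<in> elts (ap g x))"
  using ult_mem_um[of f U g] um_ev[OF U] by (simp add: base_uf[OF U])

lemma ult_eq_ev:
  "is_fun f X \<Longrightarrow> is_fun g X \<Longrightarrow> ult_eq U f g \<longleftrightarrow> (\<forall>\<^sub>F x in filt U. ap f x = ap g x)"
  using ult_eq_ue[of f U g] ue_ev[OF U] by (simp add: base_uf[OF U])

lemma ult_congruent_uf: "ult_congruent UNIV U"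
  unfolding ult_congruent_def ult_funs_uf
proof (intro conjI ballI impI)
  fix f g assume f: "f \<in> {f. is_fun f X}" "g \<in> {f. is_fun f X}" and eq: "ult_eq U f g"
  from f eq have "\<forall>\<^sub>F x in filt U. ap f x = ap g x" by (simp add: ult_eq_ev)
  then have "\<forall>\<^sub>F x in filt U. ap g x = ap f x" by eventually_elim simp
  with f show "ult_eq U g f" by (simp add: ult_eq_ev)
next
  fix f f' g g' assume f: "f \<in> {f. is_fun f X}" "f' \<in> {f. is_fun f X}" "g \<in> {f. is_fun f X}" "g' \<in> {f. is_fun f X}"
    and eq: "ult_eq U f f'" "ult_eq U g g'" "ult_mem U f g"
  from f eq have "\<forall>\<^sub>F x in filt U. ap f x = ap f' x" "\<forall>\<^sub>F x in filt U. ap g x = ap g' x"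
    "\<forall>\<^sub>F x in filt U. ap f x \<in> elts (ap g x)" by (simp_all add: ult_eq_ev ult_mem_ev)
  then have "\<forall>\<^sub>F x in filt U. ap f' x \<in> elts (ap g' x)" by eventually_elim simp
  with f show "ult_mem U f' g'" by (simp add: ult_mem_ev)
qed (simp add: ult_eq_ev)

lemma lam_in_funs:
  assumes "DF F" "emp \<in> elts T"
  shows "lam X (\<lambda>x. if F x \<in> elts T then F x else emp) \<in> elts (funs X T)"
proof -
  have "DF (\<lambda>x. if F x \<in> elts T then F x else emp)" by (intro dfn DFI[OF assms(1)])
  then show ?thesis using assms(2) by (simp add: elts_funs is_fun_lam)
qed

text \<open>Transitivity of \<open>T\<close> closes the set of functions into \<open>T\<close> under
  predecessors, up to equality almost everywhere. The second half is extensionality of the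
  ultrapower, the point where the collapse becomes injective on equivalence classes.\<close>

lemma collapse_into:
  assumes T: "transitive T" "emp \<in> elts T"
  shows "\<exists>h. partial_collapse UNIV U (funs X T) h \<and>
    (\<forall>f \<in> elts (funs X T). \<forall>g \<in> elts (funs X T). app h f = app h g \<longrightarrow> (\<forall>\<^sub>F x in filt U. ap f x = ap g x))"
proof -
  obtain D where D_def: "D = funs X T" by simp
  have D: "is_fun f X" "\<And>x. x \<in> elts X \<Longrightarrow> ap f x \<in> elts T" if "f \<in> elts D" for f
    using that unfolding D_def elts_funs by blast+
  \<comment> \<open>Members of \<open>D\<close> take values in \<open>T\<close> everywhere. The
    default \<open>emp\<close> repairs a function that does so only almost everywhere.\<close>
  have cut: "\<exists>g' \<in> elts D. \<forall>\<^sub>F x in filt U. ap g' x = ap g x"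
    if g: "\<forall>\<^sub>F x in filt U. ap g x \<in> elts T" for g
  proof -
    have F: "DF (\<lambda>x. if ap g x \<in> elts T then ap g x else emp)" by (intro dfn)
    from g ev_base[OF U] have "\<forall>\<^sub>F x in filt U. ap (lam X (\<lambda>x. if ap g x \<in> elts T then ap g x else emp)) x = ap g x"
      by eventually_elim (simp add: F)
    then show ?thesis using lam_in_funs[OF DF_ap T(2)] unfolding D_def by blast
  qed
  have "D2 (\<lambda>f g. um U f g)" by (intro dfn)
  moreover have "\<exists>d\<in>elts E. \<forall>g\<in>elts E. \<not> um U g d" if "E \<noteq> emp" for E
  proof -
    have "elts E \<noteq> {}" using that by (simp only: elts_eq_empty not_False_eq_True)
    then obtain e where "e \<in> elts E" by blast
    from um_wf[OF U this] show ?thesis .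
  qed
  ultimately have "\<exists>h. is_fun h D \<and> (\<forall>d\<in>elts D. elts (ap h d) = {ap h g |g. g \<in> elts D \<and> um U g d})"
    by (rule mostowski)
  then obtain h where h: "is_fun h D" "\<And>d. d \<in> elts D \<Longrightarrow> elts (ap h d) = {ap h g |g. g \<in> elts D \<and> um U g d}"
    by blast
  have um: "ult_mem U f g \<longleftrightarrow> um U f g" if "f \<in> elts D" "g \<in> elts D" for f g
    using D that ult_mem_um[of f U g] by (simp add: base_uf[OF U])
  have "partial_collapse UNIV U D h"
    unfolding partial_collapse_def ult_funs_uf
  proof (intro conjI ballI impI h(1))
    show "elts D \<subseteq> {f. is_fun f X}" using D(1) by blast
    fix f g assume f: "f \<in> elts D" "g \<in> {f. is_fun f X}" and m: "ult_mem U g f"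
    from m f D(1) have "\<forall>\<^sub>F x in filt U. ap g x \<in> elts (ap f x)" by (simp add: ult_mem_ev)
    with ev_base[OF U] have "\<forall>\<^sub>F x in filt U. ap g x \<in> elts T"
    proof eventually_elim
      case (elim x)
      then show ?case using D(2)[OF f(1)] T(1) unfolding transitive_def by blast
    qed
    from cut[OF this] obtain g' where g': "g' \<in> elts D" "\<forall>\<^sub>F x in filt U. ap g' x = ap g x" by blast
    from g'(2) have "\<forall>\<^sub>F x in filt U. ap g x = ap g' x" by eventually_elim simp
    then have "ult_eq U g g'" using g'(1) f(2) D(1) by (simp add: ult_eq_ev)
    with g'(1) show "\<exists>g'\<in>elts D. ult_eq U g g'" by blast
  next
    fix f assume f: "f \<in> elts D"
    have "{app h g |g. g \<in> elts D \<and> ult_mem U g f} = {ap h g |g. g \<in> elts D \<and> um U g f}"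
      using um[OF _ f] app_ap[OF h(1)] by (metis (no_types, lifting))
    then show "elts (app h f) = {app h g |g. g \<in> elts D \<and> ult_mem U g f}"
      using h(2)[OF f] app_ap[OF h(1) f] by simp
  qed
  moreover have "\<forall>\<^sub>F x in filt U. ap f x = ap g x"
    if f: "f \<in> elts D" "g \<in> elts D" "app h f = app h g" for f g
  proof (rule ccontr)
    assume bad: "\<not> (\<forall>\<^sub>F x in filt U. ap f x = ap g x)"
    \<comment> \<open>\<open>B\<close> collects the functions that share their value with an
      inequivalent one. A \<open>um\<close>-minimal member \<open>m\<close>, with partner
      \<open>l\<close>, is refuted below.\<close>
    have "D1 (\<lambda>f. \<exists>g \<in> elts D. ap h f = ap h g \<and> \<not> ue U f g)" by (intro dfn)
    from separation_D1[OF this] obtain B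
      where B: "elts B = {f \<in> elts D. \<exists>g \<in> elts D. ap h f = ap h g \<and> \<not> ue U f g}" ..
    have "ap h f = ap h g" using f app_ap[OF h(1)] by simp
    then have "f \<in> elts B" unfolding B using f bad ue_ev[OF U] by blast
    from um_wf[OF U this] obtain m where m: "m \<in> elts B" "\<And>k. k \<in> elts B \<Longrightarrow> \<not> um U k m" by blast
    then obtain l where l: "m \<in> elts D" "l \<in> elts D" "ap h m = ap h l" "\<not> ue U m l" unfolding B by blast
    have eqD: "D1 (\<lambda>x. ap m x = ap l x)" by (intro dfn)
    have ne: "\<forall>\<^sub>F x in filt U. ap m x \<noteq> ap l x" using l(4) ev_not[OF U eqD] unfolding ue_ev[OF U] by blast
    have ue_um: "um U k' j" if "ue U k k'" "um U k j" for k k' j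
    proof -
      from that have "\<forall>\<^sub>F x in filt U. ap k x = ap k' x" "\<forall>\<^sub>F x in filt U. ap k x \<in> elts (ap j x)"
        unfolding ue_ev[OF U] um_ev[OF U] by blast+
      then have "\<forall>\<^sub>F x in filt U. ap k' x \<in> elts (ap j x)" by eventually_elim simp
      then show ?thesis unfolding um_ev[OF U] .
    qed
    have ue_sym: "ue U k' k" if "ue U k k'" for k k'
      using that unfolding ue_ev[OF U] by (simp add: eq_commute)
    have pick: "\<exists>t \<in> elts D. um U t a \<and> \<not> um U t b"
      if a: "a \<in> elts D" and ex: "\<forall>\<^sub>F x in filt U. \<exists>y \<in> elts (ap a x). y \<notin> elts (ap b x)" for a b
    proof -
      have P: "D2 (\<lambda>x y. y \<notin> elts (ap b x))" by (intro dfn)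
      from ev_choice[OF U P DF_ap ex] obtain t
        where t: "\<forall>\<^sub>F x in filt U. ap t x \<in> elts (ap a x) \<and> ap t x \<notin> elts (ap b x)" by blast
      with ev_base[OF U] have "\<forall>\<^sub>F x in filt U. ap t x \<in> elts T"
      proof eventually_elim
        case (elim x)
        then show ?case using D(2)[OF a] T(1) unfolding transitive_def by blast
      qed
      from cut[OF this] obtain t' where t': "t' \<in> elts D" "\<forall>\<^sub>F x in filt U. ap t' x = ap t x" by blast
      from t t'(2) have 1: "\<forall>\<^sub>F x in filt U. ap t' x \<in> elts (ap a x)" by eventually_elim simp
      from t t'(2) have 2: "\<forall>\<^sub>F x in filt U. ap t' x \<notin> elts (ap b x)" by eventually_elim simp
      have "D1 (\<lambda>x. ap t' x \<in> elts (ap b x))" by (intro dfn)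
      from ev_not[OF U this] 1 2 t'(1) show ?thesis unfolding um_ev[OF U] by blast
    qed
    \<comment> \<open>Almost everywhere one of \<open>ap m x\<close> and \<open>ap l x\<close> has
      an element missing from the other, and the ultrafilter decides which. A choice
      \<open>t\<close> of such elements, or the function \<open>k\<close> that shares the value of
      \<open>t\<close>, then lies in \<open>B\<close> below \<open>m\<close>.\<close>
    have cover: "\<forall>\<^sub>F x in filt U. (\<exists>y \<in> elts (ap m x). y \<notin> elts (ap l x)) \<or> (\<exists>y \<in> elts (ap l x). y \<notin> elts (ap m x))"
      using ne
    proof eventually_elim
      case (elim x)
      then show ?case using vext[of "ap m x" "ap l x"] by blast
    qed
    have "D1 (\<lambda>x. \<exists>y \<in> elts (ap m x). y \<notin> elts (ap l x))" by (intro dfn)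
    from ev_disj[OF U this cover] show False
    proof
      assume "\<forall>\<^sub>F x in filt U. \<exists>y \<in> elts (ap m x). y \<notin> elts (ap l x)"
      from pick[OF l(1) this] obtain t where t: "t \<in> elts D" "um U t m" "\<not> um U t l" by blast
      then have "ap h t \<in> elts (ap h l)" using h(2)[OF l(1)] l(3) by auto
      then obtain k where k: "k \<in> elts D" "um U k l" "ap h t = ap h k" using h(2)[OF l(2)] by auto
      then have "\<not> ue U t k" using ue_um ue_sym t(3) by blast
      then have "t \<in> elts B" unfolding B using t k by blast
      then show False using m(2) t(2) by blast
    next
      assume "\<forall>\<^sub>F x in filt U. \<exists>y \<in> elts (ap l x). y \<notin> elts (ap m x)"
      from pick[OF l(2) this] obtain t where t: "t \<in> elts D" "um U t l" "\<not> um U t m" by blast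
      then have "ap h t \<in> elts (ap h m)" using h(2)[OF l(2)] l(3) by auto
      then obtain k where k: "k \<in> elts D" "um U k m" "ap h t = ap h k" using h(2)[OF l(1)] by auto
      then have "\<not> ue U k t" using ue_um t(3) by blast
      then have "k \<in> elts B" unfolding B using t(1) k(1) k(3)[symmetric] by blast
      then show False using m(2) k(2) by blast
    qed
  qed
  ultimately show ?thesis unfolding D_def by blast
qed

text \<open>One transitive \<open>T\<close> containing all values of \<open>F\<close> and
  \<open>G\<close> lets both classes be read off from the same \<open>h\<close>.\<close>

lemma common_collapse:
  assumes "DF F" "DF G"
  shows "\<exists>T h. partial_collapse UNIV U (funs X T) h \<and>
    (\<forall>f \<in> elts (funs X T). \<forall>g \<in> elts (funs X T). app h f = app h g \<longrightarrow> (\<forall>\<^sub>F x in filt U. ap f x = ap g x)) \<and>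
    lam X F \<in> elts (funs X T) \<and> lam X G \<in> elts (funs X T)"
proof -
  obtain T where T: "transitive T" "elts (un (un (rep X F) (rep X G)) (upair emp emp)) \<subseteq> elts T"
    using transitive_superset by blast
  then have "\<And>x. x \<in> elts X \<Longrightarrow> F x \<in> elts T \<and> G x \<in> elts T" and emp: "emp \<in> elts T"
    by (auto simp: elts_rep[OF assms(1)] elts_rep[OF assms(2)])
  then have "lam X F \<in> elts (funs X T)" "lam X G \<in> elts (funs X T)"
    by (simp_all add: elts_funs is_fun_lam assms)
  with collapse_into[OF T(1) emp] show ?thesis by blast
qed

section \<open>The theorem of Los for equality and membership\<close>

lemma cls_eq_iff:
  assumes F: "DF F" and G: "DF G"
  shows "cls X U F = cls X U G \<longleftrightarrow> (\<forall>\<^sub>F x in filt U. F x = G x)"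
proof -
  from common_collapse[OF F G] obtain T h where pc: "partial_collapse UNIV U (funs X T) h"
    and inj: "\<forall>f \<in> elts (funs X T). \<forall>g \<in> elts (funs X T). app h f = app h g \<longrightarrow> (\<forall>\<^sub>F x in filt U. ap f x = ap g x)"
    and D: "lam X F \<in> elts (funs X T)" "lam X G \<in> elts (funs X T)"
    by blast
  have eq: "(\<forall>\<^sub>F x in filt U. ap (lam X F) x = ap (lam X G) x) \<longleftrightarrow> (\<forall>\<^sub>F x in filt U. F x = G x)"
    by (rule eventually_cong[OF ev_base[OF U]]) (simp add: F G)
  have c: "cls X U F = app h (lam X F)" "cls X U G = app h (lam X G)"
    unfolding cls_def using ult_class_eq[OF ult_congruent_uf pc] D by blast+
  show ?thesis
  proof
    assume "cls X U F = cls X U G"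
    then show "\<forall>\<^sub>F x in filt U. F x = G x" using inj D c eq by simp
  next
    assume "\<forall>\<^sub>F x in filt U. F x = G x"
    then have "ult_eq U (lam X F) (lam X G)" using eq by (simp add: ult_eq_ev is_fun_lam F G)
    from partial_collapse_agree[OF ult_congruent_uf pc pc D this] show "cls X U F = cls X U G" using c by simp
  qed
qed

lemma elts_cls:
  assumes F: "DF F"
  shows "elts (cls X U F) = {cls X U G | G. DF G \<and> (\<forall>\<^sub>F x in filt U. G x \<in> elts (F x))}"
proof -
  from common_collapse[OF F F] obtain T h where pc: "partial_collapse UNIV U (funs X T) h"
        and D: "lam X F \<in> elts (funs X T)" 
    by blast
  have val: "ult_class UNIV U f = app h f" if "f \<in> elts (funs X T)" for f
    using ult_class_eq[OF ult_congruent_uf pc that] .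
  have eq: "(\<forall>\<^sub>F x in filt U. ap g x \<in> elts (ap (lam X F) x)) \<longleftrightarrow> (\<forall>\<^sub>F x in filt U. ap g x \<in> elts (F x))" for g
    by (rule eventually_cong[OF ev_base[OF U]]) (simp add: F)
  show ?thesis
  proof (intro equalityI subsetI)
    fix y assume "y \<in> elts (cls X U F)"
    then have "y \<in> elts (app h (lam X F))" using val[OF D] by (simp add: cls_def)
    then obtain g where g: "g \<in> elts (funs X T)" "ult_mem U g (lam X F)" "y = app h g"
      using partial_collapseD(4)[OF pc D] by blast
    then have gf: "is_fun g X" by (simp add: elts_funs)
    then have "\<forall>\<^sub>F x in filt U. ap g x \<in> elts (F x)"
      using g(2) eq by (simp add: ult_mem_ev is_fun_lam[OF F])
    moreover have "y = cls X U (ap g)"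
      using val[OF g(1)] g(3) is_fun_eq_lam[OF gf] by (simp add: cls_def)
    ultimately show "y \<in> {cls X U G | G. DF G \<and> (\<forall>\<^sub>F x in filt U. G x \<in> elts (F x))}"
      using DF_ap[of g] by blast
  next
    fix y assume "y \<in> {cls X U G | G. DF G \<and> (\<forall>\<^sub>F x in filt U. G x \<in> elts (F x))}"
    then obtain G where G: "y = cls X U G" "DF G" "\<forall>\<^sub>F x in filt U. G x \<in> elts (F x)" by blast
    \<comment> \<open>The values of \<open>G\<close> may leave the earlier bound, so a new collapse
      that covers both functions is taken.\<close>
    from common_collapse[OF F G(2)] obtain T h where pc: "partial_collapse UNIV U (funs X T) h"
            and D: "lam X F \<in> elts (funs X T)" "lam X G \<in> elts (funs X T)"
      by blast
    from ev_base[OF U] G(3) have "\<forall>\<^sub>F x in filt U. ap (lam X G) x \<in> elts (ap (lam X F) x)"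
      by eventually_elim (simp add: F G)
    then have "ult_mem U (lam X G) (lam X F)" by (simp add: ult_mem_ev is_fun_lam F G)
    then have "app h (lam X G) \<in> elts (app h (lam X F))" using partial_collapseD(4)[OF pc D(1)] D(2) by blast
    then show "y \<in> elts (cls X U F)"
      unfolding G cls_def ult_class_eq[OF ult_congruent_uf pc D(1)] ult_class_eq[OF ult_congruent_uf pc D(2)] .
  qed
qed

lemma mem_cls_iff:
  assumes F: "DF F" and G: "DF G"
  shows "cls X U G \<in> elts (cls X U F) \<longleftrightarrow> (\<forall>\<^sub>F x in filt U. G x \<in> elts (F x))"
proof
  assume "cls X U G \<in> elts (cls X U F)"
  then obtain H where H: "cls X U G = cls X U H" "DF H" "\<forall>\<^sub>F x in filt U. H x \<in> elts (F x)"
    unfolding elts_cls[OF F] by blast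
  from H(1) have "\<forall>\<^sub>F x in filt U. G x = H x" using cls_eq_iff[OF G H(2)] by blast
  with H(3) show "\<forall>\<^sub>F x in filt U. G x \<in> elts (F x)" by eventually_elim simp
qed (use G in \<open>auto simp: elts_cls[OF F]\<close>)

lemma Ult_uf: "Ult UNIV U = {cls X U F | F. DF F}"
proof -
  have 1: "ult_class UNIV U f = cls X U (ap f)" if "f \<in> ult_funs UNIV U" for f
    using that is_fun_eq_lam[of f X] unfolding ult_funs_uf cls_def by simp
  have 2: "cls X U F \<in> Ult UNIV U" if "DF F" for F
    unfolding cls_def Ult_def by (rule imageI) (simp add: ult_funs_uf is_fun_lam that)
  show ?thesis
  proof (intro equalityI subsetI)
    fix y assume "y \<in> Ult UNIV U"
    then obtain f where "f \<in> ult_funs UNIV U" "y = ult_class UNIV U f" unfolding Ult_def by (elim imageE)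
    with 1[of f] DF_ap[of f] show "y \<in> {cls X U F | F. DF F}" by blast
  qed (use 2 in blast)
qed

lemma ult_emb_uf: "ult_emb UNIV U c = cls X U (\<lambda>_. c)"
proof -
  have "setof {pair z c | z. z \<in> elts X} = lam X (\<lambda>_. c)"
    by (rule setof_eq) (auto simp: elts_lam[OF DT_const])
  then show ?thesis by (simp add: ult_emb_def cls_def base_uf[OF U])
qed

lemma ult_id_uf: "ult_id UNIV U = cls X U (\<lambda>x. x)"
proof -
  have "setof {pair z z | z. z \<in> elts X} = lam X (\<lambda>x. x)"
    by (rule setof_eq) (auto simp: elts_lam[OF DT_var])
  then show ?thesis by (simp add: ult_id_def cls_def base_uf[OF U])
qed

text \<open>By uniqueness of the collapse, being the class of a function means being its value under
  some partial collapse, which is a formula. Hence sets of classes can be formed, and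
  \<open>cls\<close> may occur in internal inductions.\<close>

lemma DT_cls:
  assumes "DT mem (\<lambda>s. F (s 0) (\<lambda>n. s (Suc n)))"
  shows "DT mem (\<lambda>s. cls X U (\<lambda>x. F x s))"
proof -
  \<comment> \<open>\<open>partial_collapse\<close> with \<open>app\<close>, \<open>ult_mem\<close>
    and \<open>ult_eq\<close> replaced by their definable counterparts.\<close>
  define pc where "pc D h \<longleftrightarrow> (\<forall>f \<in> elts D. is_fun f X) \<and> is_fun h D \<and>
     (\<forall>f \<in> elts D. \<forall>g. is_fun g X \<longrightarrow> um U g f \<longrightarrow> (\<exists>g' \<in> elts D. ue U g g')) \<and>
     (\<forall>f \<in> elts D. \<forall>u. u \<in> elts (ap h f) \<longleftrightarrow> (\<exists>g \<in> elts D. um U g f \<and> u = ap h g))" for D h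
  have pc: "partial_collapse UNIV U D h \<longleftrightarrow> pc D h" for D h
  proof (cases "(\<forall>f \<in> elts D. is_fun f X) \<and> is_fun h D")
    case True
    have m: "ult_mem U f g \<longleftrightarrow> um U f g" "ult_eq U f g \<longleftrightarrow> ue U f g" if "is_fun f X" "is_fun g X" for f g
      using that ult_mem_um[of f U g] ult_eq_ue[of f U g] by (simp_all add: base_uf[OF U])
    have a: "app h f = ap h f" if "f \<in> elts D" for f using True that by (blast intro: app_ap)
    show ?thesis
    proof
      assume p: "partial_collapse UNIV U D h"
      note p' = partial_collapseD[OF p, unfolded ult_funs_uf]
      have "\<forall>f \<in> elts D. \<forall>g. is_fun g X \<longrightarrow> um U g f \<longrightarrow> (\<exists>g' \<in> elts D. ue U g g')"
        using p'(3) m True by (metis mem_Collect_eq)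
      moreover have "u \<in> elts (ap h f) \<longleftrightarrow> (\<exists>g \<in> elts D. um U g f \<and> u = ap h g)" if "f \<in> elts D" for f u
        using p'(4)[OF that, of u] m(1)[of _ f] True that a by (metis (no_types, lifting))
      ultimately show "pc D h" unfolding pc_def using True by blast
    next
      assume p: "pc D h"
      have "\<exists>g' \<in> elts D. ult_eq U g g'" if "f \<in> elts D" "is_fun g X" "ult_mem U g f" for f g
        using that p m True unfolding pc_def by metis
      moreover have "elts (app h f) = {app h g |g. g \<in> elts D \<and> ult_mem U g f}" if "f \<in> elts D" for f
      proof -
        have "u \<in> elts (ap h f) \<longleftrightarrow> (\<exists>g \<in> elts D. um U g f \<and> u = ap h g)" for u
          using p that unfolding pc_def by blast
        then show ?thesis unfolding a[OF that] using m(1)[of _ f] True that a by (auto, metis)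
      qed
      ultimately show "partial_collapse UNIV U D h"
        unfolding partial_collapse_def ult_funs_uf using True by blast
    qed
  next
    case False
    then show ?thesis using partial_collapseD(1,2)[of UNIV U D h] unfolding pc_def ult_funs_uf by blast
  qed
  have [dfn]: "DT mem t \<Longrightarrow> DT mem u \<Longrightarrow> Dfn mem (\<lambda>s. pc (t s) (u s))" for t u
    by (rule Dfn_inst2) (unfold pc_def, intro dfn)
  have eq: "y = cls X U G \<longleftrightarrow> (\<exists>f. f = lam X G \<and> (\<exists>D h. pc D h \<and> f \<in> elts D \<and> y = ap h f))" if G: "DF G" for y G
  proof -
    from common_collapse[OF G G] obtain T h where p: "partial_collapse UNIV U (funs X T) h"
            and D: "lam X G \<in> elts (funs X T)"
      by blast
    have c: "cls X U G = ap h (lam X G)" if "pc D h" "lam X G \<in> elts D" for D h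
      using ult_class_eq[OF ult_congruent_uf, of D h] that pc partial_collapseD(2)[of UNIV U D h]
      by (simp add: cls_def app_ap)
    from p pc have "pc (funs X T) h" by simp
    with D c show ?thesis by metis
  qed
  have "Dfn mem (\<lambda>s. \<exists>f. f = lam X (\<lambda>x. F x (\<lambda>n. s (Suc n))) \<and> (\<exists>D h. pc D h \<and> f \<in> elts D \<and> s 0 = ap h f))"
  proof (intro dfn)
    show "DT mem (\<lambda>s. F (s 0) (\<lambda>n. s (Suc (Suc (Suc n)))))"
      using DT_shift[OF assms, of "case_nat 0 (\<lambda>n. n + 3)"] by (simp add: numeral_3_eq_3)
  qed
  moreover have "(s 0 = cls X U (\<lambda>x. F x (\<lambda>n. s (Suc n)))) =
    (\<exists>f. f = lam X (\<lambda>x. F x (\<lambda>n. s (Suc n))) \<and> (\<exists>D h. pc D h \<and> f \<in> elts D \<and> s 0 = ap h f))" for s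
    by (rule eq, rule DF_fix_env[OF assms])
  ultimately show ?thesis unfolding DT_def by simp
qed

lemma cls_cong: "DF F \<Longrightarrow> DF G \<Longrightarrow> \<forall>\<^sub>F x in filt U. F x = G x \<Longrightarrow> cls X U F = cls X U G"
  by (simp add: cls_eq_iff)

lemma cls_memE:
  assumes "y \<in> elts (cls X U F)" "DF F"
  obtains G where "DF G" "y = cls X U G" "\<forall>\<^sub>F x in filt U. G x \<in> elts (F x)"
  using assms elts_cls by blast

section \<open>Transfer of inclusion, pairs, natural numbers and the order of finite sets\<close>

lemma cls_subset_iff:
  assumes F: "DF F" and G: "DF G"
  shows "elts (cls X U F) \<subseteq> elts (cls X U G) \<longleftrightarrow> (\<forall>\<^sub>F x in filt U. elts (F x) \<subseteq> elts (G x))"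
proof
  note [dfn] = DFI[OF F] DFI[OF G]
  assume sub: "elts (cls X U F) \<subseteq> elts (cls X U G)"
  have D: "D1 (\<lambda>x. elts (F x) \<subseteq> elts (G x))" by (intro dfn)
  show "\<forall>\<^sub>F x in filt U. elts (F x) \<subseteq> elts (G x)"
  proof (rule ccontr)
    assume "\<not> ?thesis"
    then have "\<forall>\<^sub>F x in filt U. \<not> elts (F x) \<subseteq> elts (G x)" using ev_not[OF U D] by simp
    then have ex: "\<forall>\<^sub>F x in filt U. \<exists>y \<in> elts (F x). y \<notin> elts (G x)" by eventually_elim blast
    have P: "D2 (\<lambda>x y. y \<notin> elts (G x))" by (intro dfn)
    from ev_choice[OF U P F ex] obtain t
      where t: "\<forall>\<^sub>F x in filt U. ap t x \<in> elts (F x) \<and> ap t x \<notin> elts (G x)" by blast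
    then have "cls X U (ap t) \<in> elts (cls X U F)"
      unfolding mem_cls_iff[OF F DF_ap] by eventually_elim simp
    then have "\<forall>\<^sub>F x in filt U. ap t x \<in> elts (G x)" using sub mem_cls_iff[OF G DF_ap] by blast
    with t have "\<forall>\<^sub>F x in filt U. False" by eventually_elim simp
    then show False using ev_False[OF U] by contradiction
  qed
next
  assume sub: "\<forall>\<^sub>F x in filt U. elts (F x) \<subseteq> elts (G x)"
  show "elts (cls X U F) \<subseteq> elts (cls X U G)"
  proof
    fix y assume "y \<in> elts (cls X U F)"
    then obtain H where H: "DF H" "y = cls X U H" "\<forall>\<^sub>F x in filt U. H x \<in> elts (F x)"
      using F by (rule cls_memE)
    from sub H(3) have "\<forall>\<^sub>F x in filt U. H x \<in> elts (G x)" by eventually_elim blast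
    then show "y \<in> elts (cls X U G)" using mem_cls_iff[OF G H(1)] H(2) by simp
  qed
qed

lemma cls_upair:
  assumes F: "DF F" and G: "DF G"
  shows "cls X U (\<lambda>x. upair (F x) (G x)) = upair (cls X U F) (cls X U G)"
proof (rule vext)
  note [dfn] = DFI[OF F] DFI[OF G]
  have D: "DF (\<lambda>x. upair (F x) (G x))" by (intro dfn)
  fix y
  show "y \<in> elts (cls X U (\<lambda>x. upair (F x) (G x))) \<longleftrightarrow> y \<in> elts (upair (cls X U F) (cls X U G))"
  proof
    assume "y \<in> elts (cls X U (\<lambda>x. upair (F x) (G x)))"
    then obtain H where H: "DF H" "y = cls X U H" "\<forall>\<^sub>F x in filt U. H x \<in> elts (upair (F x) (G x))"
      using D by (rule cls_memE)
    note [dfn] = DFI[OF H(1)]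
    have D1: "D1 (\<lambda>x. H x = F x)" by (intro dfn)
    from H(3) have "\<forall>\<^sub>F x in filt U. H x = F x \<or> H x = G x" by eventually_elim simp
    from ev_disj[OF U D1 this] show "y \<in> elts (upair (cls X U F) (cls X U G))"
      using cls_eq_iff[OF H(1) F] cls_eq_iff[OF H(1) G] H(2) by auto
  next
    assume "y \<in> elts (upair (cls X U F) (cls X U G))"
    then have "y = cls X U F \<or> y = cls X U G" by simp
    then show "y \<in> elts (cls X U (\<lambda>x. upair (F x) (G x)))"
      using mem_cls_iff[OF D F] mem_cls_iff[OF D G] by auto
  qed
qed

lemma cls_pair:
  assumes F: "DF F" and G: "DF G"
  shows "cls X U (\<lambda>x. pair (F x) (G x)) = pair (cls X U F) (cls X U G)"
proof -
  note [dfn] = DFI[OF F] DFI[OF G]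
  have D: "DF (\<lambda>x. upair (F x) (F x))" "DF (\<lambda>x. upair (F x) (G x))" by (intro dfn)+
  show ?thesis unfolding pair_upair cls_upair[OF D] cls_upair[OF F F] cls_upair[OF F G] ..
qed

lemma cls_emp: "cls X U (\<lambda>_. emp) = emp"
proof -
  have D: "DF (\<lambda>_. emp)" by (intro dfn)
  have "elts (cls X U (\<lambda>_. emp)) = {}"
    unfolding elts_cls[OF D] using ev_False[OF U] by simp
  then show ?thesis by simp
qed

text \<open>An internal induction, possible because \<open>cls\<close> is definable. It allows
  sequences of the ultrapower to be indexed by the same \<open>omega\<close> as sequences of the
  universe.\<close>

lemma cls_natural:
  assumes "natural n" shows "cls X U (\<lambda>_. n) = n"
proof -
  note [dfn] = DT_cls
  have D: "D1 (\<lambda>n. cls X U (\<lambda>_. n) = n)" by (intro dfn)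
  show ?thesis
  proof (rule omega_induct[OF assms D])
    fix n assume IH: "cls X U (\<lambda>_. n) = n"
    have C: "DF (\<lambda>_. c)" for c by (intro dfn)
    show "cls X U (\<lambda>_. suc n) = suc n"
    proof (rule vext)
      fix y
      show "y \<in> elts (cls X U (\<lambda>_. suc n)) \<longleftrightarrow> y \<in> elts (suc n)"
      proof
        assume "y \<in> elts (cls X U (\<lambda>_. suc n))"
        then obtain H where H: "DF H" "y = cls X U H" "\<forall>\<^sub>F x in filt U. H x \<in> elts (suc n)"
          using C by (rule cls_memE)
        note [dfn] = DFI[OF H(1)]
        have D1: "D1 (\<lambda>x. H x = n)" by (intro dfn)
        from H(3) have "\<forall>\<^sub>F x in filt U. H x = n \<or> H x \<in> elts n" by eventually_elim simp
        from ev_disj[OF U D1 this] have "y = cls X U (\<lambda>_. n) \<or> y \<in> elts (cls X U (\<lambda>_. n))"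
          using cls_eq_iff[OF H(1) C] mem_cls_iff[OF C H(1)] H(2) by blast
        then show "y \<in> elts (suc n)" unfolding IH by simp
      next
        assume "y \<in> elts (suc n)"
        then have "y = cls X U (\<lambda>_. n) \<or> y \<in> elts (cls X U (\<lambda>_. n))" unfolding IH by simp
        moreover have "elts (cls X U (\<lambda>_. n)) \<subseteq> elts (cls X U (\<lambda>_. suc n))"
          unfolding cls_subset_iff[OF C C] by (rule always_eventually) auto
        ultimately show "y \<in> elts (cls X U (\<lambda>_. suc n))" using mem_cls_iff[OF C C] by auto
      qed
    qed
  qed (rule cls_emp)
qed

text \<open>An instance of the theorem of Los done by hand. The top point is represented by a
  function, and violations of its maximality, if present almost everywhere, could be chosen from
  \<open>un (F x) (G x)\<close> and would represent a violation in the ultrapower.\<close>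

lemma fin_less_cls:
  assumes F: "DF F" and G: "DF G"
  shows "fin_less (cls X U F) (cls X U G) \<longleftrightarrow> (\<forall>\<^sub>F x in filt U. fin_less (F x) (G x))"
proof
  note [dfn] = DFI[OF F] DFI[OF G]
  assume "fin_less (cls X U F) (cls X U G)"
  then obtain y where y: "y \<in> elts (cls X U G)" "y \<notin> elts (cls X U F)"
    "\<And>z. z \<in> (elts (cls X U F) - elts (cls X U G)) \<union> (elts (cls X U G) - elts (cls X U F)) \<Longrightarrow> z = y \<or> z \<in> elts y"
    unfolding fin_less_def by (auto simp: elts_def)
  from y(1) G obtain m where m: "DF m" "y = cls X U m" "\<forall>\<^sub>F x in filt U. m x \<in> elts (G x)" by (rule cls_memE)
  note [dfn] = DFI[OF m(1)]
  have D: "D1 (\<lambda>x. m x \<in> elts (F x))" by (intro dfn)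
  have m': "\<forall>\<^sub>F x in filt U. m x \<notin> elts (F x)"
    using y(2) unfolding m(2) mem_cls_iff[OF F m(1)] ev_not[OF U D] .
  define Q where "Q x z \<longleftrightarrow> ((z \<in> elts (F x) \<and> z \<notin> elts (G x)) \<or> (z \<in> elts (G x) \<and> z \<notin> elts (F x))) \<and> \<not> (z = m x \<or> z \<in> elts (m x))" for x z
  have Q: "D2 Q" unfolding Q_def by (intro dfn)
  note [dfn] = D2I[OF Q]
  have D: "D1 (\<lambda>x. \<exists>z. Q x z)" by (intro dfn)
  have no: "\<forall>\<^sub>F x in filt U. \<not> (\<exists>z. Q x z)"
  proof (rule ccontr)
    assume "\<not> ?thesis"
    then have "\<forall>\<^sub>F x in filt U. \<exists>z. Q x z" using ev_not[OF U D] by blast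
    then have ex: "\<forall>\<^sub>F x in filt U. \<exists>z \<in> elts (un (F x) (G x)). Q x z"
      by eventually_elim (auto simp: Q_def)
    have B: "DF (\<lambda>x. un (F x) (G x))" by (intro dfn)
    from ev_choice[OF U Q B ex] obtain t where "\<forall>\<^sub>F x in filt U. ap t x \<in> elts (un (F x) (G x)) \<and> Q x (ap t x)" ..
    then have t: "\<forall>\<^sub>F x in filt U. Q x (ap t x)" by eventually_elim simp
    have D: "D1 (\<lambda>x. ap t x \<in> elts (F x) \<and> ap t x \<notin> elts (G x))"
      "D1 (\<lambda>x. ap t x \<in> elts (F x))" "D1 (\<lambda>x. ap t x \<in> elts (G x))" by (intro dfn)+
    from t have "\<forall>\<^sub>F x in filt U. (ap t x \<in> elts (F x) \<and> ap t x \<notin> elts (G x)) \<or> (ap t x \<in> elts (G x) \<and> ap t x \<notin> elts (F x))"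
      by eventually_elim (simp add: Q_def)
    from ev_disj[OF U D(1) this]
    have "cls X U (ap t) \<in> (elts (cls X U F) - elts (cls X U G)) \<union> (elts (cls X U G) - elts (cls X U F))"
      unfolding eventually_conj_iff ev_not[OF U D(2)] ev_not[OF U D(3)]
      using mem_cls_iff[OF F DF_ap, of t] mem_cls_iff[OF G DF_ap, of t] by blast
    from y(3)[OF this] have "(\<forall>\<^sub>F x in filt U. ap t x = m x) \<or> (\<forall>\<^sub>F x in filt U. ap t x \<in> elts (m x))"
      unfolding m(2) cls_eq_iff[OF DF_ap m(1)] mem_cls_iff[OF m(1) DF_ap] .
    then have "\<forall>\<^sub>F x in filt U. ap t x = m x \<or> ap t x \<in> elts (m x)"
      by (auto elim: eventually_mono)
    with t have "\<forall>\<^sub>F x in filt U. False" by eventually_elim (simp add: Q_def)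
    then show False using ev_False[OF U] by contradiction
  qed
  from no m(3) m' show "\<forall>\<^sub>F x in filt U. fin_less (F x) (G x)"
  proof eventually_elim
    case (elim x)
    then show ?case unfolding fin_less_def Q_def elts_def by blast
  qed
next
  note [dfn] = DFI[OF F] DFI[OF G]
  assume less: "\<forall>\<^sub>F x in filt U. fin_less (F x) (G x)"
  define P where "P x m \<longleftrightarrow> m \<notin> elts (F x) \<and> (\<forall>z. (z \<in> elts (F x) \<and> z \<notin> elts (G x)) \<or> (z \<in> elts (G x) \<and> z \<notin> elts (F x)) \<longrightarrow> z = m \<or> z \<in> elts m)" for x m
  have P: "D2 P" unfolding P_def by (intro dfn)
  from less have ex: "\<forall>\<^sub>F x in filt U. \<exists>m \<in> elts (G x). P x m"
    by eventually_elim (auto simp: fin_less_def P_def elts_def)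
  from ev_choice[OF U P G ex] obtain m where m: "\<forall>\<^sub>F x in filt U. ap m x \<in> elts (G x) \<and> P x (ap m x)" by blast
  have D: "D1 (\<lambda>x. ap m x \<in> elts (F x))" by (intro dfn)
  from m have "\<forall>\<^sub>F x in filt U. ap m x \<in> elts (G x)" "\<forall>\<^sub>F x in filt U. ap m x \<notin> elts (F x)"
    by (auto elim: eventually_mono simp: P_def)
  then have "cls X U (ap m) \<in> elts (cls X U G) - elts (cls X U F)"
    using mem_cls_iff[OF G DF_ap] mem_cls_iff[OF F DF_ap] ev_not[OF U D] by blast
  moreover have "z = cls X U (ap m) \<or> z \<in> elts (cls X U (ap m))"
    if z: "z \<in> (elts (cls X U F) - elts (cls X U G)) \<union> (elts (cls X U G) - elts (cls X U F))" for z
  proof -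
    obtain t where t: "DF t" "z = cls X U t" using z elts_cls[OF F] elts_cls[OF G] by blast
    note [dfn] = DFI[OF t(1)]
    have D: "D1 (\<lambda>x. t x \<in> elts (F x))" "D1 (\<lambda>x. t x \<in> elts (G x))" "D1 (\<lambda>x. t x = ap m x)" by (intro dfn)+
    have "((\<forall>\<^sub>F x in filt U. t x \<in> elts (F x)) \<and> (\<forall>\<^sub>F x in filt U. t x \<notin> elts (G x))) \<or>
          ((\<forall>\<^sub>F x in filt U. t x \<in> elts (G x)) \<and> (\<forall>\<^sub>F x in filt U. t x \<notin> elts (F x)))"
      unfolding ev_not[OF U D(1)] ev_not[OF U D(2)]
      using z unfolding t(2) using mem_cls_iff[OF F t(1)] mem_cls_iff[OF G t(1)] by blast
    then have "\<forall>\<^sub>F x in filt U. (t x \<in> elts (F x) \<and> t x \<notin> elts (G x)) \<or> (t x \<in> elts (G x) \<and> t x \<notin> elts (F x))"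
      unfolding eventually_conj_iff[symmetric] by (auto elim: eventually_mono)
    with m have "\<forall>\<^sub>F x in filt U. t x = ap m x \<or> t x \<in> elts (ap m x)"
      unfolding P_def by eventually_elim blast
    from ev_disj[OF U D(3) this] show ?thesis
      unfolding t(2) cls_eq_iff[OF t(1) DF_ap] mem_cls_iff[OF DF_ap t(1)] .
  qed
  ultimately show "fin_less (cls X U F) (cls X U G)" unfolding fin_less_def elts_def by blast
qed

lemma fin_le_cls:
  assumes F: "DF F" and G: "DF G"
  shows "fin_le (cls X U F) (cls X U G) \<longleftrightarrow> (\<forall>\<^sub>F x in filt U. fin_le (F x) (G x))"
proof -
  note [dfn] = DFI[OF F] DFI[OF G]
  have "D1 (\<lambda>x. fin_less (F x) (G x))" by (intro dfn)
  from ev_disj[OF U this, of "\<lambda>x. F x = G x"]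
  have "(\<forall>\<^sub>F x in filt U. fin_le (F x) (G x)) \<longleftrightarrow>
        (\<forall>\<^sub>F x in filt U. fin_less (F x) (G x)) \<or> (\<forall>\<^sub>F x in filt U. F x = G x)"
    unfolding fin_le_def by (auto elim: eventually_mono)
  then show ?thesis by (simp add: fin_le_def fin_less_cls[OF F G] cls_eq_iff[OF F G])
qed

end

end

section \<open>Factoring an ultrapower of the universe\<close>

context ZFC_model
begin

text \<open>The fibre of \<open>A\<close> over \<open>x\<close> along \<open>q\<close>, its points
  being named by their other coordinate \<open>r\<close>. The class of
  \<open>x \<mapsto> Sec q r A x\<close> is the set of the ultrapower that \<open>A\<close>
  represents.\<close>

definition Sec :: "('a \<Rightarrow> 'a) \<Rightarrow> ('a \<Rightarrow> 'a) \<Rightarrow> 'a \<Rightarrow> 'a \<Rightarrow> 'a" where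
  "Sec q r A x = rep (sep A (\<lambda>\<sigma>. q \<sigma> = x)) r"

text \<open>The ultrafilter over \<open>Ult V U\<close> whose ultrapower is the factor of \<open>Ult V F\<close>.\<close>

definition quot :: "'a \<Rightarrow> 'a \<Rightarrow> ('a \<Rightarrow> 'a) \<Rightarrow> ('a \<Rightarrow> 'a) \<Rightarrow> 'a \<Rightarrow> 'a" where
  "quot X U q r F = rep F (\<lambda>A. cls X U (Sec q r A))"

text \<open>The function of \<open>Ult V U\<close> on \<open>cls X U (Sec q r S)\<close> that corresponds to \<open>f\<close> on \<open>S\<close>.\<close>

definition curried :: "'a \<Rightarrow> 'a \<Rightarrow> 'a \<Rightarrow> ('a \<Rightarrow> 'a) \<Rightarrow> ('a \<Rightarrow> 'a) \<Rightarrow> ('a \<Rightarrow> 'a) \<Rightarrow> 'a" where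
  "curried X U S q r f = cls X U (\<lambda>x. rep (sep S (\<lambda>\<sigma>. q \<sigma> = x)) (\<lambda>\<sigma>. pair (r \<sigma>) (f \<sigma>)))"

end

text \<open>\<open>S\<close> is a total space over \<open>X\<close> with projection
  \<open>q\<close>, and \<open>r\<close> is a coordinate that is injective on each fibre. Keeping
  \<open>q\<close> and \<open>r\<close> abstract allows one set of pairs to be read over either of
  its coordinates.\<close>

locale sectioned = ZFC_model +
  fixes X U S :: 'a and q r :: "'a \<Rightarrow> 'a"
  assumes U: "uf X U" and q: "DF q" and r: "DF r"
    and q_in: "\<sigma> \<in> elts S \<Longrightarrow> q \<sigma> \<in> elts X"
    and qr_inj: "\<sigma> \<in> elts S \<Longrightarrow> \<tau> \<in> elts S \<Longrightarrow> q \<sigma> = q \<tau> \<Longrightarrow> r \<sigma> = r \<tau> \<Longrightarrow> \<sigma> = \<tau>"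
begin

abbreviation code :: "'a \<Rightarrow> 'a" where
  "code A \<equiv> cls X U (Sec q r A)"

lemmas section_dfn [dfn] = DFI[OF q] DFI[OF r] DT_cls[OF U]

lemma DT_Sec [dfn]:
  assumes "DT mem A" "DT mem x" shows "DT mem (\<lambda>s. Sec q r (A s) (x s))"
proof (rule DT_inst2[OF _ assms])
  show "Dfn mem (\<lambda>s. s 0 = Sec q r (s 1) (s 2))" unfolding Sec_def by (intro dfn)
qed

lemma DF_Sec: "DF (Sec q r A)"
  by (intro dfn)

lemma elts_Sec: "elts (Sec q r A x) = {r \<sigma> | \<sigma>. \<sigma> \<in> elts A \<and> q \<sigma> = x}"
proof -
  have "D1 (\<lambda>\<sigma>. q \<sigma> = x)" by (intro dfn)
  then show ?thesis unfolding Sec_def elts_rep[OF r] by (auto simp: elts_sep)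
qed

lemma mem_Sec: "elts A \<subseteq> elts S \<Longrightarrow> \<sigma> \<in> elts S \<Longrightarrow> r \<sigma> \<in> elts (Sec q r A (q \<sigma>)) \<longleftrightarrow> \<sigma> \<in> elts A"
proof
  assume A: "elts A \<subseteq> elts S" and \<sigma>: "\<sigma> \<in> elts S" and "r \<sigma> \<in> elts (Sec q r A (q \<sigma>))"
  then obtain \<tau> where \<tau>: "\<tau> \<in> elts A" "q \<tau> = q \<sigma>" "r \<tau> = r \<sigma>" unfolding elts_Sec by auto
  then have "\<tau> = \<sigma>" using A \<sigma> qr_inj[of \<tau> \<sigma>] by auto
  with \<tau>(1) show "\<sigma> \<in> elts A" by simp
qed (auto simp: elts_Sec)

lemma elts_quot: "elts (quot X U q r F) = {code A | A. A \<in> elts F}"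
proof -
  have "DF (\<lambda>A. code A)" by (intro dfn)
  from elts_rep[OF this] show ?thesis unfolding quot_def by auto
qed

lemma sections:
  assumes t: "DF t" and ev: "\<forall>\<^sub>F x in filt U. t x \<in> elts (Sec q r S x)"
  obtains s where "DF s" "\<forall>\<^sub>F x in filt U. s x \<in> elts S \<and> q (s x) = x" "\<forall>\<^sub>F x in filt U. t x = r (s x)"
proof -
  note [dfn] = DFI[OF t]
  have P: "D2 (\<lambda>x \<sigma>. q \<sigma> = x \<and> t x = r \<sigma>)" and B: "DF (\<lambda>_. S)" by (intro dfn)+
  from ev have ex: "\<forall>\<^sub>F x in filt U. \<exists>\<sigma> \<in> elts S. q \<sigma> = x \<and> t x = r \<sigma>"
    by eventually_elim (auto simp: elts_Sec)
  from ev_choice[OF U P B ex] obtain s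
    where "\<forall>\<^sub>F x in filt U. ap s x \<in> elts S \<and> q (ap s x) = x \<and> t x = r (ap s x)" by blast
  then have "\<forall>\<^sub>F x in filt U. ap s x \<in> elts S \<and> q (ap s x) = x" "\<forall>\<^sub>F x in filt U. t x = r (ap s x)"
    by (auto elim: eventually_mono)
  with DF_ap[of s] show ?thesis by (rule that)
qed

text \<open>Points of \<open>code S\<close> correspond to sections \<open>s\<close> of
  \<open>q\<close>. This normal form reduces statements about \<open>code S\<close> to statements
  that hold along a section almost everywhere.\<close>

lemma quot_base_memE:
  assumes "y \<in> elts (code S)"
  obtains s where "DF s" "\<forall>\<^sub>F x in filt U. s x \<in> elts S \<and> q (s x) = x" "y = cls X U (\<lambda>x. r (s x))"
proof -
  from assms DF_Sec obtain t where t: "DF t" "y = cls X U t" "\<forall>\<^sub>F x in filt U. t x \<in> elts (Sec q r S x)"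
    by (rule cls_memE[OF U])
  from t(1,3) obtain s where s: "DF s" "\<forall>\<^sub>F x in filt U. s x \<in> elts S \<and> q (s x) = x" "\<forall>\<^sub>F x in filt U. t x = r (s x)"
    by (rule sections)
  have "DF (\<lambda>x. r (s x))" by (intro dfn DFI[OF s(1)])
  from cls_cong[OF U t(1) this s(3)] show ?thesis using that s(1,2) t(2) by blast
qed

lemma section_mem_iff:
  assumes s: "DF s" "\<forall>\<^sub>F x in filt U. s x \<in> elts S \<and> q (s x) = x" and A: "elts A \<subseteq> elts S"
  shows "cls X U (\<lambda>x. r (s x)) \<in> elts (code A) \<longleftrightarrow> (\<forall>\<^sub>F x in filt U. s x \<in> elts A)"
proof -
  have D: "DF (\<lambda>x. r (s x))" by (intro dfn DFI[OF s(1)])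
  show ?thesis unfolding mem_cls_iff[OF U DF_Sec D]
  proof (rule eventually_cong[OF s(2)])
    fix x assume "s x \<in> elts S \<and> q (s x) = x"
    then show "r (s x) \<in> elts (Sec q r A x) \<longleftrightarrow> s x \<in> elts A" using mem_Sec[OF A, of "s x"] by simp
  qed
qed

lemma Sec_mono: "elts A \<subseteq> elts B \<Longrightarrow> elts (code A) \<subseteq> elts (code B)"
  unfolding cls_subset_iff[OF U DF_Sec DF_Sec] by (rule always_eventually) (auto simp: elts_Sec)

lemma section_mem_base:
  assumes "DF s" "\<forall>\<^sub>F x in filt U. s x \<in> elts S \<and> q (s x) = x"
  shows "cls X U (\<lambda>x. r (s x)) \<in> elts (code S)"
  unfolding section_mem_iff[OF assms subset_refl] using assms(2) by eventually_elim simp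

text \<open>The common pattern for computing complements, intersections and Boolean values inside
  the ultrapower: a comprehension over \<open>code S\<close> is identified by testing it on
  sections.\<close>

lemma setof_sections:
  assumes A: "elts A \<subseteq> elts S"
    and P: "\<And>s. DF s \<Longrightarrow> \<forall>\<^sub>F x in filt U. s x \<in> elts S \<and> q (s x) = x \<Longrightarrow>
      P (cls X U (\<lambda>x. r (s x))) \<longleftrightarrow> (\<forall>\<^sub>F x in filt U. s x \<in> elts A)"
  shows "setof {y \<in> elts (code S). P y} = code A"
proof (rule setof_eq, intro equalityI subsetI)
  fix y assume y: "y \<in> elts (code A)"
  then have y': "y \<in> elts (code S)" using Sec_mono[OF A] by blast
  from y' obtain s where s: "DF s" "\<forall>\<^sub>F x in filt U. s x \<in> elts S \<and> q (s x) = x" "y = cls X U (\<lambda>x. r (s x))"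
    by (rule quot_base_memE)
  with y y' show "y \<in> {y \<in> elts (code S). P y}"
    using P[OF s(1,2)] section_mem_iff[OF s(1,2) A] by simp
next
  fix y assume y: "y \<in> {y \<in> elts (code S). P y}"
  then have "y \<in> elts (code S)" by simp
  then obtain s where s: "DF s" "\<forall>\<^sub>F x in filt U. s x \<in> elts S \<and> q (s x) = x" "y = cls X U (\<lambda>x. r (s x))"
    by (rule quot_base_memE)
  with y show "y \<in> elts (code A)"
    using P[OF s(1,2)] section_mem_iff[OF s(1,2) A] by simp
qed

text \<open>If \<open>b\<close> represents the subset, the points \<sigma> of \<open>S\<close> with
  \<open>r \<sigma> \<in> elts (b (q \<sigma>))\<close> form the wanted \<open>A\<close>. Thus every
  subset of \<open>code S\<close> that lies in the ultrapower is a code.\<close>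

lemma subset_of_quot_base:
  assumes "B \<in> Ult UNIV U" "elts B \<subseteq> elts (code S)"
  obtains A where "elts A \<subseteq> elts S" "B = code A"
proof -
  from assms(1) obtain b where b: "DF b" "B = cls X U b" unfolding Ult_uf[OF U] by blast
  note [dfn] = DFI[OF b(1)]
  have D: "D1 (\<lambda>\<sigma>. r \<sigma> \<in> elts (b (q \<sigma>)))" by (intro dfn)
  let ?A = "sep S (\<lambda>\<sigma>. r \<sigma> \<in> elts (b (q \<sigma>)))"
  have "\<forall>\<^sub>F x in filt U. elts (b x) \<subseteq> elts (Sec q r S x)"
    using assms(2) unfolding b(2) cls_subset_iff[OF U b(1) DF_Sec] .
  then have "\<forall>\<^sub>F x in filt U. b x = Sec q r ?A x"
  proof eventually_elim
    case (elim x)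
    show ?case
    proof (rule extensionality)
      show "elts (b x) = elts (Sec q r ?A x)" using elim unfolding elts_Sec elts_sep[OF D] by blast
    qed
  qed
  then have "B = code ?A" unfolding b(2) by (rule cls_cong[OF U b(1) DF_Sec])
  moreover have "elts ?A \<subseteq> elts S" unfolding elts_sep[OF D] by blast
  ultimately show ?thesis using that by blast
qed

lemma cls_in_Ult: "DF f \<Longrightarrow> cls X U f \<in> Ult UNIV U"
  unfolding Ult_uf[OF U] by blast

lemma cls_Sec_dif:
  assumes A: "elts A \<subseteq> elts S"
  shows "setof (elts (code S) - elts (code A)) = cls X U (Sec q r (dif S A))"
  unfolding set_diff_eq
proof (rule setof_sections)
  fix s assume s: "DF s" "\<forall>\<^sub>F x in filt U. s x \<in> elts S \<and> q (s x) = x"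
  note [dfn] = DFI[OF s(1)]
  have D: "D1 (\<lambda>x. s x \<in> elts A)" by (intro dfn)
  have "(\<forall>\<^sub>F x in filt U. s x \<in> elts (dif S A)) \<longleftrightarrow> (\<forall>\<^sub>F x in filt U. s x \<notin> elts A)"
    by (rule eventually_cong[OF s(2)]) simp
  then show "cls X U (\<lambda>x. r (s x)) \<notin> elts (code A) \<longleftrightarrow> (\<forall>\<^sub>F x in filt U. s x \<in> elts (dif S A))"
    unfolding section_mem_iff[OF s A] ev_not[OF U D] by simp
qed auto

lemma cls_Sec_Int:
  assumes A: "elts A \<subseteq> elts S" and B: "elts B \<subseteq> elts S"
  shows "setof (elts (code A) \<inter> elts (code B)) = cls X U (Sec q r (setof (elts A \<inter> elts B)))"
proof -
  have "elts (code A) \<inter> elts (code B) =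
    {y \<in> elts (code S). y \<in> elts (code A) \<and> y \<in> elts (code B)}"
    using Sec_mono[OF A] by blast
  moreover have "setof \<dots> = cls X U (Sec q r (setof (elts A \<inter> elts B)))"
  proof (rule setof_sections)
    fix s assume s: "DF s" "\<forall>\<^sub>F x in filt U. s x \<in> elts S \<and> q (s x) = x"
    show "(cls X U (\<lambda>x. r (s x)) \<in> elts (code A) \<and> cls X U (\<lambda>x. r (s x)) \<in> elts (code B))
      \<longleftrightarrow> (\<forall>\<^sub>F x in filt U. s x \<in> elts (setof (elts A \<inter> elts B)))"
      unfolding section_mem_iff[OF s A] section_mem_iff[OF s B] setof_Int by (simp add: eventually_conj_iff)
  qed (use A in \<open>auto simp: setof_Int\<close>)
  ultimately show ?thesis by simp
qed

end

section \<open>The external ultrafilter over \<open>Ult V U\<close> given by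
  \<open>F\<close>\<close>

locale factored = sectioned +
  fixes F :: 'a
  assumes F: "uf S F" and proj: "A \<in> elts U \<Longrightarrow> \<forall>\<^sub>F \<sigma> in filt F. q \<sigma> \<in> elts A"
begin

abbreviation W :: 'a where
  "W \<equiv> quot X U q r F"

abbreviation cur :: "('a \<Rightarrow> 'a) \<Rightarrow> 'a" where
  "cur \<equiv> curried X U S q r"

lemma ev_proj: assumes "\<forall>\<^sub>F x in filt U. P x" shows "\<forall>\<^sub>F \<sigma> in filt F. P (q \<sigma>)"
proof -
  from assms obtain A where A: "A \<in> elts U" "\<forall>x \<in> elts A. P x" unfolding eventually_filt[OF U] by blast
  from proj[OF A(1)] show ?thesis by eventually_elim (use A in blast)
qed

text \<open>\<open>proj\<close> gives one direction, and maximality of \<open>U\<close> the other: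
  \<open>U\<close> is the image of \<open>F\<close> under \<open>q\<close>.\<close>

lemma ev_proj_iff:
  assumes D: "D1 P" shows "(\<forall>\<^sub>F \<sigma> in filt F. P (q \<sigma>)) \<longleftrightarrow> (\<forall>\<^sub>F x in filt U. P x)"
proof
  assume P: "\<forall>\<^sub>F \<sigma> in filt F. P (q \<sigma>)"
  show "\<forall>\<^sub>F x in filt U. P x"
  proof (rule ccontr)
    assume "\<not> ?thesis"
    then have "\<forall>\<^sub>F x in filt U. \<not> P x" unfolding ev_not[OF U D] .
    from ev_proj[OF this] P have "\<forall>\<^sub>F \<sigma> in filt F. False" by eventually_elim simp
    then show False using ev_False[OF F] by contradiction
  qed
qed (rule ev_proj)

text \<open>\<open>code\<close> is not injective, so membership has to be seen independent of the
  representative. Sets with the same code have equal fibres over \<open>U\<close>-almost all points,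
  hence agree at \<open>F\<close>-almost all points by the projection.\<close>

lemma quot_mem_iff:
  assumes A: "elts A \<subseteq> elts S"
  shows "code A \<in> elts W \<longleftrightarrow> A \<in> elts F"
proof
  assume "code A \<in> elts W"
  then obtain B where B: "B \<in> elts F" "code A = code B"
    unfolding elts_quot by blast
  from B(2) have "\<forall>\<^sub>F x in filt U. Sec q r A x = Sec q r B x" using cls_eq_iff[OF U DF_Sec DF_Sec] by blast
  from ev_proj[OF this] ev_mem[OF F B(1)] have "\<forall>\<^sub>F \<sigma> in filt F. \<sigma> \<in> elts A"
  proof eventually_elim
    case (elim \<sigma>)
    have "elts B \<subseteq> elts S" using uf_sub[OF F B(1)] .
    with elim A show ?case using mem_Sec[of B \<sigma>] mem_Sec[of A \<sigma>] by auto
  qed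
  then show "A \<in> elts F" using mem_ev[OF F A] by simp
qed (use elts_quot in blast)

text \<open>Choose sets of \<open>F\<close> whose codes form the sequence. By countable completeness
  of \<open>U\<close> the intersection of the codes is the code of the intersection, and that set
  lies in \<open>F\<close> by countable completeness of \<open>F\<close>.\<close>

lemma quot_cc:
  assumes f: "is_fun f omega" "\<forall>n \<in> elts omega. app f n \<in> elts W"
  shows "setof {y \<in> elts (code S). \<forall>n \<in> elts omega. y \<in> elts (app f n)} \<in> elts W"
proof -
  have P: "D2 (\<lambda>n A. ap f n = code A)" and B: "DF (\<lambda>_. F)" by (intro dfn)+
  have "\<exists>a. is_fun a omega \<and> (\<forall>n \<in> elts omega. ap a n \<in> elts F \<and> ap f n = cls X U (Sec q r (ap a n)))"
  proof (rule bounded_choice[OF P B])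
    fix n assume "n \<in> elts omega"
    then show "\<exists>A \<in> elts F. ap f n = code A"
      using f(2) app_ap[OF f(1)] unfolding elts_quot by auto
  qed
  then obtain a where a: "\<And>n. natural n \<Longrightarrow> ap a n \<in> elts F" "\<And>n. natural n \<Longrightarrow> ap f n = cls X U (Sec q r (ap a n))"
    by auto
  have aS: "elts (ap a n) \<subseteq> elts S" if "natural n" for n using uf_sub[OF F a(1)[OF that]] .
  have D: "D1 (\<lambda>\<sigma>. \<forall>n. natural n \<longrightarrow> \<sigma> \<in> elts (ap a n))" by (intro dfn)
  let ?C = "sep S (\<lambda>\<sigma>. \<forall>n. natural n \<longrightarrow> \<sigma> \<in> elts (ap a n))"
  have "setof {y \<in> elts (code S). \<forall>n \<in> elts omega. y \<in> elts (app f n)} = code ?C"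
  proof (rule setof_sections)
    show "elts ?C \<subseteq> elts S" unfolding elts_sep[OF D] by blast
    fix s assume s: "DF s" "\<forall>\<^sub>F x in filt U. s x \<in> elts S \<and> q (s x) = x"
    note [dfn] = DFI[OF s(1)]
    have P: "D2 (\<lambda>n x. s x \<in> elts (ap a n))" by (intro dfn)
    have "(\<forall>n \<in> elts omega. cls X U (\<lambda>x. r (s x)) \<in> elts (app f n)) \<longleftrightarrow>
      (\<forall>n. natural n \<longrightarrow> (\<forall>\<^sub>F x in filt U. s x \<in> elts (ap a n)))"
      using section_mem_iff[OF s aS] a(2) app_ap[OF f(1)] by simp
    also have "\<dots> \<longleftrightarrow> (\<forall>\<^sub>F x in filt U. \<forall>n. natural n \<longrightarrow> s x \<in> elts (ap a n))"
      by (rule ev_omega_iff[OF U P])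
    also have "\<dots> \<longleftrightarrow> (\<forall>\<^sub>F x in filt U. s x \<in> elts ?C)"
      by (rule eventually_cong[OF s(2)]) (simp add: elts_sep[OF D])
    finally show "(\<forall>n \<in> elts omega. cls X U (\<lambda>x. r (s x)) \<in> elts (app f n)) \<longleftrightarrow> (\<forall>\<^sub>F x in filt U. s x \<in> elts ?C)" .
  qed
  moreover have "?C \<in> elts F"
  proof (rule uf_cc[OF F DF_ap[of a] a(1)])
    show "elts ?C \<subseteq> elts S" unfolding elts_sep[OF D] by blast
  qed (auto simp: elts_sep[OF D])
  ultimately show ?thesis unfolding elts_quot by blast
qed

theorem cc_ultrafilter_quot: "cc_ultrafilter (Ult UNIV U) (code S) W"
  unfolding cc_ultrafilter_def
proof (intro conjI ballI impI)
  have "elts S \<subseteq> elts S" by simp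
  show "code S \<in> Ult UNIV U" by (rule cls_in_Ult[OF DF_Sec])
  show "code S \<in> elts W"
    using quot_mem_iff[OF \<open>elts S \<subseteq> elts S\<close>] uf_top[OF F] by simp
  have FS: "\<And>A. A \<in> elts F \<Longrightarrow> elts A \<subseteq> elts S" by (rule uf_sub[OF F])
  fix A assume "A \<in> elts W"
  then obtain A0 where A0: "A0 \<in> elts F" "A = code A0" unfolding elts_quot by blast
  show "A \<in> Ult UNIV U" unfolding A0 by (rule cls_in_Ult[OF DF_Sec])
  show "elts A \<subseteq> elts (code S)" unfolding A0 by (rule Sec_mono[OF FS[OF A0(1)]])
  { fix B assume "B \<in> elts W"
    then obtain B0 where B0: "B0 \<in> elts F" "B = code B0" unfolding elts_quot by blast
    have "setof (elts A0 \<inter> elts B0) \<in> elts F"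
      by (rule uf_Int[OF F A0(1) B0(1)]) (use FS[OF A0(1)] in \<open>auto simp: setof_Int\<close>)
    then show "setof (elts A \<inter> elts B) \<in> elts W"
      unfolding A0(2) B0(2) cls_Sec_Int[OF FS[OF A0(1)] FS[OF B0(1)]] elts_quot by blast }
  { fix B assume B: "B \<in> Ult UNIV U" "elts A \<subseteq> elts B \<and> elts B \<subseteq> elts (code S)"
    from B(1) conjunct2[OF B(2)] obtain B0 where B0: "elts B0 \<subseteq> elts S" "B = code B0"
      by (rule subset_of_quot_base)
    \<comment> \<open>Inclusion of codes is inclusion of fibres over almost all \<open>x\<close>;
      the projection converts it into an implication that holds \<open>F\<close>-almost
      everywhere.\<close>
    from B(2) have "\<forall>\<^sub>F x in filt U. elts (Sec q r A0 x) \<subseteq> elts (Sec q r B0 x)"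
      unfolding A0(2) B0(2) cls_subset_iff[OF U DF_Sec DF_Sec] by blast
    from ev_proj[OF this] ev_mem[OF F A0(1)] have "\<forall>\<^sub>F \<sigma> in filt F. \<sigma> \<in> elts B0"
    proof eventually_elim
      case (elim \<sigma>)
      then show ?case using mem_Sec[OF FS[OF A0(1)], of \<sigma>] mem_Sec[OF B0(1), of \<sigma>] FS[OF A0(1)] by auto
    qed
    then show "B \<in> elts W"
      unfolding B0(2) quot_mem_iff[OF B0(1)] mem_ev[OF F B0(1)] . }
next
  show "setof {} \<notin> elts W"
  proof
    assume "setof {} \<in> elts W"
    then have "emp \<in> elts W" by simp
    moreover have "code emp = emp"
    proof -
      have "Sec q r emp = (\<lambda>_. emp)" by (rule ext, rule extensionality) (simp add: elts_Sec)
      then show ?thesis using cls_emp[OF U] by simp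
    qed
    ultimately have "emp \<in> elts F" using quot_mem_iff[of emp] by simp
    then show False using uf_emp[OF F] by contradiction
  qed
next
  fix A assume A: "A \<in> Ult UNIV U" "elts A \<subseteq> elts (code S)"
  then obtain A0 where A0: "elts A0 \<subseteq> elts S" "A = code A0"
    by (rule subset_of_quot_base)
  have "elts (dif S A0) \<subseteq> elts S" by auto
  then show "A \<in> elts W \<or> setof (elts (code S) - elts A) \<in> elts W"
    unfolding A0(2) cls_Sec_dif[OF A0(1)] using quot_mem_iff[OF A0(1)] quot_mem_iff uf_dif[OF F A0(1)] by blast
next
  fix f assume "is_fun f omega \<and> (\<forall>n\<in>elts omega. app f n \<in> elts W)"
  then show "setof {x \<in> elts (code S). \<forall>n\<in>elts omega. x \<in> elts (app f n)} \<in> elts W"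
    using quot_cc by blast
qed

lemma base_quot: "base W = code S"
  unfolding base_def
proof (rule setof_eq)
  have "code S \<in> elts W"
    unfolding elts_quot using uf_top[OF F] by blast
  moreover have "elts A \<subseteq> elts (code S)" if "A \<in> elts W" for A
    using that Sec_mono uf_sub[OF F] unfolding elts_quot by blast
  ultimately show "elts (code S) = \<Union> (elts ` elts W)" by blast
qed

section \<open>Functions on \<open>S\<close> and functions of the inner ultrapower\<close>

lemma DT_curried [dfn]:
  assumes "DT mem k" shows "DT mem (\<lambda>s. cur (ap (k s)))"
  by (rule DT_inst1[OF _ assms]) (unfold curried_def, intro dfn)

lemma DF_fiber: assumes "DF f" shows "DF (\<lambda>x. rep (sep S (\<lambda>\<sigma>. q \<sigma> = x)) (\<lambda>\<sigma>. pair (r \<sigma>) (f \<sigma>)))"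
  by (intro dfn DFI[OF assms])

lemma elts_fiber:
  assumes "DF f"
  shows "elts (rep (sep S (\<lambda>\<sigma>. q \<sigma> = x)) (\<lambda>\<sigma>. pair (r \<sigma>) (f \<sigma>))) = {pair (r \<sigma>) (f \<sigma>) | \<sigma>. \<sigma> \<in> elts S \<and> q \<sigma> = x}"
proof -
  note [dfn] = DFI[OF assms]
  have D: "DF (\<lambda>\<sigma>. pair (r \<sigma>) (f \<sigma>))" "D1 (\<lambda>\<sigma>. q \<sigma> = x)" by (intro dfn)+
  show ?thesis unfolding elts_rep[OF D(1)] elts_sep[OF D(2)] by blast
qed

lemma curried_in_Ult: "DF f \<Longrightarrow> cur f \<in> Ult UNIV U"
  unfolding curried_def by (rule cls_in_Ult[OF DF_fiber])

lemma curried_cong: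
  assumes "DF f" "DF g" "\<And>\<sigma>. \<sigma> \<in> elts S \<Longrightarrow> f \<sigma> = g \<sigma>"
  shows "cur f = cur g"
  unfolding curried_def
proof (rule cls_cong[OF U DF_fiber[OF assms(1)] DF_fiber[OF assms(2)]], rule always_eventually, rule allI, rule extensionality)
  fix x
  show "elts (rep (sep S (\<lambda>\<sigma>. q \<sigma> = x)) (\<lambda>\<sigma>. pair (r \<sigma>) (f \<sigma>))) = elts (rep (sep S (\<lambda>\<sigma>. q \<sigma> = x)) (\<lambda>\<sigma>. pair (r \<sigma>) (g \<sigma>)))"
    unfolding elts_fiber[OF assms(1)] elts_fiber[OF assms(2)] using assms(3) by metis
qed

lemma pair_curried:
  assumes f: "DF f" and s: "DF s" "\<forall>\<^sub>F x in filt U. s x \<in> elts S \<and> q (s x) = x"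
  shows "pair (cls X U (\<lambda>x. r (s x))) (cls X U (\<lambda>x. f (s x))) \<in> elts (cur f)"
proof -
  note [dfn] = DFI[OF f] DFI[OF s(1)]
  have D: "DF (\<lambda>x. r (s x))" "DF (\<lambda>x. f (s x))" "DF (\<lambda>x. pair (r (s x)) (f (s x)))" by (intro dfn)+
  show ?thesis
    unfolding cls_pair[OF U D(1,2), symmetric] curried_def mem_cls_iff[OF U DF_fiber[OF f] D(3)] elts_fiber[OF f]
    using s(2) by eventually_elim blast
qed

lemma curried_memE:
  assumes f: "DF f" and p: "p \<in> elts (cur f)"
  obtains s where "DF s" "\<forall>\<^sub>F x in filt U. s x \<in> elts S \<and> q (s x) = x"
    "p = pair (cls X U (\<lambda>x. r (s x))) (cls X U (\<lambda>x. f (s x)))"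
proof -
  note [dfn] = DFI[OF f]
  from p obtain H where H: "DF H" "p = cls X U H"
    "\<forall>\<^sub>F x in filt U. H x \<in> elts (rep (sep S (\<lambda>\<sigma>. q \<sigma> = x)) (\<lambda>\<sigma>. pair (r \<sigma>) (f \<sigma>)))"
    unfolding curried_def using DF_fiber[OF f] by (rule cls_memE[OF U])
  note [dfn] = DFI[OF H(1)]
  have P: "D2 (\<lambda>x \<sigma>. q \<sigma> = x \<and> H x = pair (r \<sigma>) (f \<sigma>))" and B: "DF (\<lambda>_. S)" by (intro dfn)+
  from H(3) have ex: "\<forall>\<^sub>F x in filt U. \<exists>\<sigma> \<in> elts S. q \<sigma> = x \<and> H x = pair (r \<sigma>) (f \<sigma>)"
    unfolding elts_fiber[OF f] by eventually_elim blast
  from ev_choice[OF U P B ex] obtain s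
    where s: "\<forall>\<^sub>F x in filt U. ap s x \<in> elts S \<and> q (ap s x) = x \<and> H x = pair (r (ap s x)) (f (ap s x))" by blast
  have D: "DF (\<lambda>x. r (ap s x))" "DF (\<lambda>x. f (ap s x))" "DF (\<lambda>x. pair (r (ap s x)) (f (ap s x)))" by (intro dfn)+
  from s have "\<forall>\<^sub>F x in filt U. H x = pair (r (ap s x)) (f (ap s x))" by eventually_elim simp
  then have "p = pair (cls X U (\<lambda>x. r (ap s x))) (cls X U (\<lambda>x. f (ap s x)))"
    unfolding H(2) cls_pair[OF U D(1,2), symmetric] by (rule cls_cong[OF U H(1) D(3)])
  moreover from s have "\<forall>\<^sub>F x in filt U. ap s x \<in> elts S \<and> q (ap s x) = x" by eventually_elim simp
  ultimately show ?thesis using that DF_ap by blast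
qed

lemma is_fun_curried: assumes f: "DF f" shows "is_fun (cur f) (code S)"
  unfolding is_fun_def
proof (intro conjI ballI)
  fix p assume "p \<in> elts (cur f)"
  with f obtain s where s: "DF s" "\<forall>\<^sub>F x in filt U. s x \<in> elts S \<and> q (s x) = x"
    "p = pair (cls X U (\<lambda>x. r (s x))) (cls X U (\<lambda>x. f (s x)))" by (rule curried_memE)
  then show "\<exists>x\<in>elts (code S). \<exists>y. p = pair x y" using section_mem_base[OF s(1,2)] by blast
next
  fix y assume "y \<in> elts (code S)"
  then obtain s where s: "DF s" "\<forall>\<^sub>F x in filt U. s x \<in> elts S \<and> q (s x) = x" "y = cls X U (\<lambda>x. r (s x))"
    by (rule quot_base_memE)
  show "\<exists>!z. pair y z \<in> elts (cur f)"
  proof (rule ex1I)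
    show "pair y (cls X U (\<lambda>x. f (s x))) \<in> elts (cur f)"
      unfolding s(3) by (rule pair_curried[OF f s(1,2)])
    fix z assume "pair y z \<in> elts (cur f)"
    with f obtain s' where s': "DF s'" "\<forall>\<^sub>F x in filt U. s' x \<in> elts S \<and> q (s' x) = x"
      "pair y z = pair (cls X U (\<lambda>x. r (s' x))) (cls X U (\<lambda>x. f (s' x)))" by (rule curried_memE)
    have D: "DF (\<lambda>x. r (s x))" "DF (\<lambda>x. r (s' x))" "DF (\<lambda>x. f (s x))" "DF (\<lambda>x. f (s' x))"
      by (intro dfn DFI[OF f] DFI[OF s(1)] DFI[OF s'(1)])+
    from s'(3) have "cls X U (\<lambda>x. r (s x)) = cls X U (\<lambda>x. r (s' x))" and z: "z = cls X U (\<lambda>x. f (s' x))"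
      unfolding s(3) by auto
    then have "\<forall>\<^sub>F x in filt U. r (s x) = r (s' x)" using cls_eq_iff[OF U D(1,2)] by blast
    with s(2) s'(2) have "\<forall>\<^sub>F x in filt U. f (s' x) = f (s x)"
    proof eventually_elim
      case (elim x)
      then show ?case using qr_inj[of "s x" "s' x"] by simp
    qed
    then show "z = cls X U (\<lambda>x. f (s x))" unfolding z by (rule cls_cong[OF U D(4,3)])
  qed
qed

lemma ap_curried:
  assumes f: "DF f" and s: "DF s" "\<forall>\<^sub>F x in filt U. s x \<in> elts S \<and> q (s x) = x"
  shows "ap (cur f) (cls X U (\<lambda>x. r (s x))) = cls X U (\<lambda>x. f (s x))"
  using ap_pair[OF is_fun_curried[OF f] section_mem_base[OF s]] pair_curried[OF assms] by metis

lemma app_curried: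
  assumes f: "DF f" and s: "DF s" "\<forall>\<^sub>F x in filt U. s x \<in> elts S \<and> q (s x) = x"
  shows "app (cur f) (cls X U (\<lambda>x. r (s x))) = cls X U (\<lambda>x. f (s x))"
  using app_ap[OF is_fun_curried[OF f] section_mem_base[OF s]] ap_curried[OF assms] by simp

text \<open>Along a section both sides evaluate to classes modulo \<open>U\<close>, so the Boolean
  value in the inner ultrapower is the code of the Boolean value on \<open>S\<close>. Together with
  the analogue for equality this makes \<open>cur\<close> an embedding of ultrapowers.\<close>

lemma ult_mem_curried:
  assumes f: "DF f" and g: "DF g"
  shows "ult_mem W (cur f) (cur g) \<longleftrightarrow> (\<forall>\<^sub>F \<sigma> in filt F. f \<sigma> \<in> elts (g \<sigma>))"
proof -
  note [dfn] = DFI[OF f] DFI[OF g]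
  have D: "D1 (\<lambda>\<sigma>. f \<sigma> \<in> elts (g \<sigma>))" by (intro dfn)
  let ?A = "sep S (\<lambda>\<sigma>. f \<sigma> \<in> elts (g \<sigma>))"
  have A: "elts ?A \<subseteq> elts S" unfolding elts_sep[OF D] by blast
  have "setof {y \<in> elts (code S). app (cur f) y \<in> elts (app (cur g) y)}
      = code ?A"
  proof (rule setof_sections[OF A])
    fix s assume s: "DF s" "\<forall>\<^sub>F x in filt U. s x \<in> elts S \<and> q (s x) = x"
    have D': "DF (\<lambda>x. f (s x))" "DF (\<lambda>x. g (s x))" by (intro dfn DFI[OF s(1)])+
    show "app (cur f) (cls X U (\<lambda>x. r (s x))) \<in> elts (app (cur g) (cls X U (\<lambda>x. r (s x))))
      \<longleftrightarrow> (\<forall>\<^sub>F x in filt U. s x \<in> elts ?A)"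
      unfolding app_curried[OF f s] app_curried[OF g s] mem_cls_iff[OF U D'(2,1)]
      by (rule eventually_cong[OF s(2)]) (simp add: elts_sep[OF D])
  qed
  then have "setof {y \<in> elts (code S). app (cur f) y \<^bold>\<in> app (cur g) y}
      = code ?A"
    by (simp add: elts_def[of "app (cur g) y" for y])
  then show ?thesis
    unfolding ult_mem_def base_quot ev_iff[OF F D] quot_mem_iff[OF A, symmetric] by simp
qed

lemma ult_eq_curried:
  assumes f: "DF f" and g: "DF g"
  shows "ult_eq W (cur f) (cur g) \<longleftrightarrow> (\<forall>\<^sub>F \<sigma> in filt F. f \<sigma> = g \<sigma>)"
proof -
  note [dfn] = DFI[OF f] DFI[OF g]
  have D: "D1 (\<lambda>\<sigma>. f \<sigma> = g \<sigma>)" by (intro dfn)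
  let ?A = "sep S (\<lambda>\<sigma>. f \<sigma> = g \<sigma>)"
  have A: "elts ?A \<subseteq> elts S" unfolding elts_sep[OF D] by blast
  have "setof {y \<in> elts (code S). app (cur f) y = app (cur g) y}
      = code ?A"
  proof (rule setof_sections[OF A])
    fix s assume s: "DF s" "\<forall>\<^sub>F x in filt U. s x \<in> elts S \<and> q (s x) = x"
    have D': "DF (\<lambda>x. f (s x))" "DF (\<lambda>x. g (s x))" by (intro dfn DFI[OF s(1)])+
    show "app (cur f) (cls X U (\<lambda>x. r (s x))) = app (cur g) (cls X U (\<lambda>x. r (s x)))
      \<longleftrightarrow> (\<forall>\<^sub>F x in filt U. s x \<in> elts ?A)"
      unfolding app_curried[OF f s] app_curried[OF g s] cls_eq_iff[OF U D']
      by (rule eventually_cong[OF s(2)]) (simp add: elts_sep[OF D])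
  qed
  then show ?thesis
    unfolding ult_eq_def base_quot ev_iff[OF F D] quot_mem_iff[OF A, symmetric] by simp
qed

text \<open>Let \<open>g\<close> represent \<open>G\<close>. On almost every fibre
  \<open>g x\<close> is single-valued at the points that matter, so evaluating
  \<open>g (q \<sigma>)\<close> at \<open>r \<sigma>\<close> uncurries it.\<close>

lemma curried_surj:
  assumes "G \<in> ult_funs (Ult UNIV U) W"
  shows "\<exists>f. DF f \<and> G = cur f"
proof -
  have G: "is_fun G (code S)" "G \<in> Ult UNIV U"
    using assms unfolding ult_funs_def base_quot by blast+
  from G(2) obtain g where g: "DF g" "G = cls X U g" unfolding Ult_uf[OF U] by blast
  note [dfn] = DFI[OF g(1)]
  have f: "DF (\<lambda>\<sigma>. ap (g (q \<sigma>)) (r \<sigma>))" by (intro dfn)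
  let ?f = "\<lambda>\<sigma>. ap (g (q \<sigma>)) (r \<sigma>)"
  have "G = cur ?f"
  proof (rule is_fun_ext[OF G(1) is_fun_curried[OF f]])
    fix y assume y: "y \<in> elts (code S)"
    then obtain s where s: "DF s" "\<forall>\<^sub>F x in filt U. s x \<in> elts S \<and> q (s x) = x" "y = cls X U (\<lambda>x. r (s x))"
      by (rule quot_base_memE)
    note [dfn] = DFI[OF s(1)]
    have rs: "DF (\<lambda>x. r (s x))" by (intro dfn)
    \<comment> \<open>The value \<open>ap G y\<close> needs a representative of its own. It is
      reached by descending from the class of \<open>g\<close> through the layers of a Kuratowski
      pair, each step staying in the ultrapower.\<close>
    have p: "pair y (ap G y) \<in> elts (cls X U g)" using ap_pair[OF G(1) y] g(2) by simp
    then obtain H where H: "DF H" "pair y (ap G y) = cls X U H" using g(1) by (rule cls_memE[OF U])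
    have "upair y (ap G y) \<in> elts (cls X U H)" unfolding H(2)[symmetric] pair_upair by simp
    then obtain H' where H': "DF H'" "upair y (ap G y) = cls X U H'" using H(1) by (rule cls_memE[OF U])
    have "ap G y \<in> elts (cls X U H')" unfolding H'(2)[symmetric] by simp
    then obtain b where b: "DF b" "ap G y = cls X U b" using H'(1) by (rule cls_memE[OF U])
    note [dfn] = DFI[OF b(1)]
    have pb: "DF (\<lambda>x. pair (r (s x)) (b x))" by (intro dfn)
    have gb: "\<forall>\<^sub>F x in filt U. pair (r (s x)) (b x) \<in> elts (g x)"
      using p unfolding b(2) unfolding s(3) cls_pair[OF U rs b(1), symmetric] mem_cls_iff[OF U g(1) pb] .
    define P where "P x c \<longleftrightarrow> pair (r (s x)) c \<in> elts (g x) \<and> c \<noteq> b x" for x c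
    have P: "D2 P" unfolding P_def by (intro dfn)
    note [dfn] = D2I[OF P]
    have D: "D1 (\<lambda>x. \<exists>c. P x c)" by (intro dfn)
    \<comment> \<open>A second value over almost every \<open>x\<close> could be chosen, as
      components of pairs in \<open>g x\<close> lie in its double union, and would make
      \<open>G\<close> two-valued at \<open>y\<close>.\<close>
    have "\<forall>\<^sub>F x in filt U. \<not> (\<exists>c. P x c)"
    proof (rule ccontr)
      assume "\<not> ?thesis"
      then have "\<forall>\<^sub>F x in filt U. \<exists>c. P x c" using ev_not[OF U D] by blast
      then have ex: "\<forall>\<^sub>F x in filt U. \<exists>c \<in> elts (bigun (bigun (g x))). P x c"
      proof eventually_elim
        case (elim x)
        then obtain c where c: "P x c" by blast
        then have "pair (r (s x)) c \<in> elts (g x)" by (simp add: P_def)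
        then have "upair (r (s x)) c \<in> elts (bigun (g x))" unfolding pair_upair elts_bigun by fastforce
        then have "c \<in> elts (bigun (bigun (g x)))" unfolding elts_bigun[of "bigun _"] by (rule UN_I) simp
        with c show ?case by blast
      qed
      have B: "DF (\<lambda>x. bigun (bigun (g x)))" by (intro dfn)
      from ev_choice[OF U P B ex] obtain c where "\<forall>\<^sub>F x in filt U. ap c x \<in> elts (bigun (bigun (g x))) \<and> P x (ap c x)" ..
      then have c: "\<forall>\<^sub>F x in filt U. P x (ap c x)" by eventually_elim simp
      have pc: "DF (\<lambda>x. pair (r (s x)) (ap c x))" by (intro dfn)
      from c have "\<forall>\<^sub>F x in filt U. pair (r (s x)) (ap c x) \<in> elts (g x)" by eventually_elim (simp add: P_def)
      then have "pair y (cls X U (ap c)) \<in> elts G"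
        unfolding g(2) s(3) cls_pair[OF U rs DF_ap, symmetric] mem_cls_iff[OF U g(1) pc] .
      then have "cls X U (ap c) = cls X U b" using ap_pair[OF G(1) y] b(2) by simp
      then have "\<forall>\<^sub>F x in filt U. ap c x = b x" using cls_eq_iff[OF U DF_ap b(1)] by blast
      with c have "\<forall>\<^sub>F x in filt U. False" by eventually_elim (simp add: P_def)
      then show False using ev_False[OF U] by contradiction
    qed
    with gb s(2) have "\<forall>\<^sub>F x in filt U. b x = ?f (s x)"
    proof eventually_elim
      case (elim x)
      then have "pair (r (s x)) c \<in> elts (g x) \<longleftrightarrow> c = b x" for c unfolding P_def by blast
      then have "ap (g x) (r (s x)) = b x" unfolding ap_def by simp
      then show ?case using elim by simp
    qed
    moreover have fs: "DF (\<lambda>x. ?f (s x))" by (intro dfn)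
    ultimately show "ap G y = ap (cur ?f) y"
      unfolding s(3) ap_curried[OF f s(1,2)] unfolding s(3)[symmetric] b(2) by (intro cls_cong[OF U b(1)])
  qed
  show ?thesis by (intro exI[of _ ?f] conjI f \<open>G = cur ?f\<close>)
qed

lemma ult_funs_quot: "ult_funs (Ult UNIV U) W = {cur f | f. DF f}"
proof (intro equalityI subsetI)
  fix G assume "G \<in> ult_funs (Ult UNIV U) W"
  from curried_surj[OF this] show "G \<in> {cur f | f. DF f}" by blast
next
  fix G assume "G \<in> {cur f | f. DF f}"
  then obtain f where "DF f" "G = cur f" by blast
  then show "G \<in> ult_funs (Ult UNIV U) W"
    unfolding ult_funs_def base_quot using is_fun_curried curried_in_Ult by blast
qed

lemma ult_congruent_quot: "ult_congruent (Ult UNIV U) W"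
  unfolding ult_congruent_def ult_funs_quot
proof (intro conjI ballI impI)
  fix f g assume fg: "f \<in> {cur f | f. DF f}" "g \<in> {cur f | f. DF f}"
    and e: "ult_eq W f g"
  from fg obtain f0 g0 where *: "DF f0" "f = cur f0" "DF g0" "g = cur g0" by blast
  from e have "\<forall>\<^sub>F \<sigma> in filt F. f0 \<sigma> = g0 \<sigma>" unfolding * ult_eq_curried[OF *(1,3)] .
  then have "\<forall>\<^sub>F \<sigma> in filt F. g0 \<sigma> = f0 \<sigma>" by eventually_elim simp
  then show "ult_eq W g f" unfolding * ult_eq_curried[OF *(3,1)] .
next
  fix f f' g g' assume fg: "f \<in> {cur f | f. DF f}" "f' \<in> {cur f | f. DF f}"
    "g \<in> {cur f | f. DF f}" "g' \<in> {cur f | f. DF f}"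
    and e: "ult_eq W f f'" "ult_eq W g g'" "ult_mem W f g"
  from fg obtain f0 f1 g0 g1 where *: "DF f0" "f = cur f0" "DF f1" "f' = cur f1"
    "DF g0" "g = cur g0" "DF g1" "g' = cur g1" by blast
  from e have "\<forall>\<^sub>F \<sigma> in filt F. f0 \<sigma> = f1 \<sigma>" "\<forall>\<^sub>F \<sigma> in filt F. g0 \<sigma> = g1 \<sigma>" "\<forall>\<^sub>F \<sigma> in filt F. f0 \<sigma> \<in> elts (g0 \<sigma>)"
    unfolding * ult_eq_curried[OF *(1,3)] ult_eq_curried[OF *(5,7)] ult_mem_curried[OF *(1,5)] .
  then have "\<forall>\<^sub>F \<sigma> in filt F. f1 \<sigma> \<in> elts (g1 \<sigma>)" by eventually_elim simp
  then show "ult_mem W f' g'" unfolding * ult_mem_curried[OF *(3,7)] .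
next
  fix f assume "f \<in> {cur f | f. DF f}"
  then obtain f0 where *: "DF f0" "f = cur f0" by blast
  show "ult_eq W f f" unfolding * ult_eq_curried[OF *(1,1)] by simp
qed

text \<open>Both ultrapowers carry the same relations, so a partial collapse for \<open>F\<close>
  transports along \<open>c\<close> to one for \<open>W\<close>, and uniqueness identifies the
  values.\<close>

theorem ult_class_curried:
  assumes f: "DF f"
  shows "ult_class (Ult UNIV U) W (cur f) = cls S F f"
proof -
  let ?M = "Ult UNIV U"
  \<comment> \<open>Indexing by set functions makes currying a definable operation on the model, to
    which replacement applies.\<close>
  define c where "c k = cur (ap k)" for k
  have [dfn]: "DT mem k \<Longrightarrow> DT mem (\<lambda>s. c (k s))" for k unfolding c_def by (rule DT_curried)
  have mem_c: "ult_mem W (c k) (c l) \<longleftrightarrow> (\<forall>\<^sub>F \<sigma> in filt F. ap k \<sigma> \<in> elts (ap l \<sigma>))"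
    and eq_c: "ult_eq W (c k) (c l) \<longleftrightarrow> (\<forall>\<^sub>F \<sigma> in filt F. ap k \<sigma> = ap l \<sigma>)" for k l
    unfolding c_def ult_mem_curried[OF DF_ap DF_ap] ult_eq_curried[OF DF_ap DF_ap] by (rule refl)+
  have c_funs: "c k \<in> ult_funs ?M W" for k unfolding ult_funs_quot c_def using DF_ap by blast
  from common_collapse[OF F f f] obtain T h where pc: "partial_collapse UNIV F (funs S T) h"
    and fT: "lam S f \<in> elts (funs S T)" by blast
  define D where "D = funs S T"
  note pcD = partial_collapseD[OF pc, folded D_def, unfolded ult_funs_uf[OF F]]
  have D_fun: "is_fun k S" if "k \<in> elts D" for k using pcD(1) that by blast
  \<comment> \<open>\<open>c\<close> forgets what happens over a \<open>U\<close>-null set, so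
    different \<open>k\<close> may have the same image; \<open>h\<close> has to respect this before
    it can be transported.\<close>
  have h_eq: "app h k = app h l" if "k \<in> elts D" "l \<in> elts D" "c k = c l" for k l
  proof -
    have "ult_eq W (c k) (c l)" using ult_congruent_quot c_funs that(3) unfolding ult_congruent_def by metis
    then have "ult_eq F k l" unfolding eq_c ult_eq_ev[OF F D_fun[OF that(1)] D_fun[OF that(2)]] .
    then show ?thesis
      using partial_collapse_agree[OF ult_congruent_uf[OF F] pc pc] that(1,2) unfolding D_def by blast
  qed
  have "elts (rep D c) = c ` elts D" by (rule elts_rep) (intro dfn)
  then have D': "elts (rep D c) = {c k | k. k \<in> elts D}" by blast
  have P: "D2 (\<lambda>G y. \<exists>k \<in> elts D. G = c k \<and> y = ap h k)" by (intro dfn)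
  have "\<exists>h'. is_fun h' (rep D c) \<and> (\<forall>G \<in> elts (rep D c). \<exists>k \<in> elts D. G = c k \<and> ap h' G = ap h k)"
  proof (rule fun_ex1[OF P])
    fix G assume "G \<in> elts (rep D c)"
    then obtain k where k: "k \<in> elts D" "G = c k" unfolding D' by blast
    show "\<exists>!y. \<exists>k \<in> elts D. G = c k \<and> y = ap h k"
    proof (rule ex1I[of _ "ap h k"])
      fix y assume "\<exists>k \<in> elts D. G = c k \<and> y = ap h k"
      then obtain l where l: "l \<in> elts D" "G = c l" "y = ap h l" by blast
      then show "y = ap h k" using h_eq[OF k(1) l(1)] k app_ap[OF pcD(2)] by simp
    qed (use k in blast)
  qed
  then obtain h' where h': "is_fun h' (rep D c)" "\<And>G. G \<in> elts (rep D c) \<Longrightarrow> \<exists>k \<in> elts D. G = c k \<and> ap h' G = ap h k"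
    by blast
  have h'_c: "app h' (c k) = app h k" if k: "k \<in> elts D" for k
  proof -
    have kD: "c k \<in> elts (rep D c)" unfolding D' using k by blast
    from h'(2)[OF this] obtain l where l: "l \<in> elts D" "c k = c l" "ap h' (c k) = ap h l" by blast
    then show ?thesis using h_eq[OF k l(1,2)] app_ap[OF h'(1) kD] app_ap[OF pcD(2)] by simp
  qed
  have m: "ult_mem W (c k) (c l) \<longleftrightarrow> ult_mem F k l" if "k \<in> elts D" "l \<in> elts D" for k l
    unfolding mem_c ult_mem_ev[OF F D_fun[OF that(1)] D_fun[OF that(2)]] ..
  have "partial_collapse ?M W (rep D c) h'"
    unfolding partial_collapse_def
  proof (intro conjI ballI impI h'(1))
    show "elts (rep D c) \<subseteq> ult_funs ?M W" unfolding D' using c_funs by blast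
    fix G K assume G: "G \<in> elts (rep D c)" and K: "K \<in> ult_funs ?M W" "ult_mem W K G"
    from G obtain k where k: "k \<in> elts D" "G = c k" unfolding D' by blast
    from K(1) obtain g where g: "DF g" "K = cur g" unfolding ult_funs_quot by blast
    have "K = c (lam S g)" unfolding g(2) c_def by (rule curried_cong[OF g(1) DF_ap]) (simp add: g(1))
    have lg: "is_fun (lam S g) S" by (rule is_fun_lam[OF g(1)])
    have "ult_mem F (lam S g) k"
      using K(2) unfolding \<open>K = c (lam S g)\<close> k(2) mem_c ult_mem_ev[OF F lg D_fun[OF k(1)]] .
    then obtain l where l: "l \<in> elts D" "ult_eq F (lam S g) l" using pcD(3)[OF k(1), of "lam S g"] lg by blast
    then have "ult_eq W K (c l)"
      unfolding \<open>K = c (lam S g)\<close> eq_c ult_eq_ev[OF F lg D_fun[OF l(1)]] by blast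
    with l(1) show "\<exists>G' \<in> elts (rep D c). ult_eq W K G'" unfolding D' by blast
  next
    fix G assume "G \<in> elts (rep D c)"
    then obtain k where k: "k \<in> elts D" "G = c k" unfolding D' by blast
    show "elts (app h' G) = {app h' K | K. K \<in> elts (rep D c) \<and> ult_mem W K G}"
    proof (intro equalityI subsetI)
      fix u assume "u \<in> elts (app h' G)"
      then have "u \<in> elts (app h k)" unfolding k(2) h'_c[OF k(1)] .
      then obtain l where l: "l \<in> elts D" "ult_mem F l k" "u = app h l" using pcD(4)[OF k(1)] by blast
      have "c l \<in> elts (rep D c)" unfolding D' using l(1) by blast
      moreover have "ult_mem W (c l) G" unfolding k(2) using m[OF l(1) k(1)] l(2) by simp
      ultimately show "u \<in> {app h' K | K. K \<in> elts (rep D c) \<and> ult_mem W K G}"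
        using h'_c[OF l(1)] l(3) by (metis (mono_tags, lifting) mem_Collect_eq)
    next
      fix u assume "u \<in> {app h' K | K. K \<in> elts (rep D c) \<and> ult_mem W K G}"
      then obtain l where l: "l \<in> elts D" "ult_mem W (c l) G" "u = app h' (c l)" unfolding D' by blast
      then have "ult_mem F l k" using m[OF l(1) k(1)] k(2) by simp
      then show "u \<in> elts (app h' G)" unfolding k(2) h'_c[OF k(1)] l(3) h'_c[OF l(1)] using pcD(4)[OF k(1)] l(1) by blast
    qed
  qed
  moreover have "cur f = c (lam S f)"
    unfolding c_def by (rule curried_cong[OF f DF_ap]) (simp add: f)
  moreover have fD: "lam S f \<in> elts D" using fT unfolding D_def .
  moreover have "c (lam S f) \<in> elts (rep D c)" unfolding D' using fD by blast
  ultimately have "ult_class ?M W (cur f) = app h' (c (lam S f))"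
    using ult_class_eq[OF ult_congruent_quot] by metis
  also have "\<dots> = app h (lam S f)" by (rule h'_c[OF fD])
  also have "\<dots> = cls S F f" unfolding cls_def using ult_class_eq[OF ult_congruent_uf[OF F] pc fT] by simp
  finally show ?thesis .
qed

theorem Ult_quot: "Ult (Ult UNIV U) W = Ult UNIV F"
proof (intro equalityI subsetI)
  fix y assume "y \<in> Ult (Ult UNIV U) W"
  then obtain G where G: "G \<in> ult_funs (Ult UNIV U) W" "y = ult_class (Ult UNIV U) W G"
    unfolding Ult_def[of "Ult UNIV U"] by blast
  then obtain f where f: "DF f" "G = cur f" unfolding ult_funs_quot by blast
  show "y \<in> Ult UNIV F" unfolding G(2) f(2) ult_class_curried[OF f(1)] Ult_uf[OF F] using f(1) by blast
next
  fix y assume "y \<in> Ult UNIV F"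
  then obtain f where f: "DF f" "y = cls S F f" unfolding Ult_uf[OF F] by blast
  show "y \<in> Ult (Ult UNIV U) W"
    unfolding f(2) ult_class_curried[OF f(1), symmetric] Ult_def[of "Ult UNIV U"] ult_funs_quot using f(1) by blast
qed

text \<open>The constant function with value \<open>cls X U g\<close> is the curried form of
  \<open>g\<close> composed with \<open>q\<close>, since \<open>q (s x) = x\<close> along a section.
  Constant \<open>g\<close> gives the composed embedding, and the identity gives the image of the
  identity class.\<close>

theorem ult_emb_quot:
  assumes g: "DF g"
  shows "ult_emb (Ult UNIV U) W (cls X U g) = cls S F (\<lambda>\<sigma>. g (q \<sigma>))"
proof -
  note [dfn] = DFI[OF g]
  have D: "DF (\<lambda>\<sigma>. g (q \<sigma>))" by (intro dfn)
  have ap: "ap (cur (\<lambda>\<sigma>. g (q \<sigma>))) y = cls X U g" if y: "y \<in> elts (code S)" for y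
  proof -
    from y obtain s where s: "DF s" "\<forall>\<^sub>F x in filt U. s x \<in> elts S \<and> q (s x) = x" "y = cls X U (\<lambda>x. r (s x))"
      by (rule quot_base_memE)
    have D': "DF (\<lambda>x. g (q (s x)))" by (intro dfn DFI[OF s(1)])
    from s(2) have "\<forall>\<^sub>F x in filt U. g (q (s x)) = g x" by eventually_elim simp
    then show ?thesis unfolding s(3) ap_curried[OF D s(1,2)] by (rule cls_cong[OF U D' g])
  qed
  have "setof {pair z (cls X U g) | z. z \<in> elts (code S)} = cur (\<lambda>\<sigma>. g (q \<sigma>))"
    by (rule setof_eq) (use ap is_fun_elts[OF is_fun_curried[OF D]] in auto)
  then show ?thesis unfolding ult_emb_def base_quot using ult_class_curried[OF D] by simp
qed

text \<open>The collapse onto \<open>Ult UNIV F\<close> turns \<open>ult_mem W\<close> into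
  membership, so Foundation on the set of collapsed values yields a minimal function.\<close>

theorem ult_wellfounded_quot: "ult_wellfounded (Ult UNIV U) W"
  unfolding ult_wellfounded_def
proof (intro allI impI, elim conjE)
  fix D assume D: "elts D \<noteq> {}" "elts D \<subseteq> ult_funs (Ult UNIV U) W"
  note [dfn] = DT_cls[OF F]
  have P: "D2 (\<lambda>G y. \<exists>k. G = cur (ap k) \<and> y = cls S F (ap k))" by (intro dfn)
  have rep: "\<exists>k. G = cur (ap k)" if "G \<in> elts D" for G
  proof -
    from that D(2) obtain f where f: "DF f" "G = cur f" unfolding ult_funs_quot by blast
    have "G = cur (ap (lam S f))" unfolding f(2) by (rule curried_cong[OF f(1) DF_ap]) (simp add: f(1))
    then show ?thesis by blast
  qed
  have "\<exists>v. is_fun v D \<and> (\<forall>G \<in> elts D. \<exists>k. G = cur (ap k) \<and> ap v G = cls S F (ap k))"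
  proof (rule fun_ex1[OF P])
    fix G assume "G \<in> elts D"
    from rep[OF this] obtain k where k: "G = cur (ap k)" by blast
    show "\<exists>!y. \<exists>k. G = cur (ap k) \<and> y = cls S F (ap k)"
    proof (rule ex1I[of _ "cls S F (ap k)"])
      fix y assume "\<exists>k. G = cur (ap k) \<and> y = cls S F (ap k)"
      then obtain l where l: "G = cur (ap l)" "y = cls S F (ap l)" by blast
      then show "y = cls S F (ap k)" using k ult_class_curried[OF DF_ap] by metis
    qed (use k in blast)
  qed
  then obtain v where v: "\<And>G. G \<in> elts D \<Longrightarrow> \<exists>k. G = cur (ap k) \<and> ap v G = cls S F (ap k)" by blast
  have V: "elts (rep D (ap v)) = ap v ` elts D" by (rule elts_rep[OF DF_ap])
  then have "elts (rep D (ap v)) \<noteq> {}" using D(1) by blast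
  from foundation[OF this] obtain G where G: "G \<in> elts D" "elts (ap v G) \<inter> elts (rep D (ap v)) = {}"
    unfolding V by blast
  have "\<not> ult_mem W K G" if K: "K \<in> elts D" for K
  proof
    assume m: "ult_mem W K G"
    from v[OF K] obtain k where k: "K = cur (ap k)" "ap v K = cls S F (ap k)" by blast
    from v[OF G(1)] obtain g where g: "G = cur (ap g)" "ap v G = cls S F (ap g)" by blast
    have "ap v K \<in> elts (ap v G)"
      using m unfolding k(2) g(2) unfolding k(1) g(1) ult_mem_curried[OF DF_ap DF_ap] mem_cls_iff[OF F DF_ap DF_ap] .
    then show False using G(2) K unfolding V by blast
  qed
  with G(1) show "\<exists>f\<in>elts D. \<forall>g\<in>elts D. \<not> ult_mem W g f" by blast
qed

end

context ZFC_model
begin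

text \<open>A sequence of representatives yields a sequence that is an element of the ultrapower.
  This is what lets the countable completeness of an external ultrafilter, which speaks only of such
  sequences, be used in the universe.\<close>

lemma cls_seq:
  assumes U: "uf X U" and g: "DF2 g"
  shows "is_fun (cls X U (\<lambda>x. lam omega (\<lambda>n. g n x))) omega"
    and "natural n \<Longrightarrow> ap (cls X U (\<lambda>x. lam omega (\<lambda>n. g n x))) n = cls X U (g n)"
proof -
  note [dfn] = DF2I[OF g]
  let ?G = "cls X U (\<lambda>x. lam omega (\<lambda>n. g n x))"
  have G: "DF (\<lambda>x. lam omega (\<lambda>n. g n x))" by (intro dfn)
  have C: "DF (\<lambda>_. n)" "DF (g n)" "DF (\<lambda>x. pair n (g n x))" "DF (\<lambda>n. g n x)" for n x by (intro dfn)+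
  have pair: "cls X U (\<lambda>x. pair n (g n x)) = pair n (cls X U (g n))" if "natural n" for n
    using cls_pair[OF U C(1,2)] cls_natural[OF U that] by simp
  have "elts ?G = {pair n (cls X U (g n)) | n. natural n}"
  proof (intro equalityI subsetI)
    fix p assume "p \<in> elts ?G"
    then obtain H where H: "DF H" "p = cls X U H" "\<forall>\<^sub>F x in filt U. H x \<in> elts (lam omega (\<lambda>n. g n x))"
      using G by (rule cls_memE[OF U])
    note [dfn] = DFI[OF H(1)]
    have P: "D2 (\<lambda>x n. H x = pair n (g n x))" and B: "DF (\<lambda>_. omega)" by (intro dfn)+
    from H(3) have ex: "\<forall>\<^sub>F x in filt U. \<exists>n \<in> elts omega. H x = pair n (g n x)"
      unfolding elts_lam[OF C(4)] by eventually_elim blast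
    from ev_choice[OF U P B ex] obtain \<nu>
      where \<nu>: "\<forall>\<^sub>F x in filt U. ap \<nu> x \<in> elts omega \<and> H x = pair (ap \<nu> x) (g (ap \<nu> x) x)" ..
    have D: "D1 (\<lambda>x. ap \<nu> x = n)" for n by (intro dfn)
    have D': "D2 (\<lambda>n x. ap \<nu> x \<noteq> n)" by (intro dfn)
    \<comment> \<open>By countable completeness a function into \<open>omega\<close> is constant
      almost everywhere.\<close>
    have "\<exists>n. natural n \<and> (\<forall>\<^sub>F x in filt U. ap \<nu> x = n)"
    proof (rule ccontr)
      assume "\<not> ?thesis"
      then have *: "\<forall>\<^sub>F x in filt U. ap \<nu> x \<noteq> n" if "natural n" for n using that unfolding ev_not[OF U D] by blast
      have "\<forall>\<^sub>F x in filt U. \<forall>n. natural n \<longrightarrow> ap \<nu> x \<noteq> n" by (rule ev_omega[OF U D']) (rule *)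
      with \<nu> have "\<forall>\<^sub>F x in filt U. False" by eventually_elim auto
      then show False using ev_False[OF U] by contradiction
    qed
    then obtain n where n: "natural n" "\<forall>\<^sub>F x in filt U. ap \<nu> x = n" by blast
    from \<nu> n(2) have "\<forall>\<^sub>F x in filt U. H x = pair n (g n x)" by eventually_elim simp
    then have "p = pair n (cls X U (g n))"
      unfolding H(2) pair[OF n(1), symmetric] by (rule cls_cong[OF U H(1) C(3)])
    with n(1) show "p \<in> {pair n (cls X U (g n)) | n. natural n}" by blast
  next
    fix p assume "p \<in> {pair n (cls X U (g n)) | n. natural n}"
    then obtain n where n: "natural n" "p = cls X U (\<lambda>x. pair n (g n x))" using pair by auto
    show "p \<in> elts ?G" unfolding n(2) mem_cls_iff[OF U G C(3)]
      by (rule always_eventually) (use n(1) in \<open>simp add: elts_lam[OF C(4)]\<close>)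
  qed
  then show "is_fun ?G omega" unfolding is_fun_def by auto
  from ap_pair[OF this, of n "cls X U (g n)"] show "ap ?G n = cls X U (g n)" if "natural n"
    using that \<open>elts ?G = _\<close> by auto
qed

section \<open>Every external ultrafilter comes from the universe\<close>

lemma Sec_Sig:
  assumes Y: "DF Y" and P: "D1 P" and x: "x \<in> elts X"
  shows "Sec pfst psnd (sep (Sig X Y) P) x = sep (Y x) (\<lambda>y. P (pair x y))"
proof (rule extensionality)
  note [dfn] = D1I[OF P]
  have D: "D1 (\<lambda>\<sigma>. pfst \<sigma> = x)" "D1 (\<lambda>y. P (pair x y))" "DF psnd" by (intro dfn)+
  have S: "elts (Sec pfst psnd A x) = {psnd \<sigma> | \<sigma>. \<sigma> \<in> elts A \<and> pfst \<sigma> = x}" for A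
    unfolding Sec_def elts_rep[OF D(3)] elts_sep[OF D(1)] by auto
  show "elts (Sec pfst psnd (sep (Sig X Y) P) x) = elts (sep (Y x) (\<lambda>y. P (pair x y)))"
    unfolding S elts_sep[OF D(2)] elts_sep[OF P] elts_Sig[OF Y]
  proof (intro equalityI subsetI)
    fix y assume "y \<in> {y \<in> elts (Y x). P (pair x y)}"
    then have "y = psnd (pair x y) \<and> pair x y \<in> {\<sigma> \<in> {pair x y |x y. x \<in> elts X \<and> y \<in> elts (Y x)}. P \<sigma>} \<and> pfst (pair x y) = x"
      using x by simp
    then show "y \<in> {psnd \<sigma> | \<sigma>. \<sigma> \<in> {\<sigma> \<in> {pair x y |x y. x \<in> elts X \<and> y \<in> elts (Y x)}. P \<sigma>} \<and> pfst \<sigma> = x}"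
      by blast
  qed auto
qed

lemma Sec_Sig_top:
  assumes "DF Y" "x \<in> elts X" shows "Sec pfst psnd (Sig X Y) x = Y x"
proof -
  have D: "D1 (\<lambda>_. True)" by (intro dfn)
  have "sep A (\<lambda>_. True) = A" for A by (rule extensionality) (simp add: elts_sep[OF D])
  with Sec_Sig[OF assms(1) D assms(2)] show ?thesis by simp
qed

lemma sectioned_Sig:
  assumes "uf X U" "DF Y"
  shows "sectioned mem X U (Sig X Y) pfst psnd"
proof unfold_locales
  show "uf X U" by fact
  show "DF pfst" "DF psnd" by (intro dfn)+
  show "\<sigma> \<in> elts (Sig X Y) \<Longrightarrow> pfst \<sigma> \<in> elts X" for \<sigma> by (auto simp: elts_Sig[OF assms(2)])
  show "\<sigma> \<in> elts (Sig X Y) \<Longrightarrow> \<tau> \<in> elts (Sig X Y) \<Longrightarrow> pfst \<sigma> = pfst \<tau> \<Longrightarrow> psnd \<sigma> = psnd \<tau> \<Longrightarrow> \<sigma> = \<tau>" for \<sigma> \<tau>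
    by (auto simp: elts_Sig[OF assms(2)])
qed

lemma cc_ultrafilterD:
  assumes "cc_ultrafilter M X W"
  shows "X \<in> M" and "X \<in> elts W" and "emp \<notin> elts W"
    and "A \<in> elts W \<Longrightarrow> A \<in> M" and "A \<in> elts W \<Longrightarrow> elts A \<subseteq> elts X"
    and "A \<in> elts W \<Longrightarrow> B \<in> M \<Longrightarrow> elts A \<subseteq> elts B \<Longrightarrow> elts B \<subseteq> elts X \<Longrightarrow> B \<in> elts W"
    and "A \<in> elts W \<Longrightarrow> B \<in> elts W \<Longrightarrow> setof (elts A \<inter> elts B) \<in> elts W"
    and "A \<in> M \<Longrightarrow> elts A \<subseteq> elts X \<Longrightarrow> A \<in> elts W \<or> setof (elts X - elts A) \<in> elts W"
    and "f \<in> M \<Longrightarrow> is_fun f omega \<Longrightarrow> \<forall>n \<in> elts omega. app f n \<in> elts W \<Longrightarrow>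
      setof {x \<in> elts X. \<forall>n \<in> elts omega. x \<in> elts (app f n)} \<in> elts W"
proof -
  from assms have 1: "X \<in> M" "X \<in> elts W" "setof {} \<notin> elts W"
    and 2: "\<forall>A \<in> elts W. A \<in> M \<and> elts A \<subseteq> elts X"
    and 3: "\<forall>A \<in> elts W. \<forall>B \<in> M. elts A \<subseteq> elts B \<and> elts B \<subseteq> elts X \<longrightarrow> B \<in> elts W"
    and 4: "\<forall>A \<in> elts W. \<forall>B \<in> elts W. setof (elts A \<inter> elts B) \<in> elts W"
    and 5: "\<forall>A \<in> M. elts A \<subseteq> elts X \<longrightarrow> A \<in> elts W \<or> setof (elts X - elts A) \<in> elts W"
    and 6: "\<forall>f \<in> M. is_fun f omega \<and> (\<forall>n \<in> elts omega. app f n \<in> elts W) \<longrightarrow>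
        setof {x \<in> elts X. \<forall>n \<in> elts omega. x \<in> elts (app f n)} \<in> elts W"
    unfolding cc_ultrafilter_def by - (elim conjE, assumption)+
  show "X \<in> M" "X \<in> elts W" "emp \<notin> elts W" using 1 by simp_all
  show "A \<in> elts W \<Longrightarrow> A \<in> M" "A \<in> elts W \<Longrightarrow> elts A \<subseteq> elts X" using 2 by blast+
  show "A \<in> elts W \<Longrightarrow> B \<in> M \<Longrightarrow> elts A \<subseteq> elts B \<Longrightarrow> elts B \<subseteq> elts X \<Longrightarrow> B \<in> elts W" using 3 by blast
  show "A \<in> elts W \<Longrightarrow> B \<in> elts W \<Longrightarrow> setof (elts A \<inter> elts B) \<in> elts W" using 4 by blast
  show "A \<in> M \<Longrightarrow> elts A \<subseteq> elts X \<Longrightarrow> A \<in> elts W \<or> setof (elts X - elts A) \<in> elts W" using 5 by blast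
  show "f \<in> M \<Longrightarrow> is_fun f omega \<Longrightarrow> \<forall>n \<in> elts omega. app f n \<in> elts W \<Longrightarrow>
      setof {x \<in> elts X. \<forall>n \<in> elts omega. x \<in> elts (app f n)} \<in> elts W" using 6 by blast
qed

text \<open>The total space is the sum of the sets \<open>Y x\<close> that represent the base, and
  \<open>F\<close> consists of the subsets of it whose code lies in \<open>W\<close>. Since all
  subsets of the base in the ultrapower are codes, \<open>F\<close> determines
  \<open>W\<close>.\<close>

theorem cc_ultrafilter_factored:
  assumes U: "uf X U" and W: "cc_ultrafilter (Ult UNIV U) X' W"
  shows "\<exists>Y F. DF Y \<and> X' = cls X U Y \<and> factored mem X U (Sig X Y) pfst psnd F \<and> W = quot X U pfst psnd F"
proof -
  let ?M = "Ult UNIV U"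
  note X' = cc_ultrafilterD(1,2)[OF W] and W0 = cc_ultrafilterD(3)[OF W]
    and WM = cc_ultrafilterD(4,5)[OF W] and Wsup = cc_ultrafilterD(6)[OF W]
    and Wint = cc_ultrafilterD(7)[OF W] and Wult = cc_ultrafilterD(8)[OF W] and Wcc = cc_ultrafilterD(9)[OF W]
  from X'(1) obtain Y where Y: "DF Y" "X' = cls X U Y" unfolding Ult_uf[OF U] by blast
  note [dfn] = DFI[OF Y(1)]
  define S where "S = Sig X Y"
  interpret s: sectioned mem X U S pfst psnd unfolding S_def by (rule sectioned_Sig[OF U Y(1)])
  have XS: "X' = cls X U (Sec pfst psnd S)"
    unfolding Y(2) S_def
  proof (rule cls_cong[OF U Y(1) s.DF_Sec])
    from ev_base[OF U] show "\<forall>\<^sub>F x in filt U. Y x = Sec pfst psnd (Sig X Y) x"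
      by eventually_elim (simp add: Sec_Sig_top[OF Y(1)])
  qed
  define F where "F = sep (pow S) (\<lambda>A. cls X U (Sec pfst psnd A) \<in> elts W)"
  have "D1 (\<lambda>A. cls X U (Sec pfst psnd A) \<in> elts W)" by (intro dfn)
  from elts_sep[OF this] have F: "elts F = {A. elts A \<subseteq> elts S \<and> cls X U (Sec pfst psnd A) \<in> elts W}"
    unfolding F_def by auto
  have Sec_M: "cls X U (Sec pfst psnd A) \<in> ?M" for A by (rule s.cls_in_Ult[OF s.DF_Sec])
  have "uf S F"
    unfolding uf_def
  proof (intro conjI ballI allI impI)
    fix A assume A: "elts A \<subseteq> elts S"
    have dS: "elts (dif S A) \<subseteq> elts S" by auto
    have "cls X U (Sec pfst psnd A) \<in> elts W \<or> cls X U (Sec pfst psnd (dif S A)) \<in> elts W"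
      using Wult[OF Sec_M, of A] s.Sec_mono[OF A] unfolding XS s.cls_Sec_dif[OF A] by blast
    moreover have "\<not> (cls X U (Sec pfst psnd A) \<in> elts W \<and> cls X U (Sec pfst psnd (dif S A)) \<in> elts W)"
    proof
      assume *: "cls X U (Sec pfst psnd A) \<in> elts W \<and> cls X U (Sec pfst psnd (dif S A)) \<in> elts W"
      from Wint[OF conjunct1[OF *] conjunct2[OF *]]
      have "cls X U (Sec pfst psnd (setof (elts A \<inter> elts (dif S A)))) \<in> elts W" unfolding s.cls_Sec_Int[OF A dS] .
      moreover have "setof (elts A \<inter> elts (dif S A)) = emp" by (rule setof_eq) auto
      moreover have "Sec pfst psnd emp = (\<lambda>_. emp)" by (rule ext, rule extensionality) (simp add: s.elts_Sec)
      ultimately show False using W0 cls_emp[OF U] by simp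
    qed
    ultimately show "A \<in> elts F \<longleftrightarrow> dif S A \<notin> elts F" unfolding F using A dS by blast
  next
    fix f B assume *: "(\<forall>n\<in>elts omega. ap f n \<in> elts F) \<and> elts B \<subseteq> elts S \<and>
      (\<forall>x\<in>elts S. (\<forall>n\<in>elts omega. x \<in> elts (ap f n)) \<longrightarrow> x \<in> elts B)"
    have B: "elts B \<subseteq> elts S" using * by blast
    have f: "elts (ap f n) \<subseteq> elts S" "cls X U (Sec pfst psnd (ap f n)) \<in> elts W" if "natural n" for n
      using * that unfolding F by auto
    have g: "DF2 (\<lambda>n x. Sec pfst psnd (ap f n) x)" by (intro dfn)
    \<comment> \<open>The sequence of codes must be exhibited as an element of the ultrapower before
      the completeness of \<open>W\<close> can be invoked.\<close>
    let ?G = "cls X U (\<lambda>x. lam omega (\<lambda>n. Sec pfst psnd (ap f n) x))"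
    have "DF (\<lambda>x. lam omega (\<lambda>n. Sec pfst psnd (ap f n) x))" by (intro dfn)
    then have G: "?G \<in> ?M" by (rule s.cls_in_Ult)
    have G_fun: "is_fun ?G omega" by (rule cls_seq(1)[OF U g])
    have app: "app ?G n = cls X U (Sec pfst psnd (ap f n))" if "natural n" for n
      using cls_seq(2)[OF U g that] app_ap[OF G_fun] that by simp
    have D: "D1 (\<lambda>\<sigma>. \<forall>n. natural n \<longrightarrow> \<sigma> \<in> elts (ap f n))" by (intro dfn)
    let ?C = "sep S (\<lambda>\<sigma>. \<forall>n. natural n \<longrightarrow> \<sigma> \<in> elts (ap f n))"
    have C: "elts ?C \<subseteq> elts B" "elts ?C \<subseteq> elts S" using * unfolding elts_sep[OF D] by auto
    have "setof {x \<in> elts X'. \<forall>n \<in> elts omega. x \<in> elts (app ?G n)} = cls X U (Sec pfst psnd ?C)"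
      unfolding XS
    proof (rule s.setof_sections[OF C(2)])
      fix t assume t: "DF t" "\<forall>\<^sub>F x in filt U. t x \<in> elts S \<and> pfst (t x) = x"
      note [dfn] = DFI[OF t(1)]
      have P: "D2 (\<lambda>n x. t x \<in> elts (ap f n))" by (intro dfn)
      have "(\<forall>n \<in> elts omega. cls X U (\<lambda>x. psnd (t x)) \<in> elts (app ?G n)) \<longleftrightarrow>
          (\<forall>n. natural n \<longrightarrow> (\<forall>\<^sub>F x in filt U. t x \<in> elts (ap f n)))"
        using app s.section_mem_iff[OF t f(1)] by simp
      also have "\<dots> \<longleftrightarrow> (\<forall>\<^sub>F x in filt U. \<forall>n. natural n \<longrightarrow> t x \<in> elts (ap f n))"
        by (rule ev_omega_iff[OF U P])
      also have "\<dots> \<longleftrightarrow> (\<forall>\<^sub>F x in filt U. t x \<in> elts ?C)"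
        by (rule eventually_cong[OF t(2)]) (simp add: elts_sep[OF D])
      finally show "(\<forall>n \<in> elts omega. cls X U (\<lambda>x. psnd (t x)) \<in> elts (app ?G n)) \<longleftrightarrow> (\<forall>\<^sub>F x in filt U. t x \<in> elts ?C)" .
    qed
    with Wcc[OF G G_fun] app f(2) have "cls X U (Sec pfst psnd ?C) \<in> elts W" by simp
    from Wsup[OF this Sec_M s.Sec_mono[OF C(1)]] have "cls X U (Sec pfst psnd B) \<in> elts W"
      unfolding XS using s.Sec_mono[OF B] by blast
    then show "B \<in> elts F" unfolding F using B by blast
  qed (use F in blast)
  moreover have "\<forall>\<^sub>F \<sigma> in filt F. pfst \<sigma> \<in> elts A" if A: "A \<in> elts U" for A
  proof -
    have D: "D1 (\<lambda>\<sigma>. pfst \<sigma> \<in> elts A)" by (intro dfn)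
    \<comment> \<open>Over a point of \<open>A\<close> the restriction removes nothing from the
      fibre, so the restricted set has the code of the whole space, which lies in
      \<open>W\<close>.\<close>
    have "\<forall>\<^sub>F x in filt U. Sec pfst psnd S x = Sec pfst psnd (sep S (\<lambda>\<sigma>. pfst \<sigma> \<in> elts A)) x"
      using ev_mem[OF U A]
    proof eventually_elim
      case (elim x)
      show ?case by (rule extensionality) (use elim in \<open>auto simp: s.elts_Sec elts_sep[OF D]\<close>)
    qed
    from cls_cong[OF U s.DF_Sec s.DF_Sec this] X'(2)
    have "cls X U (Sec pfst psnd (sep S (\<lambda>\<sigma>. pfst \<sigma> \<in> elts A))) \<in> elts W" unfolding XS by simp
    then have "sep S (\<lambda>\<sigma>. pfst \<sigma> \<in> elts A) \<in> elts F" unfolding F by (auto simp: elts_sep[OF D])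
    then show ?thesis using ev_iff[OF \<open>uf S F\<close> D] by simp
  qed
  ultimately interpret f: factored mem X U S pfst psnd F by unfold_locales
  have "W = quot X U pfst psnd F"
  proof (rule extensionality, intro equalityI subsetI)
    fix A assume A: "A \<in> elts W"
    then have "A \<in> ?M" "elts A \<subseteq> elts (cls X U (Sec pfst psnd S))" using WM[of A] unfolding XS by simp_all
    then obtain A0 where "elts A0 \<subseteq> elts S" "A = cls X U (Sec pfst psnd A0)" by (rule s.subset_of_quot_base)
    with A show "A \<in> elts (quot X U pfst psnd F)" unfolding s.elts_quot F by blast
  next
    fix A assume "A \<in> elts (quot X U pfst psnd F)"
    then show "A \<in> elts W" unfolding s.elts_quot F by blast
  qed
  with Y f.factored_axioms[unfolded S_def] show ?thesis by blast
qed

section \<open>Limits of ultrafilters\<close>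

lemma uf_of_cc:
  assumes W: "cc_ultrafilter UNIV X W" shows "uf X W"
proof -
  note sub = cc_ultrafilterD(5)[OF W] and W0 = cc_ultrafilterD(3)[OF W]
    and Wsup = cc_ultrafilterD(6)[OF W _ UNIV_I]
    and Wint = cc_ultrafilterD(7)[OF W] and Wult = cc_ultrafilterD(8)[OF W UNIV_I, unfolded setof_Diff_dif]
    and Wcc = cc_ultrafilterD(9)[OF W UNIV_I]
  show ?thesis unfolding uf_def
  proof (intro conjI ballI allI impI)
    fix A assume A: "elts A \<subseteq> elts X"
    have "\<not> (A \<in> elts W \<and> dif X A \<in> elts W)"
    proof
      assume *: "A \<in> elts W \<and> dif X A \<in> elts W"
      have "setof (elts A \<inter> elts (dif X A)) = emp" by (rule setof_eq) auto
      then show False using Wint[of A "dif X A"] * W0 by simp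
    qed
    with Wult[OF A] show "A \<in> elts W \<longleftrightarrow> dif X A \<notin> elts W" by blast
  next
    fix f B assume *: "(\<forall>n\<in>elts omega. ap f n \<in> elts W) \<and> elts B \<subseteq> elts X \<and>
      (\<forall>x\<in>elts X. (\<forall>n\<in>elts omega. x \<in> elts (ap f n)) \<longrightarrow> x \<in> elts B)"
    let ?f = "lam omega (ap f)"
    have f: "is_fun ?f omega" by (rule is_fun_lam[OF DF_ap])
    have app: "app ?f n = ap f n" if "n \<in> elts omega" for n
      using app_ap[OF f that] ap_lam[OF DF_ap that] by simp
    have D: "D1 (\<lambda>x. \<forall>n. natural n \<longrightarrow> x \<in> elts (ap f n))" by (intro dfn)
    have "setof {x \<in> elts X. \<forall>n \<in> elts omega. x \<in> elts (app ?f n)} \<in> elts W"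
      by (rule Wcc[OF f]) (use * app in simp)
    then have "sep X (\<lambda>x. \<forall>n. natural n \<longrightarrow> x \<in> elts (ap f n)) \<in> elts W"
      unfolding sep_def using app by simp
    then show "B \<in> elts W" by (rule Wsup) (use * in \<open>auto simp: elts_sep[OF D]\<close>)
  qed (use sub in blast)
qed

lemma uf_principal:
  assumes "y \<in> elts Y" shows "uf Y (sep (pow Y) (\<lambda>A. y \<in> elts A))"
proof -
  have D: "D1 (\<lambda>A. y \<in> elts A)" by (intro dfn)
  show ?thesis unfolding uf_def elts_sep[OF D] using assms by auto
qed

definition limit :: "'a \<Rightarrow> 'a \<Rightarrow> 'a \<Rightarrow> ('a \<Rightarrow> 'a) \<Rightarrow> 'a" where
  "limit X V Y w = sep (pow Y) (\<lambda>A. sep X (\<lambda>x. A \<in> elts (w x)) \<in> elts V)"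

lemma elts_limit:
  assumes V: "uf X V" and w: "DF w"
  shows "elts (limit X V Y w) = {A. elts A \<subseteq> elts Y \<and> (\<forall>\<^sub>F x in filt V. A \<in> elts (w x))}"
proof -
  note [dfn] = DFI[OF w]
  have D: "D1 (\<lambda>x. A \<in> elts (w x))" "D1 (\<lambda>A. sep X (\<lambda>x. A \<in> elts (w x)) \<in> elts V)" for A by (intro dfn)+
  show ?thesis unfolding limit_def elts_sep[OF D(2)] ev_iff[OF V D(1)] by simp
qed

text \<open>All clauses transfer pointwise. For countable intersections the completeness of
  \<open>V\<close> first puts all the sets into \<open>w x\<close> simultaneously, and then that of
  \<open>w x\<close> applies.\<close>

lemma uf_limit:
  assumes V: "uf X V" and w: "DF w" and uf: "\<And>x. x \<in> elts X \<Longrightarrow> uf Y (w x)"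
  shows "uf Y (limit X V Y w)"
  unfolding uf_def elts_limit[OF V w]
proof (intro conjI ballI allI impI)
  note [dfn] = DFI[OF w]
  fix A assume A: "elts A \<subseteq> elts Y"
  have D: "D1 (\<lambda>x. A \<in> elts (w x))" by (intro dfn)
  have "(\<forall>\<^sub>F x in filt V. dif Y A \<in> elts (w x)) \<longleftrightarrow> (\<forall>\<^sub>F x in filt V. A \<notin> elts (w x))"
    by (rule eventually_cong[OF ev_base[OF V]]) (rule uf_dif[OF uf A])
  then show "A \<in> {A. elts A \<subseteq> elts Y \<and> (\<forall>\<^sub>F x in filt V. A \<in> elts (w x))} \<longleftrightarrow>
    dif Y A \<notin> {A. elts A \<subseteq> elts Y \<and> (\<forall>\<^sub>F x in filt V. A \<in> elts (w x))}"
    using A unfolding ev_not[OF V D] by auto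
next
  note [dfn] = DFI[OF w]
  fix f B assume *: "(\<forall>n\<in>elts omega. ap f n \<in> {A. elts A \<subseteq> elts Y \<and> (\<forall>\<^sub>F x in filt V. A \<in> elts (w x))}) \<and>
    elts B \<subseteq> elts Y \<and> (\<forall>x\<in>elts Y. (\<forall>n\<in>elts omega. x \<in> elts (ap f n)) \<longrightarrow> x \<in> elts B)"
  have P: "D2 (\<lambda>n x. ap f n \<in> elts (w x))" by (intro dfn)
  have "\<forall>\<^sub>F x in filt V. \<forall>n. natural n \<longrightarrow> ap f n \<in> elts (w x)"
    by (rule ev_omega[OF V P]) (use * in simp)
  with ev_base[OF V] have "\<forall>\<^sub>F x in filt V. B \<in> elts (w x)"
  proof eventually_elim
    case (elim x)
    show ?case by (rule uf_cc[OF uf[OF elim(1)] DF_ap[of f]]) (use elim(2) * in auto)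
  qed
  with * show "B \<in> {A. elts A \<subseteq> elts Y \<and> (\<forall>\<^sub>F x in filt V. A \<in> elts (w x))}" by simp
qed auto

definition push :: "'a \<Rightarrow> 'a \<Rightarrow> 'a \<Rightarrow> ('a \<Rightarrow> 'a) \<Rightarrow> 'a" where
  "push X V Y g = sep (pow Y) (\<lambda>A. sep X (\<lambda>x. g x \<in> elts A) \<in> elts V)"

lemma elts_push:
  assumes g: "DF g"
  shows "elts (push X V Y g) = {A. elts A \<subseteq> elts Y \<and> sep X (\<lambda>x. g x \<in> elts A) \<in> elts V}"
proof -
  note [dfn] = DFI[OF g]
  have D: "D1 (\<lambda>A. sep X (\<lambda>x. g x \<in> elts A) \<in> elts V)" by (intro dfn)
  show ?thesis unfolding push_def elts_sep[OF D] by simp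
qed

text \<open>An image ultrafilter is the limit of the principal ultrafilters at the points
  \<open>g x\<close>.\<close>

lemma uf_push:
  assumes V: "uf X V" and g: "DF g" "\<And>x. x \<in> elts X \<Longrightarrow> g x \<in> elts Y"
  shows "uf Y (push X V Y g)"
proof -
  note [dfn] = DFI[OF g(1)]
  have w: "DF (\<lambda>x. sep (pow Y) (\<lambda>A. g x \<in> elts A))" by (intro dfn)
  have D: "D1 (\<lambda>A. g x \<in> elts A)" "D1 (\<lambda>x. g x \<in> elts A)" for x A by (intro dfn)+
  have "push X V Y g = limit X V Y (\<lambda>x. sep (pow Y) (\<lambda>A. g x \<in> elts A))"
    by (rule extensionality) (auto simp: elts_push[OF g(1)] elts_limit[OF V w] elts_sep[OF D(1)] ev_iff[OF V D(2)] elim: eventually_mono)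
  moreover have "uf Y \<dots>" by (rule uf_limit[OF V w uf_principal]) (rule g(2))
  ultimately show ?thesis by simp
qed

section \<open>The order on finite sets of ordinals\<close>

lemma ordinal_mem: "ordinal \<beta> \<Longrightarrow> \<alpha> \<in> elts \<beta> \<Longrightarrow> ordinal \<alpha>"
  unfolding ordinal_def transitive_def by blast

lemma ordinal_trans: "ordinal \<gamma> \<Longrightarrow> \<alpha> \<in> elts \<beta> \<Longrightarrow> \<beta> \<in> elts \<gamma> \<Longrightarrow> \<alpha> \<in> elts \<gamma>"
  unfolding ordinal_def transitive_def by blast

lemma ordinal_suc: "ordinal \<alpha> \<Longrightarrow> ordinal (suc \<alpha>)"
  unfolding ordinal_def transitive_def by auto

text \<open>Take \<open>a\<close> minimal among ordinals incomparable with something, then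
  \<open>b\<close> minimal among those incomparable with \<open>a\<close>. Minimality makes them
  have the same elements. The search runs through successors so that \<alpha> and \<beta> themselves
  are candidates.\<close>

lemma ordinal_trichotomy:
  assumes "ordinal \<alpha>" "ordinal \<beta>"
  shows "\<alpha> \<in> elts \<beta> \<or> \<alpha> = \<beta> \<or> \<beta> \<in> elts \<alpha>"
proof (rule ccontr)
  assume inc: "\<not> ?thesis"
  define I where "I x y \<longleftrightarrow> x \<notin> elts y \<and> x \<noteq> y \<and> y \<notin> elts x" for x y
  have I: "D2 I" unfolding I_def by (intro dfn)
  note [dfn] = D2I[OF I]
  have D: "D1 (\<lambda>x. \<exists>y \<in> elts (suc \<beta>). I x y)" by (intro dfn)
  let ?A = "sep (suc \<alpha>) (\<lambda>x. \<exists>y \<in> elts (suc \<beta>). I x y)"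
  have "\<alpha> \<in> elts ?A" unfolding elts_sep[OF D] using inc by (simp add: I_def)
  then have "elts ?A \<noteq> {}" by blast
  from foundation[OF this] obtain a where a: "a \<in> elts ?A" "elts a \<inter> elts ?A = {}" by blast
  have D': "D1 (\<lambda>y. I a y)" by (intro dfn)
  let ?B = "sep (suc \<beta>) (\<lambda>y. I a y)"
  have "elts ?B \<noteq> {}" using a(1) unfolding elts_sep[OF D] elts_sep[OF D'] by blast
  from foundation[OF this] obtain b where b: "b \<in> elts ?B" "elts b \<inter> elts ?B = {}" by blast
  have a': "a \<in> elts (suc \<alpha>)" and b': "b \<in> elts (suc \<beta>)" and ab: "I a b"
    using a(1) b(1) unfolding elts_sep[OF D] elts_sep[OF D'] by blast+
  note ord = ordinal_suc[OF assms(1)] ordinal_suc[OF assms(2)]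
  have oa: "ordinal a" "ordinal b" using ordinal_mem[OF ord(1) a'] ordinal_mem[OF ord(2) b'] .
  have "a = b"
  proof (rule vext)
    fix u
    show "u \<in> elts a \<longleftrightarrow> u \<in> elts b"
    proof
      assume u: "u \<in> elts a"
      have "u \<in> elts (suc \<alpha>)" using ordinal_trans[OF ord(1) u a'] .
      then have "\<not> I u b" using a(2) u b' unfolding elts_sep[OF D] by blast
      then show "u \<in> elts b" using ab u ordinal_trans[OF oa(1), of b u] unfolding I_def by blast
    next
      assume u: "u \<in> elts b"
      have "u \<in> elts (suc \<beta>)" using ordinal_trans[OF ord(2) u b'] .
      then have "\<not> I a u" using b(2) u unfolding elts_sep[OF D'] by blast
      then show "u \<in> elts a" using ab u ordinal_trans[OF oa(2), of a u] unfolding I_def by blast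
    qed
  qed
  then show False using ab unfolding I_def by blast
qed

text \<open>The symmetric difference of \<open>a\<close> and \<open>c\<close> lies in the union of
  the other two, and the larger of the tops \<open>k\<close> and \<open>m\<close> belongs to exactly
  one of them, hence is its top.\<close>

lemma fin_le_trans:
  assumes ord: "\<And>\<alpha>. \<alpha> \<in> elts a \<union> elts b \<union> elts c \<Longrightarrow> ordinal \<alpha>"
    and ab: "fin_le a b" and bc: "fin_le b c"
  shows "fin_le a c"
proof (cases "a = b \<or> b = c")
  case False
  then have "fin_less a b" "fin_less b c" using ab bc unfolding fin_le_def by blast+
  then obtain k m where k: "k \<in> elts b" "k \<notin> elts a"
      "\<And>z. z \<in> (elts a - elts b) \<union> (elts b - elts a) \<Longrightarrow> z = k \<or> z \<in> elts k"
    and m: "m \<in> elts c" "m \<notin> elts b"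
      "\<And>z. z \<in> (elts b - elts c) \<union> (elts c - elts b) \<Longrightarrow> z = m \<or> z \<in> elts m"
    unfolding fin_less_def elts_def by blast
  have ok: "ordinal k" "ordinal m" using ord k m by blast+
  from k(1) m(2) have "k \<noteq> m" by blast
  with ordinal_trichotomy[OF ok] consider "k \<in> elts m" | "m \<in> elts k" by blast
  then have "fin_less a c"
  proof cases
    case 1
    have "m \<notin> elts a" using k(3)[of m] m(2) \<open>k \<noteq> m\<close> mem_asym[OF 1] by blast
    moreover have "z = m \<or> z \<in> elts m" if "z \<in> (elts a - elts c) \<union> (elts c - elts a)" for z
    proof -
      from that have "z \<in> (elts a - elts b) \<union> (elts b - elts a) \<or> z \<in> (elts b - elts c) \<union> (elts c - elts b)" by blast
      then show ?thesis using k(3)[of z] m(3)[of z] 1 ordinal_trans[OF ok(2), of z k] by blast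
    qed
    ultimately show ?thesis unfolding fin_less_def using m(1) unfolding elts_def by blast
  next
    case 2
    have "k \<in> elts c" using m(3)[of k] k(1) \<open>k \<noteq> m\<close> mem_asym[OF 2] by blast
    moreover have "z = k \<or> z \<in> elts k" if "z \<in> (elts a - elts c) \<union> (elts c - elts a)" for z
    proof -
      from that have "z \<in> (elts a - elts b) \<union> (elts b - elts a) \<or> z \<in> (elts b - elts c) \<union> (elts c - elts b)" by blast
      then show ?thesis using k(3)[of z] m(3)[of z] 2 ordinal_trans[OF ok(1), of z m] by blast
    qed
    ultimately show ?thesis unfolding fin_less_def using k(2) unfolding elts_def by blast
  qed
  then show ?thesis unfolding fin_le_def by blast
qed (use ab bc in auto)

text \<open>Provides a base set and the fact that its members consist of ordinals, which
  transitivity of the order on finite sets relies on.\<close>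

lemma uniform_ultrafilter_uf:
  assumes "uniform_ultrafilter U"
  shows "\<exists>X. uf X U \<and> (\<forall>x \<in> elts X. \<forall>\<alpha> \<in> elts x. ordinal \<alpha>)"
proof -
  from assms obtain \<kappa> n where \<kappa>: "ordinal \<kappa>" "cc_ultrafilter UNIV (subsets_of_size \<kappa> n) U"
    unfolding uniform_ultrafilter_def by blast
  \<comment> \<open>\<open>bij_betw\<close> belongs to the ambient logic. Spelled out with
    \<open>ap\<close> it becomes definable, so that the comprehension in
    \<open>subsets_of_size\<close> denotes a set.\<close>
  have eq: "is_fun f n \<and> bij_betw (app f) (elts n) (elts a) \<longleftrightarrow> is_fun f n \<and>
    (\<forall>u \<in> elts n. \<forall>v \<in> elts n. ap f u = ap f v \<longrightarrow> u = v) \<and> (\<forall>y. y \<in> elts a \<longleftrightarrow> (\<exists>u \<in> elts n. y = ap f u))" for f a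
  proof (cases "is_fun f n")
    case True
    then have "bij_betw (app f) (elts n) (elts a) \<longleftrightarrow> bij_betw (ap f) (elts n) (elts a)"
      by (intro bij_betw_cong) (rule app_ap)
    then show ?thesis using True by (auto simp: bij_betw_def inj_on_def)
  qed simp
  have "D1 (\<lambda>a. \<exists>f. is_fun f n \<and> (\<forall>u \<in> elts n. \<forall>v \<in> elts n. ap f u = ap f v \<longrightarrow> u = v) \<and>
    (\<forall>y. y \<in> elts a \<longleftrightarrow> (\<exists>u \<in> elts n. y = ap f u)))" by (intro dfn)
  from separation_D1[OF this, of "pow \<kappa>"]
  have "\<exists>z. elts z = {a. elts a \<subseteq> elts \<kappa> \<and> (\<exists>f. is_fun f n \<and> bij_betw (app f) (elts n) (elts a))}"
    unfolding eq by simp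
  from elts_setofI[OF this]
  have "elts (subsets_of_size \<kappa> n) \<subseteq> {a. elts a \<subseteq> elts \<kappa>}" unfolding subsets_of_size_def by blast
  then have "\<forall>x \<in> elts (subsets_of_size \<kappa> n). \<forall>\<alpha> \<in> elts x. ordinal \<alpha>"
    using ordinal_mem[OF \<kappa>(1)] by blast
  with uf_of_cc[OF \<kappa>(2)] show ?thesis by blast
qed

end

section \<open>The E-order as a Ketonen order\<close>

context ZFC_model
begin

text \<open>The non-strict Ketonen order. \<open>ap w x\<close> is an ultrafilter at every point and
  not just almost everywhere, which keeps limits of \<open>w\<close> along ultrafilters on
  \<open>X1\<close> well behaved.\<close>

definition ketonen :: "'a \<Rightarrow> 'a \<Rightarrow> 'a \<Rightarrow> 'a \<Rightarrow> bool" where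
  "ketonen X0 U0 X1 U1 \<longleftrightarrow> (\<exists>w.
     (\<forall>x \<in> elts X1. uf X0 (ap w x)) \<and>
     (\<forall>A. elts A \<subseteq> elts X0 \<longrightarrow> (A \<in> elts U0 \<longleftrightarrow> (\<forall>\<^sub>F x in filt U1. A \<in> elts (ap w x)))) \<and>
     (\<forall>\<^sub>F x in filt U1. sep X0 (\<lambda>z. fin_le z x) \<in> elts (ap w x)))"

lemma ketonen_trans:
  assumes U0: "uf X0 U0" and U1: "uf X1 U1" and U2: "uf X2 U2"
    and ord: "\<And>x \<alpha>. x \<in> elts X0 \<union> elts X1 \<union> elts X2 \<Longrightarrow> \<alpha> \<in> elts x \<Longrightarrow> ordinal \<alpha>"
    and K01: "ketonen X0 U0 X1 U1" and K12: "ketonen X1 U1 X2 U2"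
  shows "ketonen X0 U0 X2 U2"
proof -
  obtain w where w: "\<And>y. y \<in> elts X1 \<Longrightarrow> uf X0 (ap w y)"
    "\<And>A. elts A \<subseteq> elts X0 \<Longrightarrow> A \<in> elts U0 \<longleftrightarrow> (\<forall>\<^sub>F y in filt U1. A \<in> elts (ap w y))"
    "\<forall>\<^sub>F y in filt U1. sep X0 (\<lambda>z. fin_le z y) \<in> elts (ap w y)"
    using K01 unfolding ketonen_def by blast
  obtain v where v: "\<And>x. x \<in> elts X2 \<Longrightarrow> uf X1 (ap v x)"
    "\<And>A. elts A \<subseteq> elts X1 \<Longrightarrow> A \<in> elts U1 \<longleftrightarrow> (\<forall>\<^sub>F x in filt U2. A \<in> elts (ap v x))"
    "\<forall>\<^sub>F x in filt U2. sep X1 (\<lambda>z. fin_le z x) \<in> elts (ap v x)"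
    using K12 unfolding ketonen_def by blast
  define u where "u = lam X2 (\<lambda>x. limit X1 (ap v x) X0 (ap w))"
  have DF: "DF (\<lambda>x. limit X1 (ap v x) X0 (ap w))" unfolding limit_def by (intro dfn)
  have u_elts: "elts (ap u x) = {A. elts A \<subseteq> elts X0 \<and> (\<forall>\<^sub>F y in filt (ap v x). A \<in> elts (ap w y))}"
    if "x \<in> elts X2" for x
    unfolding u_def ap_lam[OF DF that] by (rule elts_limit[OF v(1)[OF that] DF_ap])
  have D: "D1 (\<lambda>y. A \<in> elts (ap w y))" "D1 (\<lambda>z. fin_le z x)"
    "D1 (\<lambda>y. sep X0 (\<lambda>z. fin_le z y) \<in> elts (ap w y))" for A x by (intro dfn)+
  \<comment> \<open>A Fubini rule: as \<open>U1\<close> is the limit of the \<open>v x\<close>, its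
    quantifier splits into the one for \<open>U2\<close> followed by the one for
    \<open>ap v x\<close>.\<close>
  have ev_v: "(\<forall>\<^sub>F y in filt U1. P y) \<longleftrightarrow> (\<forall>\<^sub>F x in filt U2. \<forall>\<^sub>F y in filt (ap v x). P y)" if P: "D1 P" for P
  proof -
    have "elts (sep X1 P) \<subseteq> elts X1" unfolding elts_sep[OF P] by blast
    then have "(\<forall>\<^sub>F y in filt U1. P y) \<longleftrightarrow> (\<forall>\<^sub>F x in filt U2. sep X1 P \<in> elts (ap v x))"
      unfolding ev_iff[OF U1 P] by (rule v(2))
    also have "\<dots> \<longleftrightarrow> (\<forall>\<^sub>F x in filt U2. \<forall>\<^sub>F y in filt (ap v x). P y)"
      by (rule eventually_cong[OF ev_base[OF U2]]) (simp add: ev_iff[OF v(1) P])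
    finally show ?thesis .
  qed
  have 1: "uf X0 (ap u x)" if "x \<in> elts X2" for x
    unfolding u_def ap_lam[OF DF that] by (rule uf_limit[OF v(1)[OF that] DF_ap w(1)])
  have 2: "A \<in> elts U0 \<longleftrightarrow> (\<forall>\<^sub>F x in filt U2. A \<in> elts (ap u x))" if A: "elts A \<subseteq> elts X0" for A
  proof -
    have "A \<in> elts U0 \<longleftrightarrow> (\<forall>\<^sub>F x in filt U2. \<forall>\<^sub>F y in filt (ap v x). A \<in> elts (ap w y))"
      unfolding w(2)[OF A] by (rule ev_v[OF D(1)])
    also have "\<dots> \<longleftrightarrow> (\<forall>\<^sub>F x in filt U2. A \<in> elts (ap u x))"
      by (rule eventually_cong[OF ev_base[OF U2]]) (simp add: u_elts A)
    finally show ?thesis .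
  qed
  have "\<forall>\<^sub>F x in filt U2. \<forall>\<^sub>F y in filt (ap v x). sep X0 (\<lambda>z. fin_le z y) \<in> elts (ap w y)"
    using w(3) unfolding ev_v[OF D(3)] .
  with v(3) ev_base[OF U2] have 3: "\<forall>\<^sub>F x in filt U2. sep X0 (\<lambda>z. fin_le z x) \<in> elts (ap u x)"
  proof eventually_elim
    case (elim x)
    \<comment> \<open>For almost all \<open>y\<close> one has \<open>y\<close> below
      \<open>x\<close>, and then the initial segment of \<open>y\<close>, already measured by
      \<open>ap w y\<close>, is contained in that of \<open>x\<close>.\<close>
    have "\<forall>\<^sub>F y in filt (ap v x). fin_le y x"
      using elim(1) ev_iff[OF v(1)[OF elim(2)] D(2)] by simp
    with elim(3) ev_base[OF v(1)[OF elim(2)]]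
    have "\<forall>\<^sub>F y in filt (ap v x). sep X0 (\<lambda>z. fin_le z x) \<in> elts (ap w y)"
    proof eventually_elim
      fix y assume y: "sep X0 (\<lambda>z. fin_le z y) \<in> elts (ap w y)" "y \<in> elts X1" "fin_le y x"
      show "sep X0 (\<lambda>z. fin_le z x) \<in> elts (ap w y)"
      proof (rule uf_sup[OF w(1)[OF y(2)] y(1)])
        show "elts (sep X0 (\<lambda>z. fin_le z x)) \<subseteq> elts X0" unfolding elts_sep[OF D(2)] by blast
        show "elts (sep X0 (\<lambda>z. fin_le z y)) \<subseteq> elts (sep X0 (\<lambda>z. fin_le z x))"
          unfolding elts_sep[OF D(2)]
        proof clarify
          fix z assume z: "z \<in> elts X0" "fin_le z y"
          have "\<alpha> \<in> elts z \<union> elts y \<union> elts x \<Longrightarrow> ordinal \<alpha>" for \<alpha> using ord z(1) y(2) elim(2) by blast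
          from fin_le_trans[OF this z(2) y(3)] show "fin_le z x" .
        qed
      qed
    qed
    then show ?case unfolding u_elts[OF elim(2)] by (simp add: elts_sep[OF D(2)])
  qed
  from 1 2 3 show ?thesis unfolding ketonen_def by (intro exI[of _ u] conjI ballI allI impI)
qed

text \<open>On the product \<open>S\<close> the sum \<open>F\<close> projects to \<open>U1\<close>
  by \<open>pfst\<close> and to \<open>U0\<close> by \<open>psnd\<close>. The two factorizations of
  the single ultrapower by \<open>F\<close> form the comparison.\<close>

lemma ketonen_imp_E_le:
  assumes U0: "uf X0 U0" and U1: "uf X1 U1" and K: "ketonen X0 U0 X1 U1"
  shows "E_le U0 U1"
proof -
  obtain w where w: "\<And>x. x \<in> elts X1 \<Longrightarrow> uf X0 (ap w x)"
    "\<And>A. elts A \<subseteq> elts X0 \<Longrightarrow> A \<in> elts U0 \<longleftrightarrow> (\<forall>\<^sub>F x in filt U1. A \<in> elts (ap w x))"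
    "\<forall>\<^sub>F x in filt U1. sep X0 (\<lambda>z. fin_le z x) \<in> elts (ap w x)"
    using K unfolding ketonen_def by blast
  have X0: "DF (\<lambda>_. X0)" by (intro dfn)
  define S where "S = Sig X1 (\<lambda>_. X0)"
  have S: "elts S = {pair x z | x z. x \<in> elts X1 \<and> z \<in> elts X0}" unfolding S_def by (rule elts_Sig[OF X0])
  interpret s1: sectioned mem X1 U1 S pfst psnd unfolding S_def by (rule sectioned_Sig[OF U1 X0])
  have DP: "DF (pair x)" for x by (intro dfn)
  \<comment> \<open>\<open>ap w x\<close> is copied to the fibre over \<open>x\<close>, so that all
    these ultrafilters live on the same set \<open>S\<close> and a limit can be taken.\<close>
  define v where "v x = push X0 (ap w x) S (pair x)" for x
  have v: "DF v" unfolding v_def push_def by (intro dfn)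
  define fibres where "fibres = lam X1 v"
  \<comment> \<open>the sum of the \<open>w x\<close> along \<open>U1\<close>\<close>
  define F where "F = limit X1 U1 S (ap fibres)"
  have uf_v: "uf S (ap fibres x)" if "x \<in> elts X1" for x
    unfolding fibres_def ap_lam[OF v that] v_def
    by (rule uf_push[OF w(1)[OF that] DP]) (use that S in blast)
  have F: "uf S F" unfolding F_def by (rule uf_limit[OF U1 DF_ap uf_v])
  have F_iff: "A \<in> elts F \<longleftrightarrow> (\<forall>\<^sub>F x in filt U1. Sec pfst psnd A x \<in> elts (ap w x))" if A: "elts A \<subseteq> elts S" for A
  proof -
    have D: "D1 (\<lambda>\<sigma>. \<sigma> \<in> elts A)" by (intro dfn)
    have "sep S (\<lambda>\<sigma>. \<sigma> \<in> elts A) = A" by (rule extensionality) (use A in \<open>auto simp: elts_sep[OF D]\<close>)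
    then have Sec: "Sec pfst psnd A x = sep X0 (\<lambda>z. pair x z \<in> elts A)" if "x \<in> elts X1" for x
      using Sec_Sig[OF X0 D that, folded S_def] by simp
    have "A \<in> elts F \<longleftrightarrow> (\<forall>\<^sub>F x in filt U1. A \<in> elts (ap fibres x))"
      unfolding F_def elts_limit[OF U1 DF_ap] using A by simp
    also have "\<dots> \<longleftrightarrow> (\<forall>\<^sub>F x in filt U1. Sec pfst psnd A x \<in> elts (ap w x))"
    proof (rule eventually_cong[OF ev_base[OF U1]])
      fix x assume x: "x \<in> elts X1"
      show "A \<in> elts (ap fibres x) \<longleftrightarrow> Sec pfst psnd A x \<in> elts (ap w x)"
        unfolding fibres_def ap_lam[OF v x] v_def elts_push[OF DP] Sec[OF x] using A by simp
    qed
    finally show ?thesis .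
  qed
  have ev_F: "(\<forall>\<^sub>F \<sigma> in filt F. P \<sigma>) \<longleftrightarrow> (\<forall>\<^sub>F x in filt U1. sep X0 (\<lambda>z. P (pair x z)) \<in> elts (ap w x))" if P: "D1 P" for P
  proof -
    have "elts (sep S P) \<subseteq> elts S" unfolding elts_sep[OF P] by blast
    from F_iff[OF this]
    have "(\<forall>\<^sub>F \<sigma> in filt F. P \<sigma>) \<longleftrightarrow> (\<forall>\<^sub>F x in filt U1. Sec pfst psnd (sep S P) x \<in> elts (ap w x))"
      unfolding ev_iff[OF F P] .
    also have "\<dots> \<longleftrightarrow> (\<forall>\<^sub>F x in filt U1. sep X0 (\<lambda>z. P (pair x z)) \<in> elts (ap w x))"
      by (rule eventually_cong[OF ev_base[OF U1]]) (simp add: Sec_Sig[OF X0 P, where X = X1, folded S_def])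
    finally show ?thesis .
  qed
  interpret f1: factored mem X1 U1 S pfst psnd F
  proof unfold_locales
    show "uf S F" by (rule F)
    fix A assume A: "A \<in> elts U1"
    have D: "D1 (\<lambda>\<sigma>. pfst \<sigma> \<in> elts A)" by (intro dfn)
    have DT: "D1 (\<lambda>z. x \<in> elts A)" for x by (intro dfn)
    show "\<forall>\<^sub>F \<sigma> in filt F. pfst \<sigma> \<in> elts A"
      unfolding ev_F[OF D] using ev_mem[OF U1 A] ev_base[OF U1]
    proof eventually_elim
      case (elim x)
      have "sep X0 (\<lambda>z. x \<in> elts A) = X0" by (rule extensionality, subst elts_sep[OF DT]) (use elim(1) in simp)
      then show ?case using uf_top[OF w(1)[OF elim(2)]] by simp
    qed
  qed
  interpret f0: factored mem X0 U0 S psnd pfst F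
  proof unfold_locales
    show "uf X0 U0" "uf S F" "DF psnd" "DF pfst" by (rule U0 F s1.q s1.r)+
    show "\<sigma> \<in> elts S \<Longrightarrow> psnd \<sigma> \<in> elts X0" for \<sigma> unfolding S by auto
    show "\<sigma> \<in> elts S \<Longrightarrow> \<tau> \<in> elts S \<Longrightarrow> psnd \<sigma> = psnd \<tau> \<Longrightarrow> pfst \<sigma> = pfst \<tau> \<Longrightarrow> \<sigma> = \<tau>" for \<sigma> \<tau>
      using s1.qr_inj by metis
    fix A assume A: "A \<in> elts U0"
    have AX: "elts A \<subseteq> elts X0" by (rule uf_sub[OF U0 A])
    have D: "D1 (\<lambda>\<sigma>. psnd \<sigma> \<in> elts A)" "D1 (\<lambda>z. z \<in> elts A)" by (intro dfn)+
    have "sep X0 (\<lambda>z. z \<in> elts A) = A" by (rule extensionality) (use AX in \<open>auto simp: elts_sep[OF D(2)]\<close>)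
    \<comment> \<open>All fibres are copies of \<open>X0\<close>, so a condition on
      \<open>psnd\<close> alone is measured by \<open>ap w x\<close> directly, and the limit clause
      of \<open>ketonen\<close> is the projection to \<open>U0\<close>.\<close>
    then show "\<forall>\<^sub>F \<sigma> in filt F. psnd \<sigma> \<in> elts A"
      unfolding ev_F[OF D(1)] using w(2)[OF AX] A by simp
  qed
  let ?W0 = "quot X0 U0 psnd pfst F" and ?W1 = "quot X1 U1 pfst psnd F"
  have C: "DF (\<lambda>_. c)" for c by (intro dfn)
  have Y: "ult_emb (Ult UNIV U0) ?W0 (ult_emb UNIV U0 c) = cls S F (\<lambda>_. c)"
    "ult_emb (Ult UNIV U1) ?W1 (ult_emb UNIV U1 c) = cls S F (\<lambda>_. c)" for c
    unfolding ult_emb_uf[OF U0] ult_emb_uf[OF U1] f0.ult_emb_quot[OF C] f1.ult_emb_quot[OF C] by (rule refl)+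
  have "external_comparison U0 U1 ?W0 ?W1"
    unfolding external_comparison_def Let_def
  proof (intro conjI)
    show "\<exists>X. cc_ultrafilter (Ult UNIV U0) X ?W0" by (rule exI[of _ "cls X0 U0 (Sec psnd pfst S)"]) (rule f0.cc_ultrafilter_quot)
    show "\<exists>X. cc_ultrafilter (Ult UNIV U1) X ?W1" by (rule exI[of _ "cls X1 U1 (Sec pfst psnd S)"]) (rule f1.cc_ultrafilter_quot)
    show "ult_wellfounded (Ult UNIV U0) ?W0" by (rule f0.ult_wellfounded_quot)
    show "ult_wellfounded (Ult UNIV U1) ?W1" by (rule f1.ult_wellfounded_quot)
    show "Ult (Ult UNIV U0) ?W0 = Ult (Ult UNIV U1) ?W1" unfolding f0.Ult_quot f1.Ult_quot ..
    show "ult_emb (Ult UNIV U0) ?W0 \<circ> ult_emb UNIV U0 = ult_emb (Ult UNIV U1) ?W1 \<circ> ult_emb UNIV U1"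
      by (rule ext) (simp only: comp_apply Y)
  qed
  moreover have "one_internal U1 ?W1"
  proof -
    \<comment> \<open>A set belongs to \<open>F\<close> iff almost all its fibres are in
      \<open>ap w x\<close>, so the quotient is the class of the sequence of these ultrafilters.
      This is internality.\<close>
    have "?W1 = cls X1 U1 (ap w)"
    proof (rule extensionality, intro equalityI subsetI)
      fix y assume "y \<in> elts ?W1"
      then obtain A where A: "A \<in> elts F" "y = cls X1 U1 (Sec pfst psnd A)" unfolding s1.elts_quot by blast
      show "y \<in> elts (cls X1 U1 (ap w))"
        unfolding A(2) mem_cls_iff[OF U1 DF_ap s1.DF_Sec] using A(1) F_iff[OF uf_sub[OF F A(1)]] by simp
    next
      fix y assume "y \<in> elts (cls X1 U1 (ap w))"
      then obtain a where a: "DF a" "y = cls X1 U1 a" "\<forall>\<^sub>F x in filt U1. a x \<in> elts (ap w x)"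
        using DF_ap by (rule cls_memE[OF U1])
      from a(3) ev_base[OF U1] have "\<forall>\<^sub>F x in filt U1. elts (a x) \<subseteq> elts (Sec pfst psnd S x)"
      proof eventually_elim
        case (elim x)
        then show ?case using uf_sub[OF w(1)[OF elim(2)] elim(1)]
          unfolding S_def Sec_Sig_top[OF X0 elim(2)] by blast
      qed
      then have "elts y \<subseteq> elts (cls X1 U1 (Sec pfst psnd S))"
        unfolding a(2) cls_subset_iff[OF U1 a(1) s1.DF_Sec] .
      moreover have "y \<in> Ult UNIV U1" unfolding a(2) by (rule s1.cls_in_Ult[OF a(1)])
      ultimately obtain A where A: "elts A \<subseteq> elts S" "y = cls X1 U1 (Sec pfst psnd A)"
        using s1.subset_of_quot_base by blast
      have "\<forall>\<^sub>F x in filt U1. a x = Sec pfst psnd A x"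
        using A(2) unfolding a(2) cls_eq_iff[OF U1 a(1) s1.DF_Sec] .
      with a(3) have "\<forall>\<^sub>F x in filt U1. Sec pfst psnd A x \<in> elts (ap w x)" by eventually_elim simp
      then show "y \<in> elts ?W1" unfolding A(2) f1.quot_mem_iff[OF A(1)] F_iff[OF A(1)] .
    qed
    then show ?thesis unfolding one_internal_def using s1.cls_in_Ult[OF DF_ap] by simp
  qed
  moreover have "fin_le (ult_emb (Ult UNIV U0) ?W0 (ult_id UNIV U0)) (ult_emb (Ult UNIV U1) ?W1 (ult_id UNIV U1))"
  proof -
    have I: "DF (\<lambda>x. x)" by (intro dfn)
    have D: "D1 (\<lambda>\<sigma>. fin_le (psnd \<sigma>) (pfst \<sigma>))" by (intro dfn)
    have P: "DF (\<lambda>\<sigma>. psnd \<sigma>)" "DF (\<lambda>\<sigma>. pfst \<sigma>)" by (intro dfn)+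
    show ?thesis
      unfolding ult_id_uf[OF U0] ult_id_uf[OF U1] f0.ult_emb_quot[OF I] f1.ult_emb_quot[OF I] fin_le_cls[OF F P] ev_F[OF D]
      using w(3) by simp
  qed
  ultimately show ?thesis unfolding E_le_def by blast
qed

text \<open>
  An ultrafilter of \<open>Ult V U\<close> is represented by a sequence of ultrafilters almost everywhere, since
  otherwise a choice of counterexamples would represent one for the quotient.
\<close>

lemma internal_quot_uf:
  assumes U: "uf X U" and Y: "DF Y" and fac: "factored mem X U (Sig X Y) pfst psnd F"
    and w: "DF w" and W: "quot X U pfst psnd F = cls X U w"
  shows "\<forall>\<^sub>F x in filt U. uf (Y x) (w x)"
proof -
  define S where "S = Sig X Y"
  interpret f: factored mem X U S pfst psnd F unfolding S_def by (rule fac)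
  note [dfn] = DFI[OF Y] DFI[OF w]
  have F_iff: "A \<in> elts F \<longleftrightarrow> (\<forall>\<^sub>F x in filt U. Sec pfst psnd A x \<in> elts (w x))" if "elts A \<subseteq> elts S" for A
    using f.quot_mem_iff[OF that] unfolding W mem_cls_iff[OF U w f.DF_Sec] by blast
  have sepS: "elts (sep S P) \<subseteq> elts S" if "D1 P" for P unfolding elts_sep[OF that] by blast
  have F_sep: "(\<forall>\<^sub>F \<sigma> in filt F. P (pfst \<sigma>) (psnd \<sigma>)) \<longleftrightarrow> (\<forall>\<^sub>F x in filt U. sep (Y x) (P x) \<in> elts (w x))"
    if P: "D2 P" for P
  proof -
    note [dfn] = D2I[OF P]
    have D: "D1 (\<lambda>\<sigma>. P (pfst \<sigma>) (psnd \<sigma>))" by (intro dfn)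
    have "Sec pfst psnd (sep S (\<lambda>\<sigma>. P (pfst \<sigma>) (psnd \<sigma>))) x = sep (Y x) (P x)" if "x \<in> elts X" for x
      using Sec_Sig[OF Y D that] unfolding S_def by simp
    then show ?thesis unfolding ev_iff[OF f.F D] F_iff[OF sepS[OF D]]
      by (intro eventually_cong[OF ev_base[OF U]]) simp
  qed
  \<comment> \<open>\<open>Q1\<close>, \<open>Q2\<close> and \<open>Q3\<close> are the failures of
    the three clauses of \<open>uf\<close> at \<open>x\<close>. A failure of the third involves a
    sequence and a set; \<open>B3 x\<close> bounds such pairs by a set so that they can be
    chosen.\<close>
  define Q1 where "Q1 x A \<longleftrightarrow> \<not> elts A \<subseteq> elts (Y x)" for x A
  define Q2 where "Q2 x A \<longleftrightarrow> (A \<in> elts (w x) \<longleftrightarrow> dif (Y x) A \<in> elts (w x))" for x A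
  define Q3 where "Q3 x p \<longleftrightarrow> psnd p \<notin> elts (w x) \<and>
    (\<forall>y \<in> elts (Y x). (\<forall>n. natural n \<longrightarrow> y \<in> elts (ap (pfst p) n)) \<longrightarrow> y \<in> elts (psnd p))" for x p
  define B3 where "B3 x = Sig (funs omega (w x)) (\<lambda>_. pow (Y x))" for x
  have Q: "D2 Q1" "D2 Q2" "D2 Q3" unfolding Q1_def Q2_def Q3_def by (intro dfn)+
  have B3: "DF B3" unfolding B3_def by (intro dfn)
  have B3_elts: "elts (B3 x) = {pair f B | f B. is_fun f omega \<and> (\<forall>n. natural n \<longrightarrow> ap f n \<in> elts (w x)) \<and> elts B \<subseteq> elts (Y x)}" for x
    unfolding B3_def elts_Sig[OF DT_const] elts_funs by auto
  note [dfn] = D2I[OF Q(1)] D2I[OF Q(2)] D2I[OF Q(3)] DFI[OF B3]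
  have no: "\<forall>\<^sub>F x in filt U. \<not> (\<exists>y \<in> elts (B x). P x y)"
    if P: "D2 P" and B: "DF B" and c: "\<And>a. \<forall>\<^sub>F x in filt U. ap a x \<in> elts (B x) \<and> P x (ap a x) \<Longrightarrow> False" for P B
  proof (rule ccontr)
    assume *: "\<not> ?thesis"
    note [dfn] = D2I[OF P] DFI[OF B]
    have D: "D1 (\<lambda>x. \<exists>y \<in> elts (B x). P x y)" by (intro dfn)
    from * have "\<forall>\<^sub>F x in filt U. \<exists>y \<in> elts (B x). P x y" unfolding ev_not[OF U D] by blast
    from ev_choice[OF U P B this] c show False by blast
  qed
  have 1: "\<forall>\<^sub>F x in filt U. \<not> (\<exists>A \<in> elts (w x). Q1 x A)"
  proof (rule no[OF Q(1) w])
    fix a assume a: "\<forall>\<^sub>F x in filt U. ap a x \<in> elts (w x) \<and> Q1 x (ap a x)"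
    then have "\<forall>\<^sub>F x in filt U. ap a x \<in> elts (w x)" by eventually_elim simp
    then have "cls X U (ap a) \<in> elts (quot X U pfst psnd F)" unfolding W mem_cls_iff[OF U w DF_ap] .
    from cc_ultrafilterD(5)[OF f.cc_ultrafilter_quot this]
    have "\<forall>\<^sub>F x in filt U. elts (ap a x) \<subseteq> elts (Sec pfst psnd S x)"
      unfolding cls_subset_iff[OF U DF_ap f.DF_Sec] .
    with a ev_base[OF U] have "\<forall>\<^sub>F x in filt U. False"
    proof eventually_elim
      case (elim x)
      then show ?case using Sec_Sig_top[OF Y, of x X] unfolding S_def Q1_def by simp
    qed
    then show False using ev_False[OF U] by contradiction
  qed
  have powY: "DF (\<lambda>x. pow (Y x))" by (intro dfn)
  have 2: "\<forall>\<^sub>F x in filt U. \<not> (\<exists>A \<in> elts (pow (Y x)). Q2 x A)"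
  proof (rule no[OF Q(2) powY])
    fix a assume a: "\<forall>\<^sub>F x in filt U. ap a x \<in> elts (pow (Y x)) \<and> Q2 x (ap a x)"
    have P: "D2 (\<lambda>x y. y \<in> elts (ap a x))" "D2 (\<lambda>x y. y \<notin> elts (ap a x))" by (intro dfn)+
    have D: "D1 (\<lambda>y. y \<in> elts (ap a x))" "D1 (\<lambda>y. y \<notin> elts (ap a x))" for x by (intro dfn)+
    have D': "D1 (\<lambda>\<sigma>. psnd \<sigma> \<in> elts (ap a (pfst \<sigma>)))" by (intro dfn)
    have "(\<forall>\<^sub>F x in filt U. sep (Y x) (\<lambda>y. y \<in> elts (ap a x)) \<in> elts (w x)) \<longleftrightarrow>
        (\<forall>\<^sub>F x in filt U. sep (Y x) (\<lambda>y. y \<notin> elts (ap a x)) \<in> elts (w x))"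
    proof (rule eventually_cong[OF a])
      fix x assume x: "ap a x \<in> elts (pow (Y x)) \<and> Q2 x (ap a x)"
      have "sep (Y x) (\<lambda>y. y \<in> elts (ap a x)) = ap a x"
        by (rule extensionality) (use x in \<open>auto simp: elts_sep[OF D(1)]\<close>)
      moreover have "sep (Y x) (\<lambda>y. y \<notin> elts (ap a x)) = dif (Y x) (ap a x)" unfolding dif_def ..
      ultimately show "sep (Y x) (\<lambda>y. y \<in> elts (ap a x)) \<in> elts (w x) \<longleftrightarrow> sep (Y x) (\<lambda>y. y \<notin> elts (ap a x)) \<in> elts (w x)"
        using x unfolding Q2_def by simp
    qed
    \<comment> \<open>The subset of \<open>S\<close> with fibres \<open>ap a x\<close> would be in
      \<open>F\<close> exactly when its complement is.\<close>
    then show False unfolding F_sep[OF P(1), symmetric] F_sep[OF P(2), symmetric] ev_not[OF f.F D'] by blast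
  qed
  have 3: "\<forall>\<^sub>F x in filt U. \<not> (\<exists>p \<in> elts (B3 x). Q3 x p)"
  proof (rule no[OF Q(3) B3])
    fix a assume a: "\<forall>\<^sub>F x in filt U. ap a x \<in> elts (B3 x) \<and> Q3 x (ap a x)"
    have P: "D2 (\<lambda>x y. y \<in> elts (ap (pfst (ap a x)) n))" "D2 (\<lambda>x y. y \<in> elts (psnd (ap a x)))"
      "D2 (\<lambda>n \<sigma>. psnd \<sigma> \<in> elts (ap (pfst (ap a (pfst \<sigma>))) n))" for n by (intro dfn)+
    have D: "D1 (\<lambda>y. y \<in> elts A)" for A by (intro dfn)
    have mem: "\<forall>\<^sub>F \<sigma> in filt F. psnd \<sigma> \<in> elts (ap (pfst (ap a (pfst \<sigma>))) n)" if n: "natural n" for n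
      unfolding F_sep[OF P(1)] using a 1
    proof eventually_elim
      case (elim x)
      from elim(1) obtain g B where g: "ap a x = pair g B" "\<forall>n. natural n \<longrightarrow> ap g n \<in> elts (w x)"
        unfolding B3_elts by blast
      then have gn: "ap g n \<in> elts (w x)" using n by blast
      with elim(2) have "elts (ap g n) \<subseteq> elts (Y x)" unfolding Q1_def by blast
      then have "sep (Y x) (\<lambda>y. y \<in> elts (ap g n)) = ap g n"
        by (intro extensionality) (auto simp: elts_sep[OF D])
      with gn g(1) show ?case by simp
    qed
    \<comment> \<open>The completeness of \<open>F\<close> intersects the chosen sequences in all
      fibres at once; the chosen supersets then get measure one as well, against their
      choice.\<close>
    have "\<forall>\<^sub>F \<sigma> in filt F. \<forall>n. natural n \<longrightarrow> psnd \<sigma> \<in> elts (ap (pfst (ap a (pfst \<sigma>))) n)"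
      by (rule ev_omega[OF f.F P(3)]) (rule mem)
    with f.ev_proj[OF a] ev_base[OF f.F] have "\<forall>\<^sub>F \<sigma> in filt F. psnd \<sigma> \<in> elts (psnd (ap a (pfst \<sigma>)))"
    proof eventually_elim
      case (elim \<sigma>)
      have "psnd \<sigma> \<in> elts (Y (pfst \<sigma>))" using elim(2) unfolding S_def elts_Sig[OF Y] by auto
      then show ?case using elim(1,3) unfolding Q3_def by blast
    qed
    then have "\<forall>\<^sub>F x in filt U. sep (Y x) (\<lambda>y. y \<in> elts (psnd (ap a x))) \<in> elts (w x)"
      unfolding F_sep[OF P(2)] .
    with a have "\<forall>\<^sub>F x in filt U. False"
    proof eventually_elim
      case (elim x)
      from elim(1) obtain g B where g: "ap a x = pair g B" "elts B \<subseteq> elts (Y x)" "B \<notin> elts (w x)"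
        unfolding B3_elts Q3_def by auto
      then have "sep (Y x) (\<lambda>y. y \<in> elts B) = B"
        by (intro extensionality) (auto simp: elts_sep[OF D])
      with elim(2) g show ?case by simp
    qed
    then show False using ev_False[OF U] by contradiction
  qed
  from 1 2 3 show ?thesis
  proof eventually_elim
    case (elim x)
    show ?case unfolding uf_def
    proof (intro conjI ballI allI impI)
      show "A \<in> elts (w x) \<Longrightarrow> elts A \<subseteq> elts (Y x)" for A using elim(1) unfolding Q1_def by blast
      show "A \<in> elts (w x) \<longleftrightarrow> dif (Y x) A \<notin> elts (w x)" if "elts A \<subseteq> elts (Y x)" for A
      proof -
        from that have "A \<in> elts (pow (Y x))" by simp
        with elim(2) have "\<not> Q2 x A" by blast
        then show ?thesis unfolding Q2_def by blast
      qed
      fix f B assume *: "(\<forall>n\<in>elts omega. ap f n \<in> elts (w x)) \<and> elts B \<subseteq> elts (Y x) \<and>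
        (\<forall>y\<in>elts (Y x). (\<forall>n\<in>elts omega. y \<in> elts (ap f n)) \<longrightarrow> y \<in> elts B)"
      let ?f = "lam omega (ap f)"
      have f: "is_fun ?f omega" by (rule is_fun_lam[OF DF_ap])
      have ap: "ap ?f n = ap f n" if "natural n" for n using that ap_lam[OF DF_ap, of n omega] by simp
      have "pair ?f B \<in> elts (B3 x)" unfolding B3_elts using f ap * by auto
      with elim(3) have "\<not> Q3 x (pair ?f B)" by blast
      then show "B \<in> elts (w x)" using * ap by (simp add: Q3_def)
    qed
  qed
qed

text \<open>Internality provides ultrafilters \<open>w x\<close> on the fibres of \<open>F\<close>;
  their images under a representative of the image of \<open>[id]\<close> of \<open>U0\<close> are
  the ultrafilters sought.\<close>

lemma E_le_imp_ketonen:
  assumes U0: "uf X0 U0" and U1: "uf X1 U1" and E: "E_le U0 U1"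
  shows "ketonen X0 U0 X1 U1"
proof -
  obtain W0 W1 where ext: "external_comparison U0 U1 W0 W1" and int: "W1 \<in> Ult UNIV U1"
    and le: "fin_le (ult_emb (Ult UNIV U0) W0 (ult_id UNIV U0)) (ult_emb (Ult UNIV U1) W1 (ult_id UNIV U1))"
    using E unfolding E_le_def one_internal_def by blast
  obtain X0' X1' where cc: "cc_ultrafilter (Ult UNIV U0) X0' W0" "cc_ultrafilter (Ult UNIV U1) X1' W1"
    and Ult: "Ult (Ult UNIV U0) W0 = Ult (Ult UNIV U1) W1"
    and emb: "ult_emb (Ult UNIV U0) W0 \<circ> ult_emb UNIV U0 = ult_emb (Ult UNIV U1) W1 \<circ> ult_emb UNIV U1"
    using ext unfolding external_comparison_def Let_def by blast
  obtain Y0 F0 where Y0: "DF Y0" "factored mem X0 U0 (Sig X0 Y0) pfst psnd F0" "W0 = quot X0 U0 pfst psnd F0"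
    using cc_ultrafilter_factored[OF U0 cc(1)] by blast
  obtain Y F where Y: "DF Y" "factored mem X1 U1 (Sig X1 Y) pfst psnd F" "W1 = quot X1 U1 pfst psnd F"
    using cc_ultrafilter_factored[OF U1 cc(2)] by blast
  obtain w where w: "DF w" "W1 = cls X1 U1 w" using int unfolding Ult_uf[OF U1] by blast
  define S0 S where "S0 = Sig X0 Y0" and "S = Sig X1 Y"
  interpret f0: factored mem X0 U0 S0 pfst psnd F0 unfolding S0_def by (rule Y0(2))
  interpret f: factored mem X1 U1 S pfst psnd F unfolding S_def by (rule Y(2))
  have C: "DF (\<lambda>_. c)" for c by (intro dfn)
  have I: "DF (\<lambda>x. x)" by (intro dfn)
  have P: "DF (\<lambda>\<sigma>. pfst \<sigma>)" by (intro dfn)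
  \<comment> \<open>The commutativity of the comparison, read in the two ultrapowers of the
    universe.\<close>
  have const: "cls S0 F0 (\<lambda>_. c) = cls S F (\<lambda>_. c)" for c
    using fun_cong[OF emb, of c]
    unfolding comp_apply ult_emb_uf[OF U0] ult_emb_uf[OF U1] Y0(3) Y(3) f0.ult_emb_quot[OF C] f.ult_emb_quot[OF C] .
  have id: "ult_emb (Ult UNIV U0) W0 (ult_id UNIV U0) = cls S0 F0 (\<lambda>\<sigma>. pfst \<sigma>)"
    "ult_emb (Ult UNIV U1) W1 (ult_id UNIV U1) = cls S F (\<lambda>\<sigma>. pfst \<sigma>)"
    unfolding ult_id_uf[OF U0] ult_id_uf[OF U1] Y0(3) Y(3) f0.ult_emb_quot[OF I] f.ult_emb_quot[OF I] by (rule refl)+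
  have "cls S0 F0 (\<lambda>\<sigma>. pfst \<sigma>) \<in> Ult UNIV F"
  proof -
    have "Ult UNIV F0 = Ult UNIV F" using Ult unfolding Y0(3) Y(3) f0.Ult_quot f.Ult_quot .
    then show ?thesis using Ult_uf[OF f0.F] P by blast
  qed
  then obtain g0 where g0: "DF g0" "cls S0 F0 (\<lambda>\<sigma>. pfst \<sigma>) = cls S F g0" unfolding Ult_uf[OF f.F] by blast
  note [dfn] = DFI[OF g0(1)] DFI[OF w(1)] DFI[OF Y(1)]
  \<comment> \<open>A set is in \<open>U0\<close> iff its image under the common embedding contains
    the distinguished point; evaluating this modulo \<open>F0\<close> and modulo \<open>F\<close>
    gives the two sides.\<close>
  have U0_iff: "A \<in> elts U0 \<longleftrightarrow> (\<forall>\<^sub>F \<sigma> in filt F. g0 \<sigma> \<in> elts A)" if A: "elts A \<subseteq> elts X0" for A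
  proof -
    have D: "D1 (\<lambda>x. x \<in> elts A)" by (intro dfn)
    have "A \<in> elts U0 \<longleftrightarrow> (\<forall>\<^sub>F \<sigma> in filt F0. pfst \<sigma> \<in> elts A)"
      unfolding mem_ev[OF U0 A] f0.ev_proj_iff[OF D] ..
    also have "\<dots> \<longleftrightarrow> cls S0 F0 (\<lambda>\<sigma>. pfst \<sigma>) \<in> elts (cls S0 F0 (\<lambda>_. A))" unfolding mem_cls_iff[OF f0.F C P] ..
    also have "\<dots> \<longleftrightarrow> (\<forall>\<^sub>F \<sigma> in filt F. g0 \<sigma> \<in> elts A)" unfolding const g0(2) mem_cls_iff[OF f.F C g0(1)] ..
    finally show ?thesis .
  qed
  obtain d where d: "d \<in> elts X0" using uf_top[OF U0] uf_emp[OF U0] by (metis elts_eq_empty ex_in_conv)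
  \<comment> \<open>\<open>g0\<close> takes values in \<open>X0\<close> only almost everywhere,
    whereas the image ultrafilters must live on \<open>X0\<close>; an arbitrary point
    \<open>d\<close> serves as default.\<close>
  define g where "g \<sigma> = (if g0 \<sigma> \<in> elts X0 then g0 \<sigma> else d)" for \<sigma>
  have g: "DF g" unfolding g_def by (intro dfn)
  note [dfn] = DFI[OF g]
  have gX0: "g \<sigma> \<in> elts X0" for \<sigma> unfolding g_def using d by simp
  have "\<forall>\<^sub>F \<sigma> in filt F. g0 \<sigma> \<in> elts X0" using U0_iff[of X0] uf_top[OF U0] by simp
  then have g_eq: "\<forall>\<^sub>F \<sigma> in filt F. g0 \<sigma> = g \<sigma>" by eventually_elim (simp add: g_def)
  have "\<forall>\<^sub>F \<sigma> in filt F. fin_le (g0 \<sigma>) (pfst \<sigma>)" using le unfolding id g0(2) fin_le_cls[OF f.F g0(1) P] .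
  with g_eq have le': "\<forall>\<^sub>F \<sigma> in filt F. fin_le (g \<sigma>) (pfst \<sigma>)" by eventually_elim simp
  have ev_F: "(\<forall>\<^sub>F \<sigma> in filt F. P \<sigma>) \<longleftrightarrow> (\<forall>\<^sub>F x in filt U1. sep (Y x) (\<lambda>y. P (pair x y)) \<in> elts (w x))" if P: "D1 P" for P
  proof -
    have S: "elts (sep S P) \<subseteq> elts S" unfolding elts_sep[OF P] by blast
    have "(\<forall>\<^sub>F \<sigma> in filt F. P \<sigma>) \<longleftrightarrow> (\<forall>\<^sub>F x in filt U1. Sec pfst psnd (sep S P) x \<in> elts (w x))"
      using f.quot_mem_iff[OF S] unfolding ev_iff[OF f.F P] Y(3)[symmetric] w(2) mem_cls_iff[OF U1 w(1) f.DF_Sec] by blast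
    also have "\<dots> \<longleftrightarrow> (\<forall>\<^sub>F x in filt U1. sep (Y x) (\<lambda>y. P (pair x y)) \<in> elts (w x))"
      by (rule eventually_cong[OF ev_base[OF U1]]) (simp add: Sec_Sig[OF Y(1) P, where X = X1, folded S_def])
    finally show ?thesis .
  qed
  have good: "\<forall>\<^sub>F x in filt U1. uf (Y x) (w x)"
    by (rule internal_quot_uf[OF U1 Y(1,2) w(1)]) (use Y(3) w(2) in simp)
  \<comment> \<open>Over the null set where \<open>w x\<close> is not an ultrafilter,
    \<open>U0\<close> is a convenient ultrafilter on \<open>X0\<close>, so that \<open>v x\<close>
    is one for every \<open>x\<close>.\<close>
  define v where "v x = (if uf (Y x) (w x) then push (Y x) (w x) X0 (\<lambda>y. g (pair x y)) else U0)" for x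
  have v: "DF v" unfolding v_def push_def by (intro dfn)
  have D: "DF (\<lambda>y. g (pair x y))" "D1 (\<lambda>z. fin_le z x)" "D1 (\<lambda>\<sigma>. fin_le (g \<sigma>) (pfst \<sigma>))"
    "D1 (\<lambda>\<sigma>. g \<sigma> \<in> elts A)" for x A by (intro dfn)+
  have uf_v: "uf X0 (v x)" for x
    unfolding v_def using uf_push[OF _ D(1) gX0] U0 by simp
  have v_mem: "\<forall>\<^sub>F x in filt U1. \<forall>A. A \<in> elts (v x) \<longleftrightarrow> elts A \<subseteq> elts X0 \<and> sep (Y x) (\<lambda>y. g (pair x y) \<in> elts A) \<in> elts (w x)"
    using good by eventually_elim (simp add: v_def elts_push[OF D(1)])
  have lim: "A \<in> elts U0 \<longleftrightarrow> (\<forall>\<^sub>F x in filt U1. A \<in> elts (v x))" if A: "elts A \<subseteq> elts X0" for A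
  proof -
    have "A \<in> elts U0 \<longleftrightarrow> (\<forall>\<^sub>F \<sigma> in filt F. g \<sigma> \<in> elts A)"
      unfolding U0_iff[OF A] by (rule eventually_cong[OF g_eq]) simp
    also have "\<dots> \<longleftrightarrow> (\<forall>\<^sub>F x in filt U1. A \<in> elts (v x))"
      unfolding ev_F[OF D(4)] by (rule eventually_cong[OF v_mem]) (use A in simp)
    finally show ?thesis .
  qed
  have below: "\<forall>\<^sub>F x in filt U1. sep X0 (\<lambda>z. fin_le z x) \<in> elts (v x)"
    using v_mem le'[unfolded ev_F[OF D(3)]]
  proof eventually_elim
    case (elim x)
    have D': "D1 (\<lambda>y. fin_le (g (pair x y)) x)" "D1 (\<lambda>y. g (pair x y) \<in> elts (sep X0 (\<lambda>z. fin_le z x)))" by (intro dfn)+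
    have "sep (Y x) (\<lambda>y. g (pair x y) \<in> elts (sep X0 (\<lambda>z. fin_le z x))) = sep (Y x) (\<lambda>y. fin_le (g (pair x y)) x)"
      by (rule extensionality) (auto simp: elts_sep[OF D'(1)] elts_sep[OF D'(2)] elts_sep[OF D(2)] gX0)
    moreover have "elts (sep X0 (\<lambda>z. fin_le z x)) \<subseteq> elts X0" unfolding elts_sep[OF D(2)] by blast
    ultimately show ?case using elim by simp
  qed
  have ap: "ap (lam X1 v) x = v x" if "x \<in> elts X1" for x by (rule ap_lam[OF v that])
  have ev_ap: "(\<forall>\<^sub>F x in filt U1. Q x (ap (lam X1 v) x)) \<longleftrightarrow> (\<forall>\<^sub>F x in filt U1. Q x (v x))" for Q
    by (rule eventually_cong[OF ev_base[OF U1]]) (simp add: ap)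
  show ?thesis unfolding ketonen_def
  proof (intro exI[of _ "lam X1 v"] conjI ballI allI impI)
    show "uf X0 (ap (lam X1 v) x)" if "x \<in> elts X1" for x unfolding ap[OF that] by (rule uf_v)
    show "A \<in> elts U0 \<longleftrightarrow> (\<forall>\<^sub>F x in filt U1. A \<in> elts (ap (lam X1 v) x))" if "elts A \<subseteq> elts X0" for A
      unfolding ev_ap[of "\<lambda>_ V. A \<in> elts V"] by (rule lim[OF that])
    show "\<forall>\<^sub>F x in filt U1. sep X0 (\<lambda>z. fin_le z x) \<in> elts (ap (lam X1 v) x)"
      unfolding ev_ap[of "\<lambda>x V. sep X0 (\<lambda>z. fin_le z x) \<in> elts V"] by (rule below)
  qed
qed

theorem E_le_trans:
  assumes "uniform_ultrafilter U0" "uniform_ultrafilter U1" "uniform_ultrafilter U2"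
    and "E_le U0 U1" "E_le U1 U2"
  shows "E_le U0 U2"
proof -
  from uniform_ultrafilter_uf[OF assms(1)] obtain X0
    where 0: "uf X0 U0" "\<forall>x \<in> elts X0. \<forall>\<alpha> \<in> elts x. ordinal \<alpha>" by blast
  from uniform_ultrafilter_uf[OF assms(2)] obtain X1
    where 1: "uf X1 U1" "\<forall>x \<in> elts X1. \<forall>\<alpha> \<in> elts x. ordinal \<alpha>" by blast
  from uniform_ultrafilter_uf[OF assms(3)] obtain X2
    where 2: "uf X2 U2" "\<forall>x \<in> elts X2. \<forall>\<alpha> \<in> elts x. ordinal \<alpha>" by blast
  have "ketonen X0 U0 X2 U2"
  proof (rule ketonen_trans[OF 0(1) 1(1) 2(1)])
    show "\<alpha> \<in> elts x \<Longrightarrow> ordinal \<alpha>" if "x \<in> elts X0 \<union> elts X1 \<union> elts X2" for x \<alpha>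
      using that 0(2) 1(2) 2(2) by blast
  qed (use E_le_imp_ketonen 0(1) 1(1) 2(1) assms(4,5) in blast)+
  then show ?thesis by (rule ketonen_imp_E_le[OF 0(1) 2(1)])
qed

end

theorem theorem7p8:
  fixes mem :: "'v \<Rightarrow> 'v \<Rightarrow> bool"
    and U0 U1 U2 :: 'v
  assumes "ZFC_model mem"
    and "membership.uniform_ultrafilter mem U0"
    and "membership.uniform_ultrafilter mem U1"
    and "membership.uniform_ultrafilter mem U2"
    and "membership.E_le mem U0 U1"
    and "membership.E_le mem U1 U2"
  shows "membership.E_le mem U0 U2"
  using assms by (rule ZFC_model.E_le_trans)

end
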